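(* Let $n\ge 3$. If a linear equation in standard form $$y^{(n)}+c_{n-1}(x)\,y^{(n-1)}+c_{n-2}(x)\,y^{(n-2)}+\dots+c_0(x)\,y=0$$ has a maximal symmetry algebra, then in its general form it may be expressed in terms of only two arbitrary functions, namely $c_{n-1}$ and $c_{n-2}$, and their derivatives. That is, for each $n\ge 3$ there are functions $F_0,\dots,F_{n-3}$ (depending only on $n$), each a function of finitely many of the variables $c_{n-1},c_{n-1}',c_{n-1}'',\dots,c_{n-2},c_{n-2}',c_{n-2}'',\dots$, such that every equation of the form $y^{(n)}+c_{n-1}(x)\,y^{(n-1)}+c_{n-2}(x)\,y^{(n-2)}+\dots+c_0(x)\,y=0$ having a maximal symmetry algebra satisfies $c_j=F_j(c_{n-1},c_{n-1}',\dots;c_{n-2},c_{n-2}',\dots)$ for $j=0,\dots,n-3$, with $c_{n-1}$ and $c_{n-2}$ themselves being arbitrary smooth functions.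
   Context: All coefficients $c_j=c_j(x)$ are smooth functions on an open interval; primes denote derivatives with respect to $x$. The symmetry algebra of an ordinary differential equation is the Lie algebra of its Lie point symmetries, i.e. vector fields $\xi(x,y)\partial_x+\eta(x,y)\partial_y$ satisfying the infinitesimal criterion of invariance for the equation. For a linear ordinary differential equation of order $n\ge 3$ the maximal possible dimension of this algebra is $n+4$; the equation is said to have a maximal symmetry algebra (or maximal symmetry) if this dimension is attained. By known results of Lie and of Krause and Michel this is equivalent to the equation being reducible by a (local) invertible point transformation to $y^{(n)}=0$. *)

theory Defs
  imports "HOL-Analysis.Analysis" "HOL-Library.Function_Algebras"
begin

text \<open>
  Smoothness on an open set of a Euclidean space, used for open subsets of the line and of the plane:
  a function is \<open>C\<^sup>k\<^sup>+\<^sup>1\<close> iff it is continuous and its first-order partial derivatives exist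
  and are \<open>C\<^sup>k\<close>. On open sets this depends only on the restriction of the function to the set.
\<close>

definition partial :: "'a::euclidean_space \<Rightarrow> ('a \<Rightarrow> real) \<Rightarrow> 'a \<Rightarrow> real" where
  "partial b f z = deriv (\<lambda>t. f (z + t *\<^sub>R b)) 0"

primrec Ck_on :: "nat \<Rightarrow> 'a::euclidean_space set \<Rightarrow> ('a \<Rightarrow> real) \<Rightarrow> bool" where
  "Ck_on 0 S f \<longleftrightarrow> continuous_on S f"
| "Ck_on (Suc k) S f \<longleftrightarrow> continuous_on S f \<and>
     (\<forall>b\<in>Basis. (\<forall>z\<in>S. (\<lambda>t. f (z + t *\<^sub>R b)) differentiable (at 0)) \<and> Ck_on k S (partial b f))"

definition smooth_on :: "'a::euclidean_space set \<Rightarrow> ('a \<Rightarrow> real) \<Rightarrow> bool" where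
  "smooth_on S f \<longleftrightarrow> (\<forall>k. Ck_on k S f)"

lemma partial_real [simp]: "partial (1::real) f = deriv f"
proof
  fix z :: real
  have "(DERIV (\<lambda>t. f (z + t)) 0 :> D) \<longleftrightarrow> (DERIV f z :> D)" for D
    using DERIV_shift[of f D 0 z] by (simp add: add.commute)
  then show "partial 1 f z = deriv f z"
    by (simp add: partial_def deriv_def)
qed

definition open_interval :: "real set \<Rightarrow> bool" where
  "open_interval I \<longleftrightarrow> open I \<and> is_interval I \<and> I \<noteq> {}"

text \<open>
  A differential function of \<open>x, y, y', y'', \<dots>\<close> is a function \<open>F x u\<close>, where \<open>u k\<close> is the jet
  coordinate \<open>y\<^sup>(\<^sup>k\<^sup>)\<close>. The operator \<open>total_deriv m\<close> is the total derivative \<open>D\<^sub>x\<close> on differential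
  functions of order at most \<open>m\<close>, i.e. depending on \<open>x, u 0, \<dots>, u m\<close> only.
\<close>

type_synonym diff_fun = "real \<Rightarrow> (nat \<Rightarrow> real) \<Rightarrow> real"

definition jet_partial :: "nat \<Rightarrow> diff_fun \<Rightarrow> diff_fun" where
  "jet_partial k F x u = deriv (\<lambda>t. F x (u(k := t))) (u k)"

definition total_deriv :: "nat \<Rightarrow> diff_fun \<Rightarrow> diff_fun" where
  "total_deriv m F x u = deriv (\<lambda>t. F t u) x + (\<Sum>k\<le>m. u (Suc k) * jet_partial k F x u)"

text \<open>
  A vector field \<open>X (x, y) = (\<xi>, \<eta>)\<close> stands for \<open>\<xi> \<partial>\<^sub>x + \<eta> \<partial>\<^sub>y\<close>. The coefficient of \<open>\<partial>/\<partial>y\<^sup>(\<^sup>k\<^sup>)\<close> in its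
  prolongation is given by the usual recursion
  \<open>\<eta>\<^sup>(\<^sup>0\<^sup>) = \<eta>\<close>, \<open>\<eta>\<^sup>(\<^sup>k\<^sup>+\<^sup>1\<^sup>) = D\<^sub>x \<eta>\<^sup>(\<^sup>k\<^sup>) - y\<^sup>(\<^sup>k\<^sup>+\<^sup>1\<^sup>) D\<^sub>x \<xi>\<close>.
\<close>

type_synonym vector_field = "real \<times> real \<Rightarrow> real \<times> real"

primrec prolong_coeff :: "vector_field \<Rightarrow> nat \<Rightarrow> diff_fun" where
  "prolong_coeff X 0 = (\<lambda>x u. snd (X (x, u 0)))"
| "prolong_coeff X (Suc k) = (\<lambda>x u.
     total_deriv k (prolong_coeff X k) x u
     - u (Suc k) * total_deriv 0 (\<lambda>x u. fst (X (x, u 0))) x u)"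

definition prolongation :: "nat \<Rightarrow> vector_field \<Rightarrow> diff_fun \<Rightarrow> diff_fun" where
  "prolongation n X F x u =
     fst (X (x, u 0)) * deriv (\<lambda>t. F t u) x + (\<Sum>k\<le>n. prolong_coeff X k x u * jet_partial k F x u)"

definition linear_ode :: "nat \<Rightarrow> (nat \<Rightarrow> real \<Rightarrow> real) \<Rightarrow> diff_fun" where
  "linear_ode n c x u = u n + (\<Sum>j<n. c j x * u j)"

text \<open>
  Lie point symmetries over the interval \<open>I\<close> are smooth vector fields on \<open>I \<times> \<real>\<close>. They are
  represented by their extension by zero, so that distinct elements of the set below are distinct
  as vector fields on \<open>I \<times> \<real>\<close>.
\<close>

definition symmetry_algebra ::
  "nat \<Rightarrow> real set \<Rightarrow> (nat \<Rightarrow> real \<Rightarrow> real) \<Rightarrow> vector_field set" where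
  "symmetry_algebra n I c = {X.
     smooth_on (I \<times> UNIV) (\<lambda>z. fst (X z)) \<and> smooth_on (I \<times> UNIV) (\<lambda>z. snd (X z)) \<and>
     (\<forall>z. z \<notin> I \<times> UNIV \<longrightarrow> X z = 0) \<and>
     (\<forall>x\<in>I. \<forall>u. linear_ode n c x u = 0 \<longrightarrow> prolongation n X (linear_ode n c) x u = 0)}"

global_interpretation vf: vector_space "\<lambda>(r::real) (X::vector_field) z. r *\<^sub>R X z"
  by unfold_locales (auto simp: fun_eq_iff plus_fun_def algebra_simps)

text \<open>
  The number \<open>n + 4\<close> is the largest dimension possible for \<open>n \<ge> 3\<close>. Since \<^const>\<open>vf.dim\<close> is \<open>0\<close>
  for infinite-dimensional sets, the equation below includes finite dimensionality.
\<close>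

definition maximal_symmetry :: "nat \<Rightarrow> real set \<Rightarrow> (nat \<Rightarrow> real \<Rightarrow> real) \<Rightarrow> bool" where
  "maximal_symmetry n I c \<longleftrightarrow> vf.dim (symmetry_algebra n I c) = n + 4"

definition derivs :: "nat \<Rightarrow> (real \<Rightarrow> real) \<Rightarrow> real \<Rightarrow> real list" where
  "derivs N f x = map (\<lambda>k. (deriv ^^ k) f x) [0..<N]"

end

theory Submission
  imports Defs
begin

text \<open>
  A symmetry of a linear equation of order \<open>n \<ge> 3\<close> is affine in \<open>y\<close>: it has the form
  \<open>\<xi>(x) \<partial>\<^sub>x + (\<phi>(x) y + \<beta>(x)) \<partial>\<^sub>y\<close>. On a jet that satisfies the equation, the invariance criterion
  is a polynomial identity in \<open>y', \<dots>, y\<^sup>(\<^sup>n\<^sup>-\<^sup>1\<^sup>)\<close>; its coefficient at \<open>y'' y\<^sup>(\<^sup>n\<^sup>-\<^sup>1\<^sup>)\<close>, a nonzero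
  multiple of \<open>\<xi>\<^sub>y\<close>, forces \<open>\<xi>\<close> to be independent of \<open>y\<close>, and then the one at
  \<open>y' y\<^sup>(\<^sup>n\<^sup>-\<^sup>1\<^sup>)\<close> is \<open>n \<eta>\<^sub>y\<^sub>y\<close> (\<open>partial_y_xi_eq_0\<close>, \<open>eta_yy_eq_0\<close>). For a field of this form the
  criterion becomes one determining equation for each \<open>j < n\<close>, linear in \<open>\<xi>\<close> and \<open>\<phi>\<close>, and the requirement that \<open>\<beta>\<close> solve the equation itself (\<open>determining_equations\<close>).

  The two determining equations for \<open>j = n - 1\<close> and \<open>j = n - 2\<close> form a linear first-order system for
  \<open>(\<xi>, \<xi>', \<xi>'', \<phi>)\<close> whose matrix depends only on \<open>c\<^sub>n\<^sub>-\<^sub>1\<close> and \<open>c\<^sub>n\<^sub>-\<^sub>2\<close> (\<open>cauchy_data_system\<close>). Hence a symmetry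
  is determined by \<open>4 + n\<close> numbers, the values of \<open>\<xi>, \<xi>', \<xi>'', \<phi>\<close> and of \<open>\<beta>, \<dots>, \<beta>\<^sup>(\<^sup>n\<^sup>-\<^sup>1\<^sup>)\<close> at a point, and the
  symmetry algebra has dimension \<open>n + 4\<close> iff these numbers can be prescribed arbitrarily
  (\<open>maximal_symmetry_iff_cauchy_data_onto\<close>).

  Uniqueness: let two equations with maximal symmetry share \<open>c\<^sub>n\<^sub>-\<^sub>1\<close> and \<open>c\<^sub>n\<^sub>-\<^sub>2\<close>. At a point \<open>x\<close> both have a
  symmetry with \<open>\<xi>(x) = 0\<close>, \<open>\<xi>'(x) = 1\<close> and the same remaining data, and the common system makes \<open>\<xi>\<close> and \<open>\<phi>\<close> the
  same for both. If the coefficients of index above \<open>j\<close> agree, the difference of the two \<open>j\<close>-th determining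
  equations at \<open>x\<close> is \<open>(n - j) (c\<^sub>j(x) - d\<^sub>j(x)) = 0\<close>. Downward induction on \<open>j\<close> gives
  \<open>maximal_symmetry_unique\<close>.

  Existence: with \<open>p = c\<^sub>n\<^sub>-\<^sub>1 / n\<close> and a function \<open>q\<close>, the recursion
  \<open>L\<^sub>k\<^sub>+\<^sub>1 = (D + p) L\<^sub>k + k (n - k) q L\<^sub>k\<^sub>-\<^sub>1\<close> with \<open>L\<^sub>0 = 1\<close> defines an operator \<open>L\<^sub>n\<close> of order \<open>n\<close>; for \<open>p = 0\<close> it is the
  \<open>(n - 1)\<close>-st symmetric power of \<open>y'' + q y = 0\<close>. If \<open>\<xi>''' + 4 q \<xi>' + 2 q' \<xi> = 0\<close>, the first-order operator
  \<open>T = (n - 1) / 2 \<xi>' - \<xi> (D + p)\<close> maps solutions of \<open>L\<^sub>n y = 0\<close> to solutions (\<open>L_twist\<close>), which yields a symmetry.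
  The choice of the initial values of \<open>\<xi>\<close>, of a multiple of \<open>y \<partial>\<^sub>y\<close> and of a solution \<open>\<beta>\<close> realises all data, so
  \<open>L\<^sub>n y = 0\<close> has maximal symmetry (\<open>maximal_symmetry_iterative\<close>). The coefficient of \<open>D\<^sup>n\<^sup>-\<^sup>2\<close> is affine in \<open>q\<close> with a
  nonzero constant factor, so \<open>c\<^sub>n\<^sub>-\<^sub>2\<close> can be prescribed through \<open>q\<close>. The coefficients of \<open>L\<^sub>n\<close> at a point depend
  only on the derivatives of \<open>c\<^sub>n\<^sub>-\<^sub>1\<close> and \<open>c\<^sub>n\<^sub>-\<^sub>2\<close> of order at most \<open>n + 1\<close> there (\<open>jets_agree_canonical_coeff\<close>), and
  by uniqueness they are the coefficients of every equation with maximal symmetry.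
\<close>

section \<open>Calculus of smooth functions\<close>

lemma eventually_line_in_open:
  fixes z :: "'a::real_normed_vector"
  assumes "open S" "z \<in> S"
  shows "\<forall>\<^sub>F t in nhds (0::real). z + t *\<^sub>R b \<in> S"
proof -
  have "((\<lambda>t::real. z + t *\<^sub>R b) \<longlongrightarrow> z + 0 *\<^sub>R b) (nhds 0)"
    by (intro tendsto_intros filterlim_ident)
  then show ?thesis
    using assms by (simp add: topological_tendstoD)
qed

lemma partial_cong_open:
  fixes z :: "'a::euclidean_space"
  assumes "open S" "z \<in> S" "\<And>w. w \<in> S \<Longrightarrow> f w = g w"
  shows "partial b f z = partial b g z"
  unfolding partial_def
  by (rule deriv_cong_ev)
    (use eventually_line_in_open[OF assms(1,2), of b] assms(3) in \<open>auto elim: eventually_mono\<close>)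

lemma line_differentiable_cong_open:
  fixes z :: "'a::euclidean_space"
  assumes "open S" "z \<in> S" "\<And>w. w \<in> S \<Longrightarrow> f w = g w"
    and "(\<lambda>t::real. f (z + t *\<^sub>R b)) differentiable (at 0)"
  shows "(\<lambda>t. g (z + t *\<^sub>R b) :: real) differentiable (at 0)"
proof -
  have ev: "\<forall>\<^sub>F t in nhds 0. f (z + t *\<^sub>R b) = g (z + t *\<^sub>R b)"
    using eventually_line_in_open[OF assms(1,2), of b] assms(3) by (auto elim: eventually_mono)
  obtain D where "DERIV (\<lambda>t. f (z + t *\<^sub>R b)) 0 :> D"
    using assms(4) by (auto simp: real_differentiable_def)
  then have "DERIV (\<lambda>t. g (z + t *\<^sub>R b)) 0 :> D"
    using DERIV_cong_ev[OF refl ev refl] by blast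
  then show ?thesis by (auto simp: real_differentiable_def)
qed

lemma Ck_on_cong_open:
  assumes "open S" "Ck_on k S f" "\<And>w. w \<in> S \<Longrightarrow> f w = g w"
  shows "Ck_on k S g"
  using assms(2,3)
proof (induction k arbitrary: f g)
  case 0
  then show ?case using continuous_on_cong[of S S f g] by simp
next
  case (Suc k)
  have c: "continuous_on S g"
    using Suc.prems continuous_on_cong[of S S f g] by simp
  have "Ck_on k S (partial b g)" if "b \<in> Basis" for b
    using Suc.IH[of "partial b f" "partial b g"] Suc.prems that
      partial_cong_open[OF assms(1), of _ f g b] by auto
  moreover have "(\<lambda>t. g (z + t *\<^sub>R b)) differentiable (at 0)" if "b \<in> Basis" "z \<in> S" for b z
    using line_differentiable_cong_open[OF assms(1) that(2), of f g b] Suc.prems that by auto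
  ultimately show ?case using c by simp
qed

lemma smooth_on_cong_open:
  assumes "open S" "smooth_on S f" "\<And>w. w \<in> S \<Longrightarrow> f w = g w"
  shows "smooth_on S g"
  using assms Ck_on_cong_open unfolding smooth_on_def by metis

lemma Ck_on_Suc_imp: "Ck_on (Suc k) S f \<Longrightarrow> Ck_on k S f"
proof (induction k arbitrary: f)
  case (Suc k)
  have "Ck_on k S (partial b f)" if "b \<in> Basis" for b
    by (rule Suc.IH) (use Suc.prems that in \<open>metis Ck_on.simps(2)\<close>)
  moreover have "continuous_on S f"
      "\<forall>b\<in>Basis. \<forall>z\<in>S. (\<lambda>t. f (z + t *\<^sub>R b)) differentiable (at 0)"
    using Suc.prems by (metis Ck_on.simps(2))+
  ultimately show ?case unfolding Ck_on.simps(2) by blast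
qed simp

lemma Ck_on_const: "Ck_on k S (\<lambda>_. c)"
proof (induction k arbitrary: c)
  case 0
  then show ?case by simp
next
  case (Suc k)
  have "partial b (\<lambda>_::'a. c) = (\<lambda>_. 0)" for b
    by (simp add: partial_def fun_eq_iff)
  then show ?case using Suc by simp
qed

lemma partial_add:
  assumes "(\<lambda>t. f (z + t *\<^sub>R b)) differentiable (at 0)" "(\<lambda>t. g (z + t *\<^sub>R b)) differentiable (at 0)"
  shows "partial b (\<lambda>w. f w + g w) z = partial b f z + partial b g z"
  using assms unfolding partial_def by (simp add: field_differentiable_def real_differentiable_def)

lemma partial_mult:
  assumes "(\<lambda>t. f (z + t *\<^sub>R b)) differentiable (at 0)" "(\<lambda>t. g (z + t *\<^sub>R b)) differentiable (at 0)"
  shows "partial b (\<lambda>w. f w * g w) z = partial b f z * g z + f z * partial b g z"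
  using assms unfolding partial_def by (simp add: field_differentiable_def real_differentiable_def)

lemma Ck_on_add:
  assumes "open S" "Ck_on k S f" "Ck_on k S g"
  shows "Ck_on k S (\<lambda>w. f w + g w)"
  using assms(2,3)
proof (induction k arbitrary: f g)
  case 0
  then show ?case by (simp add: continuous_on_add)
next
  case (Suc k)
  have "Ck_on k S (partial b (\<lambda>w. f w + g w))" if b: "b \<in> Basis" for b
    by (rule Ck_on_cong_open[OF assms(1) Suc.IH[of "partial b f" "partial b g"]])
      (use Suc.prems b in \<open>auto intro!: partial_add[symmetric]\<close>)
  then show ?case using Suc.prems by (auto intro!: continuous_on_add)
qed

lemma Ck_on_mult:
  assumes "open S" "Ck_on k S f" "Ck_on k S g"
  shows "Ck_on k S (\<lambda>w. f w * g w)"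
  using assms(2,3)
proof (induction k arbitrary: f g)
  case 0
  then show ?case by (simp add: continuous_on_mult)
next
  case (Suc k)
  note low = Suc.prems[THEN Ck_on_Suc_imp]
  have "Ck_on k S (partial b (\<lambda>w. f w * g w))" if b: "b \<in> Basis" for b
  proof (rule Ck_on_cong_open[OF assms(1)])
    show "Ck_on k S (\<lambda>w. partial b f w * g w + f w * partial b g w)"
      using Suc.prems b low by (intro Ck_on_add[OF assms(1)] Suc.IH) auto
    show "partial b f w * g w + f w * partial b g w = partial b (\<lambda>w. f w * g w) w" if "w \<in> S" for w
      using Suc.prems b that by (intro partial_mult[symmetric]) auto
  qed
  then show ?case using Suc.prems by (auto intro!: continuous_on_mult)
qed

lemma smooth_on_const [simp]: "smooth_on S (\<lambda>_. c)"
  by (simp add: smooth_on_def Ck_on_const)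

lemma smooth_on_if: "smooth_on S f \<Longrightarrow> smooth_on S g \<Longrightarrow> smooth_on S (\<lambda>x. if P then f x else g x)"
  by (cases P) simp_all

lemma smooth_on_add: "open S \<Longrightarrow> smooth_on S f \<Longrightarrow> smooth_on S g \<Longrightarrow> smooth_on S (\<lambda>w. f w + g w)"
  by (simp add: smooth_on_def Ck_on_add)

lemma smooth_on_mult: "open S \<Longrightarrow> smooth_on S f \<Longrightarrow> smooth_on S g \<Longrightarrow> smooth_on S (\<lambda>w. f w * g w)"
  by (simp add: smooth_on_def Ck_on_mult)

lemma smooth_on_minus: "open S \<Longrightarrow> smooth_on S f \<Longrightarrow> smooth_on S (\<lambda>w. - f w)"
  using smooth_on_mult[of S "\<lambda>_. -1" f] by simp

lemma smooth_on_diff: "open S \<Longrightarrow> smooth_on S f \<Longrightarrow> smooth_on S g \<Longrightarrow> smooth_on S (\<lambda>w. f w - g w)"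
  using smooth_on_add[of S f "\<lambda>w. - g w"] smooth_on_minus[of S g] by simp

lemma smooth_on_sum:
  "open S \<Longrightarrow> (\<And>i. i \<in> K \<Longrightarrow> smooth_on S (f i)) \<Longrightarrow> smooth_on S (\<lambda>w. \<Sum>i\<in>K. f i w)"
  by (induction K rule: infinite_finite_induct) (auto intro: smooth_on_add)

lemma smooth_on_imp_continuous_on: "smooth_on S f \<Longrightarrow> continuous_on S f"
  unfolding smooth_on_def by (metis Ck_on.simps(1))

lemma smooth_on_partial: "smooth_on S f \<Longrightarrow> b \<in> Basis \<Longrightarrow> smooth_on S (partial b f)"
  unfolding smooth_on_def by (metis Ck_on.simps(2))

lemma smooth_on_line_differentiable:
  "smooth_on S f \<Longrightarrow> b \<in> Basis \<Longrightarrow> z \<in> S \<Longrightarrow> (\<lambda>t. f (z + t *\<^sub>R b)) differentiable (at 0)"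
  unfolding smooth_on_def by (metis Ck_on.simps(2))

lemma smooth_on_deriv: "smooth_on I f \<Longrightarrow> smooth_on I (deriv f)"
  using smooth_on_partial[of I f 1] by simp

lemma smooth_on_DERIV:
  fixes f :: "real \<Rightarrow> real"
  assumes "smooth_on I f" "x \<in> I"
  shows "DERIV f x :> deriv f x"
proof -
  obtain D where "DERIV (\<lambda>t. f (x + t)) 0 :> D"
    using smooth_on_line_differentiable[OF assms(1) _ assms(2), of 1]
    by (auto simp: real_differentiable_def)
  then have "DERIV f x :> D"
    using DERIV_shift[of f D 0 x] by (simp add: add.commute)
  then show ?thesis using DERIV_imp_deriv by blast
qed

lemma smooth_on_higher_deriv: "smooth_on I f \<Longrightarrow> smooth_on I ((deriv ^^ k) f)"
  by (induction k) (auto intro: smooth_on_deriv)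

lemma smooth_on_DERIV_higher:
  "smooth_on I f \<Longrightarrow> x \<in> I \<Longrightarrow> DERIV ((deriv ^^ k) f) x :> (deriv ^^ Suc k) f x"
  using smooth_on_DERIV[OF smooth_on_higher_deriv] by simp

lemma deriv_cong_open:
  fixes f g :: "real \<Rightarrow> real"
  assumes "open I" "x \<in> I" "\<And>y. y \<in> I \<Longrightarrow> f y = g y"
  shows "deriv f x = deriv g x"
  by (rule deriv_cong_ev)
    (use eventually_nhds_in_open[OF assms(1,2)] assms(3) in \<open>auto elim: eventually_mono\<close>)

lemma higher_deriv_cong_open:
  fixes f g :: "real \<Rightarrow> real"
  assumes "open I" "\<And>y. y \<in> I \<Longrightarrow> f y = g y" "x \<in> I"
  shows "(deriv ^^ k) f x = (deriv ^^ k) g x"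
  using assms(3) by (induction k arbitrary: x) (auto simp: assms(2) intro!: deriv_cong_open[OF assms(1)])

lemma DERIV_cong_open:
  fixes f g :: "real \<Rightarrow> real"
  assumes "open I" "x \<in> I" "\<And>y. y \<in> I \<Longrightarrow> f y = g y" "DERIV f x :> D"
  shows "DERIV g x :> D"
proof -
  have "\<forall>\<^sub>F y in nhds x. f y = g y"
    using eventually_nhds_in_open[OF assms(1,2)] assms(3) by (auto elim: eventually_mono)
  then show ?thesis using DERIV_cong_ev[OF refl _ refl, of f g x D] assms(4) by blast
qed

lemma higher_deriv_add:
  fixes f g :: "real \<Rightarrow> real"
  assumes "open I" "smooth_on I f" "smooth_on I g" "x \<in> I"
  shows "(deriv ^^ k) (\<lambda>x. f x + g x) x = (deriv ^^ k) f x + (deriv ^^ k) g x"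
  using assms(4)
proof (induction k arbitrary: x)
  case (Suc k)
  have "deriv ((deriv ^^ k) (\<lambda>x. f x + g x)) x = deriv (\<lambda>x. (deriv ^^ k) f x + (deriv ^^ k) g x) x"
    by (rule deriv_cong_open[OF assms(1)]) (use Suc in auto)
  also have "\<dots> = (deriv ^^ Suc k) f x + (deriv ^^ Suc k) g x"
    by (intro DERIV_imp_deriv DERIV_add smooth_on_DERIV_higher[of I] assms Suc.prems)
  finally show ?case by simp
qed simp

lemma higher_deriv_cmult:
  fixes f :: "real \<Rightarrow> real"
  assumes "open I" "smooth_on I f" "x \<in> I"
  shows "(deriv ^^ k) (\<lambda>x. r * f x) x = r * (deriv ^^ k) f x"
  using assms(3)
proof (induction k arbitrary: x)
  case (Suc k)
  have "deriv ((deriv ^^ k) (\<lambda>x. r * f x)) x = deriv (\<lambda>x. r * (deriv ^^ k) f x) x"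
    by (rule deriv_cong_open[OF assms(1)]) (use Suc in auto)
  also have "\<dots> = r * (deriv ^^ Suc k) f x"
    by (intro DERIV_imp_deriv DERIV_cmult smooth_on_DERIV_higher[of I] assms Suc.prems)
  finally show ?case by simp
qed simp

text \<open>The dependence of the canonical coefficients on the derivatives of \<open>a\<close> and \<open>b\<close> at a point is expressed by
  comparing two pairs of functions at two points, of possibly different intervals. The relation is compatible with
  sums and products, and a derivative costs one order; this replaces an explicit formula for the dependence.\<close>

lemma Ck_on_Suc_realI:
  fixes f :: "real \<Rightarrow> real"
  assumes "open I" "\<And>x. x \<in> I \<Longrightarrow> DERIV f x :> f' x" "Ck_on k I f'"
  shows "Ck_on (Suc k) I f"
proof -
  have "(\<lambda>t. f (z + t)) differentiable (at 0)" if "z \<in> I" for z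
    using assms(2)[OF that] DERIV_shift[of f "f' z" 0 z]
    by (auto simp: real_differentiable_def add.commute)
  moreover have "Ck_on k I (deriv f)"
    by (rule Ck_on_cong_open[OF assms(1,3)]) (use assms(2) DERIV_imp_deriv in metis)
  moreover have "continuous_on I f"
    using assms(1,2) by (meson DERIV_isCont continuous_at_imp_continuous_on)
  ultimately show ?thesis by simp
qed

lemma Basis_plane: "(Basis :: (real \<times> real) set) = {(1,0),(0,1)}"
  by (auto simp: Basis_prod_def)

abbreviation partial_x :: "(real \<times> real \<Rightarrow> real) \<Rightarrow> real \<times> real \<Rightarrow> real" where
  "partial_x \<equiv> partial (1,0)"
abbreviation partial_y :: "(real \<times> real \<Rightarrow> real) \<Rightarrow> real \<times> real \<Rightarrow> real" where
  "partial_y \<equiv> partial (0,1)"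

lemma smooth_on_strip_DERIV_x:
  assumes "smooth_on (I \<times> UNIV) f" "x \<in> I"
  shows "DERIV (\<lambda>t. f (t, y)) x :> partial_x f (x, y)"
proof -
  have "(\<lambda>t. f ((x,y) + t *\<^sub>R (1,0))) differentiable (at 0)"
    by (rule smooth_on_line_differentiable[OF assms(1)]) (use assms in \<open>auto simp: Basis_plane\<close>)
  then have "DERIV (\<lambda>t. f (x + t, y)) 0 :> partial_x f (x, y)"
    by (auto simp: partial_def real_differentiable_def DERIV_imp_deriv)
  then show ?thesis
    using DERIV_shift[of "\<lambda>t. f (t, y)" "partial_x f (x, y)" 0 x] by (simp add: add.commute)
qed

lemma smooth_on_strip_DERIV_y:
  assumes "smooth_on (I \<times> UNIV) f" "x \<in> I"
  shows "DERIV (\<lambda>t. f (x, t)) y :> partial_y f (x, y)"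
proof -
  have "(\<lambda>t. f ((x,y) + t *\<^sub>R (0,1))) differentiable (at 0)"
    by (rule smooth_on_line_differentiable[OF assms(1)]) (use assms in \<open>auto simp: Basis_plane\<close>)
  then have "DERIV (\<lambda>t. f (x, y + t)) 0 :> partial_y f (x, y)"
    by (auto simp: partial_def real_differentiable_def DERIV_imp_deriv)
  then show ?thesis
    using DERIV_shift[of "\<lambda>t. f (x, t)" "partial_y f (x, y)" 0 y] by (simp add: add.commute)
qed

lemma smooth_on_partial_x: "smooth_on S f \<Longrightarrow> smooth_on S (partial_x f)"
  and smooth_on_partial_y: "smooth_on S f \<Longrightarrow> smooth_on S (partial_y f)"
  by (simp_all add: smooth_on_partial Basis_plane)

lemma smooth_on_slice:
  fixes I :: "real set" and y :: real
  assumes "open I" "smooth_on (I \<times> UNIV) f"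
  shows "smooth_on I (\<lambda>x. f (x, y))"
proof -
  have "Ck_on k I (\<lambda>x. f (x, y))" if "smooth_on (I \<times> UNIV) f" for k and f :: "real \<times> real \<Rightarrow> real"
    using that
  proof (induction k arbitrary: f)
    case 0
    have "continuous_on I (\<lambda>x. f (x, y))"
      by (rule continuous_on_compose2[OF smooth_on_imp_continuous_on[OF 0]]) (auto intro!: continuous_intros)
    then show ?case by simp
  next
    case (Suc k)
    show ?case
      by (rule Ck_on_Suc_realI[OF assms(1) smooth_on_strip_DERIV_x[OF Suc.prems]])
        (use Suc smooth_on_partial_x in auto)
  qed
  then show ?thesis using assms(2) by (simp add: smooth_on_def)
qed

lemma smooth_on_strip_fst:
  fixes I :: "real set"
  assumes "open I" "smooth_on I f"
  shows "smooth_on (I \<times> (UNIV :: real set)) (\<lambda>z. f (fst z))"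
proof -
  have op: "open (I \<times> (UNIV :: real set))" using assms by (simp add: open_Times)
  have "Ck_on k (I \<times> (UNIV :: real set)) (\<lambda>z. f (fst z))" if "smooth_on I f" for k and f :: "real \<Rightarrow> real"
    using that
  proof (induction k arbitrary: f)
    case 0
    have "continuous_on (I \<times> (UNIV :: real set)) (\<lambda>z. f (fst z))"
      by (rule continuous_on_compose2[OF smooth_on_imp_continuous_on[OF 0]]) (auto intro!: continuous_intros)
    then show ?case by simp
  next
    case (Suc k)
    have px: "DERIV (\<lambda>t. f (fst z + t)) 0 :> deriv f (fst z)" if "z \<in> I \<times> (UNIV :: real set)" for z
    proof -
      have "DERIV f (fst z) :> deriv f (fst z)"
        using smooth_on_DERIV[OF Suc.prems, of "fst z"] that by (simp add: mem_Times_iff)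
      then show ?thesis
        using DERIV_shift[of f "deriv f (fst z)" 0 "fst z"] by (simp add: add.commute)
    qed
    have cont: "continuous_on (I \<times> (UNIV :: real set)) (\<lambda>z. f (fst z))"
      by (rule continuous_on_compose2[OF smooth_on_imp_continuous_on[OF Suc.prems]]) (auto intro!: continuous_intros)
    have 1: "Ck_on k (I \<times> (UNIV :: real set)) (partial_x (\<lambda>z. f (fst z)))"
      by (rule Ck_on_cong_open[OF op Suc.IH[OF smooth_on_deriv[OF Suc.prems]]])
        (use px[THEN DERIV_imp_deriv] in \<open>simp add: partial_def mem_Times_iff\<close>)
    have 2: "partial_y (\<lambda>z. f (fst z)) = (\<lambda>_. 0)"
      by (auto simp: partial_def)
    have 3: "(\<lambda>t. f (fst (z + t *\<^sub>R b))) differentiable (at 0)"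
      if "z \<in> I \<times> (UNIV :: real set)" "b = (1,0) \<or> b = (0,1)" for z b
      using that(2)
    proof
      assume "b = (1,0)"
      then show ?thesis using px[OF that(1)] by (auto simp: real_differentiable_def)
    next
      assume "b = (0,1)"
      then show ?thesis by simp
    qed
    show ?case
      unfolding Ck_on.simps(2) Basis_plane
      using cont 1 2 3 by (simp add: Ck_on_const)
  qed
  then show ?thesis using assms by (simp add: smooth_on_def)
qed

lemma smooth_on_strip_snd: "smooth_on ((I :: real set) \<times> (UNIV :: real set)) (\<lambda>z. snd z :: real)"
proof -
  have "Ck_on k (I \<times> (UNIV :: real set)) (\<lambda>z. snd z :: real)" for k
  proof (cases k)
    case (Suc l)
    have 1: "DERIV (\<lambda>t. y + t) 0 :> 1" for y :: real
      by (auto intro!: derivative_eq_intros)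
    have 2: "partial_x (\<lambda>z. snd z :: real) = (\<lambda>_. 0)" "partial_y (\<lambda>z. snd z :: real) = (\<lambda>_. 1)"
      using 1 DERIV_imp_deriv by (auto simp: partial_def)
    have 3: "continuous_on (I \<times> (UNIV :: real set)) (\<lambda>z. snd z :: real)"
      by (auto intro!: continuous_intros)
    have 4: "(\<lambda>t. snd (z + t *\<^sub>R (0, 1)) :: real) differentiable (at 0)" for z :: "real \<times> real"
      using 1 by (auto simp: real_differentiable_def)
    show ?thesis
      unfolding Suc Ck_on.simps(2) Basis_plane
      using 2 3 4 by (simp add: Ck_on_const)
  qed (auto intro!: continuous_intros)
  then show ?thesis by (simp add: smooth_on_def)
qed

section \<open>Linear differential equations on an open interval\<close>

lemma open_interval_segment_subset:
  "open_interval I \<Longrightarrow> x \<in> I \<Longrightarrow> y \<in> I \<Longrightarrow> {x..y} \<subseteq> I"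
  unfolding open_interval_def by (meson atLeastAtMost_iff is_interval_1 subsetI)

lemma open_interval_compact_neighbourhood:
  assumes "open_interval I" "x \<in> I" "y \<in> I"
  obtains l r where "l < x" "l < y" "x < r" "y < r" "{l..r} \<subseteq> I"
proof -
  have "open I" using assms by (simp add: open_interval_def)
  have ends: "\<exists>l\<in>I. \<exists>r\<in>I. l < z \<and> z < r" if "z \<in> I" for z
  proof -
    obtain e where e: "e > 0" "cball z e \<subseteq> I"
      using \<open>open I\<close> \<open>z \<in> I\<close> open_contains_cball by blast
    then have "z - e \<in> I" "z + e \<in> I" by (auto simp: subset_iff dist_real_def)
    then show ?thesis using e by (intro bexI[of _ "z-e"] bexI[of _ "z+e"]) auto
  qed
  obtain l1 r1 l2 r2 where "l1 \<in> I" "r1 \<in> I" "l1 < x" "x < r1" "l2 \<in> I" "r2 \<in> I" "l2 < y" "y < r2"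
    using ends[OF assms(2)] ends[OF assms(3)] by blast
  then show ?thesis
    using open_interval_segment_subset[OF assms(1), of "min l1 l2" "max r1 r2"]
    by (intro that[of "min l1 l2" "max r1 r2"]) (auto simp: min_def max_def)
qed

text \<open>One antiderivative is needed on all of \<open>I\<close>. The oriented integral \<open>LBINT y=x0..x\<close> provides it on both
  sides of \<open>x0\<close> at once.\<close>

lemma antiderivative_on_open_interval:
  assumes "open_interval I" "continuous_on I f" "x0 \<in> I"
  shows "\<exists>F. F x0 = (0::real) \<and> (\<forall>x\<in>I. DERIV F x :> f x)"
proof -
  define F where "F = (\<lambda>u. LBINT y=ereal x0..ereal u. f y)"
  have "DERIV F x :> f x" if x: "x \<in> I" for x
  proof -
    obtain l r where lr: "l < x" "l < x0" "x < r" "x0 < r" "{l..r} \<subseteq> I"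
      using open_interval_compact_neighbourhood[OF assms(1) x assms(3)] .
    have "(F has_vector_derivative f x) (at x within {l..r})"
      unfolding F_def
      by (rule interval_integral_FTC2) (use lr assms(2) continuous_on_subset in auto)
    then have "(F has_vector_derivative f x) (at x)"
      using lr by (simp add: at_within_Icc_at)
    then show ?thesis by (simp add: has_real_derivative_iff_has_vector_derivative)
  qed
  moreover have "F x0 = 0" by (simp add: F_def)
  ultimately show ?thesis by blast
qed

text \<open>The estimate that produces the factor \<open>1 / k!\<close> in the Picard series: each integration from \<open>x0\<close>
  raises the exponent by one and divides by it.\<close>

lemma power_bound_antiderivative:
  fixes F :: "real \<Rightarrow> real"
  assumes der: "\<And>t. t \<in> {l..r} \<Longrightarrow> DERIV F t :> F' t"
    and bnd: "\<And>t. t \<in> {l..r} \<Longrightarrow> \<bar>F' t\<bar> \<le> c * \<bar>t - x0\<bar> ^ k"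
    and "x0 \<in> {l..r}" "x \<in> {l..r}" "F x0 = 0"
  shows "\<bar>F x\<bar> \<le> c * \<bar>x - x0\<bar> ^ Suc k / Suc k"
proof -
  have contF: "continuous_on S F" if "S \<subseteq> {l..r}" for S
    using der that by (meson DERIV_isCont continuous_at_imp_continuous_on subsetD)
  consider "x = x0" | "x0 < x" | "x < x0" by linarith
  then show ?thesis
  proof cases
    case 1
    then show ?thesis using assms(5) by simp
  next
    case 2
    have "norm (F x - F x0) \<le> c * (x - x0) ^ Suc k / Suc k - c * (x0 - x0) ^ Suc k / Suc k"
    proof (rule differentiable_bound_general[OF 2])
      show "continuous_on {x0..x} F" using assms by (intro contF) auto
      show "continuous_on {x0..x} (\<lambda>t. c * (t - x0) ^ Suc k / Suc k)"
        by (intro continuous_intros) auto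
      fix t assume t: "x0 < t" "t < x"
      then have tlr: "t \<in> {l..r}" using assms by auto
      show "(F has_vector_derivative F' t) (at t)"
        using der[OF tlr] by (simp add: has_real_derivative_iff_has_vector_derivative)
      have "DERIV (\<lambda>t. c * (t - x0) ^ Suc k / Suc k) t :> c * (t - x0) ^ k"
        by (auto intro!: derivative_eq_intros simp del: power_Suc)
      then show "((\<lambda>t. c * (t - x0) ^ Suc k / Suc k) has_vector_derivative c * (t - x0) ^ k) (at t)"
        by (simp add: has_real_derivative_iff_has_vector_derivative)
      show "norm (F' t) \<le> c * (t - x0) ^ k" using bnd[OF tlr] t by simp
    qed
    then show ?thesis using 2 assms(5) by simp
  next
    case 3
    have "norm (F x0 - F x) \<le> - (c * (x0 - x0) ^ Suc k / Suc k) - - (c * (x0 - x) ^ Suc k / Suc k)"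
    proof (rule differentiable_bound_general[OF 3])
      show "continuous_on {x..x0} F" using assms by (intro contF) auto
      show "continuous_on {x..x0} (\<lambda>t. - (c * (x0 - t) ^ Suc k / Suc k))"
        by (intro continuous_intros) auto
      fix t assume t: "x < t" "t < x0"
      then have tlr: "t \<in> {l..r}" using assms by auto
      show "(F has_vector_derivative F' t) (at t)"
        using der[OF tlr] by (simp add: has_real_derivative_iff_has_vector_derivative)
      have "DERIV (\<lambda>t. - (c * (x0 - t) ^ Suc k / Suc k)) t :> c * (x0 - t) ^ k"
        by (auto intro!: derivative_eq_intros simp del: power_Suc)
      then show "((\<lambda>t. - (c * (x0 - t) ^ Suc k / Suc k)) has_vector_derivative c * (x0 - t) ^ k) (at t)"
        by (simp add: has_real_derivative_iff_has_vector_derivative)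
      show "norm (F' t) \<le> c * (x0 - t) ^ k" using bnd[OF tlr] t by simp
    qed
    then show ?thesis using 3 assms(5) by simp
  qed
qed

lemma coefficients_bounded_on_compact:
  fixes A :: "nat \<Rightarrow> nat \<Rightarrow> real \<Rightarrow> real"
  assumes "\<And>i j. i < N \<Longrightarrow> j < N \<Longrightarrow> continuous_on {l..r} (A i j)"
  obtains B where "B \<ge> 0" "\<And>i j x. i < N \<Longrightarrow> j < N \<Longrightarrow> x \<in> {l..r} \<Longrightarrow> \<bar>A i j x\<bar> \<le> B"
proof -
  have "\<exists>b. \<forall>x\<in>{l..r}. \<bar>A i j x\<bar> \<le> b" if "i < N" "j < N" for i j
  proof -
    have "bounded (A i j ` {l..r})"
      using assms[OF that] compact_continuous_image compact_imp_bounded by blast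
    then show ?thesis by (auto simp: bounded_iff)
  qed
  then obtain b where b: "\<And>i j x. i < N \<Longrightarrow> j < N \<Longrightarrow> x \<in> {l..r} \<Longrightarrow> \<bar>A i j x\<bar> \<le> b i j"
    by metis
  let ?B = "\<Sum>i<N. \<Sum>j<N. \<bar>b i j\<bar>"
  have "\<bar>A i j x\<bar> \<le> ?B" if "i < N" "j < N" "x \<in> {l..r}" for i j x
  proof -
    have "\<bar>A i j x\<bar> \<le> \<bar>b i j\<bar>" using b[OF that] by simp
    also have "\<dots> \<le> (\<Sum>j<N. \<bar>b i j\<bar>)" by (rule member_le_sum) (use that in auto)
    also have "\<dots> \<le> ?B"
      by (rule member_le_sum[of i _ "\<lambda>i. \<Sum>j<N. \<bar>b i j\<bar>"]) (use that in \<open>auto intro: sum_nonneg\<close>)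
    finally show ?thesis .
  qed
  then show ?thesis by (intro that[of ?B]) (auto intro!: sum_nonneg)
qed

text \<open>The energy \<open>S = \<Sum>j<N. (w j)\<^sup>2\<close> satisfies \<open>\<bar>S'\<bar> \<le> C S\<close> on compact intervals, so \<open>S e\<^sup>-\<^sup>C\<^sup>t\<close> decreases and
  \<open>S e\<^sup>C\<^sup>t\<close> increases. As \<open>S\<close> vanishes at \<open>x0\<close>, it vanishes to the right and to the left of it.\<close>

lemma linear_system_unique:
  fixes A :: "nat \<Rightarrow> nat \<Rightarrow> real \<Rightarrow> real" and w :: "nat \<Rightarrow> real \<Rightarrow> real"
  assumes I: "open_interval I"
    and contA: "\<And>i j. i < N \<Longrightarrow> j < N \<Longrightarrow> continuous_on I (A i j)"
    and der: "\<And>j x. j < N \<Longrightarrow> x \<in> I \<Longrightarrow> DERIV (w j) x :> (\<Sum>i<N. A j i x * w i x)"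
    and x0: "x0 \<in> I" and init: "\<And>j. j < N \<Longrightarrow> w j x0 = 0"
    and "x \<in> I" "j < N"
  shows "w j x = 0"
proof -
  obtain l r where lr: "l < x" "l < x0" "x < r" "x0 < r" "{l..r} \<subseteq> I"
    using open_interval_compact_neighbourhood[OF I \<open>x \<in> I\<close> x0] .
  obtain B where B: "B \<ge> 0" "\<And>i j x. i < N \<Longrightarrow> j < N \<Longrightarrow> x \<in> {l..r} \<Longrightarrow> \<bar>A i j x\<bar> \<le> B"
    using coefficients_bounded_on_compact[of N l r A] contA lr(5) continuous_on_subset by metis
  define S where "S t = (\<Sum>j<N. (w j t)\<^sup>2)" for t
  define S' where "S' t = (\<Sum>j<N. 2 * w j t * (\<Sum>i<N. A j i t * w i t))" for t
  define C where "C = 2 * B * real N"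
  have S0: "S x0 = 0" using init by (simp add: S_def)
  have derS: "DERIV S t :> S' t" if "t \<in> {l..r}" for t
    unfolding S_def S'_def
    by (rule derivative_eq_intros refl der | use that lr in force)+ (simp add: algebra_simps)
  have S'_bound: "\<bar>S' t\<bar> \<le> C * S t" if t: "t \<in> {l..r}" for t
  proof -
    have "\<bar>S' t\<bar> \<le> (\<Sum>j<N. \<Sum>i<N. \<bar>2 * w j t * (A j i t * w i t)\<bar>)"
      unfolding S'_def sum_distrib_left by (intro order_trans[OF sum_abs] sum_mono sum_abs)
    also have "\<dots> \<le> (\<Sum>j<N. \<Sum>i<N. B * ((w j t)\<^sup>2 + (w i t)\<^sup>2))"
    proof (intro sum_mono)
      fix j i assume ij: "j \<in> {..<N}" "i \<in> {..<N}"
      have "\<bar>2 * w j t * (A j i t * w i t)\<bar> = \<bar>A j i t\<bar> * (2 * \<bar>w j t\<bar> * \<bar>w i t\<bar>)"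
        by (simp add: abs_mult)
      also have "\<dots> \<le> B * (2 * \<bar>w j t\<bar> * \<bar>w i t\<bar>)"
        using B(2)[of j i t] ij t by (intro mult_right_mono) auto
      also have "\<dots> \<le> B * ((w j t)\<^sup>2 + (w i t)\<^sup>2)"
        using sum_squares_bound[of "\<bar>w j t\<bar>" "\<bar>w i t\<bar>"] B(1) by (intro mult_left_mono) auto
      finally show "\<bar>2 * w j t * (A j i t * w i t)\<bar> \<le> B * ((w j t)\<^sup>2 + (w i t)\<^sup>2)" .
    qed
    also have "\<dots> = (\<Sum>j<N. B * (real N * (w j t)\<^sup>2 + S t))"
      unfolding S_def by (subst sum_distrib_left[symmetric], subst sum.distrib, simp)
    also have "\<dots> = B * (\<Sum>j<N. real N * (w j t)\<^sup>2 + S t)"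
      by (simp only: sum_distrib_left)
    also have "(\<Sum>j<N. real N * (w j t)\<^sup>2 + S t) = real N * S t + real N * S t"
      unfolding sum.distrib by (subst sum_distrib_left[symmetric], simp add: S_def)
    also have "B * (real N * S t + real N * S t) = C * S t" by (simp add: C_def)
    finally show ?thesis .
  qed
  have "S x \<le> 0"
  proof (cases "x0 \<le> x")
    case True
    have "S x * exp (- C * x) \<le> S x0 * exp (- C * x0)"
    proof (rule DERIV_nonpos_imp_nonincreasing[OF True])
      fix t assume "x0 \<le> t" "t \<le> x"
      then have t: "t \<in> {l..r}" using lr by auto
      have "DERIV (\<lambda>t. S t * exp (- C * t)) t :> (S' t - C * S t) * exp (- C * t)"
        by (auto intro!: derivative_eq_intros derS[OF t] simp: algebra_simps)
      moreover have "(S' t - C * S t) * exp (- C * t) \<le> 0"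
        using S'_bound[OF t] by (intro mult_nonpos_nonneg) auto
      ultimately show "\<exists>y. DERIV (\<lambda>t. S t * exp (- C * t)) t :> y \<and> y \<le> 0" by blast
    qed
    then show ?thesis using S0 by (simp add: mult_le_0_iff)
  next
    case False
    then have xx: "x \<le> x0" by simp
    have "S x * exp (C * x) \<le> S x0 * exp (C * x0)"
    proof (rule DERIV_nonneg_imp_nondecreasing[OF xx])
      fix t assume "x \<le> t" "t \<le> x0"
      then have t: "t \<in> {l..r}" using lr by auto
      have "DERIV (\<lambda>t. S t * exp (C * t)) t :> (S' t + C * S t) * exp (C * t)"
        by (auto intro!: derivative_eq_intros derS[OF t] simp: algebra_simps)
      moreover have "(S' t + C * S t) * exp (C * t) \<ge> 0"
        using S'_bound[OF t] by (intro mult_nonneg_nonneg) auto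
      ultimately show "\<exists>y. DERIV (\<lambda>t. S t * exp (C * t)) t :> y \<and> 0 \<le> y" by blast
    qed
    then show ?thesis using S0 by (simp add: mult_le_0_iff)
  qed
  then have "S x = 0" using sum_nonneg[of "{..<N}" "\<lambda>j. (w j x)\<^sup>2"] by (simp add: S_def)
  then show ?thesis using \<open>j < N\<close> by (simp add: S_def sum_nonneg_eq_0_iff)
qed

text \<open>The solution is the Picard series \<open>\<Sum>k. W k\<close>, where \<open>W 0\<close> is the constant initial vector and \<open>W (k + 1)\<close>
  integrates \<open>A (W k)\<close> from \<open>x0\<close>. On a compact interval \<open>W k\<close> is bounded by \<open>M (C \<bar>x - x0\<bar>)\<^sup>k / k!\<close>, so the series
  of derivatives converges uniformly there and the sum may be differentiated termwise. The terms are defined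
  on all of \<open>I\<close>, hence so is the solution.\<close>

lemma linear_system_exists:
  fixes A :: "nat \<Rightarrow> nat \<Rightarrow> real \<Rightarrow> real" and v :: "nat \<Rightarrow> real"
  assumes I: "open_interval I"
    and contA: "\<And>i j. i < N \<Longrightarrow> j < N \<Longrightarrow> continuous_on I (A i j)"
    and x0: "x0 \<in> I"
  shows "\<exists>w. (\<forall>j<N. w j x0 = v j) \<and> (\<forall>j<N. \<forall>x\<in>I. DERIV (w j) x :> (\<Sum>i<N. A j i x * w i x))"
proof -
  have "\<exists>F. F x0 = 0 \<and> (\<forall>x\<in>I. DERIV F x :> f x)" if "continuous_on I f" for f :: "real \<Rightarrow> real"
    by (rule antiderivative_on_open_interval[OF I that x0])
  then obtain J where J: "\<And>f. continuous_on I f \<Longrightarrow> J f x0 = 0"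
      "\<And>f x. continuous_on I f \<Longrightarrow> x \<in> I \<Longrightarrow> DERIV (J f) x :> f x"
    by metis
  define W where "W = rec_nat (\<lambda>j _. v j) (\<lambda>k Wk j. J (\<lambda>x. \<Sum>i<N. A j i x * Wk i x))"
  have W0: "W 0 = (\<lambda>j _. v j)"
    and WS: "W (Suc k) j = J (\<lambda>x. \<Sum>i<N. A j i x * W k i x)" for k j
    by (simp_all add: W_def)
  have contW: "j < N \<Longrightarrow> continuous_on I (W k j)" for k j
  proof (induction k arbitrary: j)
    case (Suc k)
    then have "continuous_on I (\<lambda>x. \<Sum>i<N. A j i x * W k i x)"
      by (intro continuous_intros contA) auto
    then show ?case unfolding WS
      using J(2) by (meson DERIV_isCont continuous_at_imp_continuous_on)
  qed (simp add: W0)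
  have cont: "continuous_on I (\<lambda>x. \<Sum>i<N. A j i x * W k i x)" if "j < N" for k j
    using that by (intro continuous_intros contA contW) auto
  define W' where "W' k j x = (case k of 0 \<Rightarrow> 0 | Suc k \<Rightarrow> \<Sum>i<N. A j i x * W k i x)" for k j x
  have derW: "DERIV (W k j) x :> W' k j x" if "j < N" "x \<in> I" for k j x
    using J(2)[OF cont[OF that(1)] that(2)] by (cases k) (auto simp: W'_def W0 WS)
  have init: "W (Suc k) j x0 = 0" if "j < N" for k j
    unfolding WS by (rule J(1)[OF cont[OF that]])
  define w where "w j x = (\<Sum>k. W k j x)" for j x
  have "summable (\<lambda>k. W k j x) \<and> DERIV (w j) x :> (\<Sum>k. W' k j x)" if j: "j < N" and x: "x \<in> I" for j x
  proof -
    obtain l r where lr: "l < x" "l < x0" "x < r" "x0 < r" "{l..r} \<subseteq> I"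
      using open_interval_compact_neighbourhood[OF I x x0] .
    obtain B where B: "B \<ge> 0" "\<And>i j x. i < N \<Longrightarrow> j < N \<Longrightarrow> x \<in> {l..r} \<Longrightarrow> \<bar>A i j x\<bar> \<le> B"
      using coefficients_bounded_on_compact[of N l r A] contA lr(5) continuous_on_subset by metis
    define M where "M = (\<Sum>j<N. \<bar>v j\<bar>)"
    define C where "C = real N * B"
    have C0: "C \<ge> 0" using B by (simp add: C_def)
    have M0: "M \<ge> 0" by (simp add: M_def sum_nonneg)
    have step: "\<bar>\<Sum>i<N. A j i t * W k i t\<bar> \<le> C * b"
      if "j < N" "t \<in> {l..r}" "\<And>i. i < N \<Longrightarrow> \<bar>W k i t\<bar> \<le> b" for k j t b
    proof -
      have "\<bar>\<Sum>i<N. A j i t * W k i t\<bar> \<le> (\<Sum>i<N. B * b)"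
        by (rule order_trans[OF sum_abs sum_mono])
          (use that B in \<open>auto simp: abs_mult intro!: mult_mono\<close>)
      then show ?thesis by (simp add: C_def)
    qed
    have bnd: "j < N \<Longrightarrow> t \<in> {l..r} \<Longrightarrow> \<bar>W k j t\<bar> \<le> M * C ^ k / fact k * \<bar>t - x0\<bar> ^ k" for k j t
    proof (induction k arbitrary: j t)
      case 0
      then show ?case by (auto simp: W0 M_def intro!: member_le_sum)
    next
      case (Suc k)
      have "\<bar>W (Suc k) j t\<bar> \<le> M * C ^ Suc k / fact k * \<bar>t - x0\<bar> ^ Suc k / Suc k"
      proof (rule power_bound_antiderivative[of l r "W (Suc k) j" "W' (Suc k) j"])
        fix s assume s: "s \<in> {l..r}"
        show "DERIV (W (Suc k) j) s :> W' (Suc k) j s" using derW Suc.prems s lr by blast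
        show "\<bar>W' (Suc k) j s\<bar> \<le> M * C ^ Suc k / fact k * \<bar>s - x0\<bar> ^ k"
          using step[OF Suc.prems(1) s Suc.IH[OF _ s]] by (simp add: W'_def mult_ac)
      qed (use lr Suc.prems init in auto)
      then show ?case by (simp add: field_simps)
    qed
    define R where "R = r - l"
    have R: "\<bar>t - x0\<bar> \<le> R" if "t \<in> {l..r}" for t using that lr by (auto simp: R_def)
    have bndR: "\<bar>W k j t\<bar> \<le> M * ((C * R) ^ k / fact k)" if "j < N" "t \<in> {l..r}" for k j t
    proof -
      have "M * C ^ k / fact k * \<bar>t - x0\<bar> ^ k \<le> M * C ^ k / fact k * R ^ k"
        using R[OF that(2)] C0 M0 by (intro mult_left_mono power_mono) auto
      then show ?thesis using bnd[OF that, of k] by (simp add: power_mult_distrib mult_ac)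
    qed
    have summ: "summable (\<lambda>k. M * ((C * R) ^ k / fact k))"
      using summable_exp[of "C * R"] by (intro summable_mult) (simp add: divide_inverse mult.commute)
    define m where "m k = (case k of 0 \<Rightarrow> 0 | Suc k \<Rightarrow> C * (M * ((C * R) ^ k / fact k)))" for k
    have "summable (\<lambda>k. m (Suc k))"
      using summable_mult[OF summ, of C] by (simp add: m_def)
    then have "summable m" by (simp only: summable_Suc_iff)
    have bndW': "norm (W' k j t) \<le> m k" if "t \<in> {l..r}" for k t
      using step[OF j that bndR[OF _ that]] by (cases k) (auto simp: W'_def m_def)
    \<comment> \<open>the derivatives of the terms are dominated by an exponential series, shifted by one index\<close>
    have unif: "uniformly_convergent_on {l..r} (\<lambda>n t. \<Sum>k<n. W' k j t)"
      by (rule Weierstrass_m_test'[OF bndW' \<open>summable m\<close>])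
    have sum0: "summable (\<lambda>k. W k j x0)"
      by (rule summable_comparison_test'[OF summ, of 0]) (use bndR[OF j] lr in auto)
    have d: "(W k j has_field_derivative W' k j t) (at t within {l..r})" if "t \<in> {l..r}" for k t
      using derW[OF j] that lr(5) by (meson has_field_derivative_at_within subsetD)
    have "x \<in> interior {l..r}" using lr by simp
    moreover have "x0 \<in> {l..r}" using lr by simp
    ultimately show ?thesis
      using has_field_derivative_series'[OF convex_closed_interval d unif _ sum0, of x]
      unfolding w_def by (auto simp: cbox_interval)
  qed
  then have summW: "summable (\<lambda>k. W k j x)" and derw: "DERIV (w j) x :> (\<Sum>k. W' k j x)"
    if "j < N" "x \<in> I" for j x using that by blast+
  have "(\<Sum>k. W' k j x) = (\<Sum>i<N. A j i x * w i x)" if "j < N" "x \<in> I" for j x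
  proof -
    have "(\<lambda>k. \<Sum>i<N. A j i x * W k i x) sums (\<Sum>i<N. A j i x * w i x)"
      unfolding w_def using summW that by (intro sums_sum sums_mult summable_sums) auto
    then have "(\<lambda>k. W' (Suc k) j x) sums (\<Sum>i<N. A j i x * w i x)" by (simp add: W'_def)
    then have "(\<lambda>k. W' k j x) sums ((\<Sum>i<N. A j i x * w i x) + W' 0 j x)"
      using sums_Suc_iff[of "\<lambda>k. W' k j x"] by blast
    then show ?thesis by (simp add: sums_unique[symmetric] W'_def)
  qed
  moreover have "w j x0 = v j" if "j < N" for j
  proof -
    have "(\<lambda>k. W k j x0) sums (\<Sum>k<1. W k j x0)"
      by (rule sums_finite) (use init[OF that] in \<open>auto simp: gr0_conv_Suc\<close>)
    then show ?thesis by (simp add: w_def sums_unique[symmetric] W0)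
  qed
  ultimately show ?thesis using derw by (intro exI[of _ w]) auto
qed

lemma linear_system_smooth:
  fixes A :: "nat \<Rightarrow> nat \<Rightarrow> real \<Rightarrow> real" and w :: "nat \<Rightarrow> real \<Rightarrow> real"
  assumes I: "open I"
    and smA: "\<And>i j. i < N \<Longrightarrow> j < N \<Longrightarrow> smooth_on I (A i j)"
    and der: "\<And>j x. j < N \<Longrightarrow> x \<in> I \<Longrightarrow> DERIV (w j) x :> (\<Sum>i<N. A j i x * w i x)"
    and "j < N"
  shows "smooth_on I (w j)"
proof -
  have sumCk: "Ck_on k I (\<lambda>x. \<Sum>i\<in>K. f i x)"
    if "finite K" "\<And>i. i \<in> K \<Longrightarrow> Ck_on k I (f i)" for k K and f :: "nat \<Rightarrow> real \<Rightarrow> real"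
    using that by (induction K) (auto intro: Ck_on_add[OF I] simp: Ck_on_const)
  have "j < N \<Longrightarrow> Ck_on k I (w j)" for k j
  proof (induction k arbitrary: j)
    case 0
    then show ?case using der by (simp, meson DERIV_isCont continuous_at_imp_continuous_on)
  next
    case (Suc k)
    show ?case
      by (rule Ck_on_Suc_realI[OF I der[OF Suc.prems]])
        (use Suc smA in \<open>auto intro!: sumCk Ck_on_mult[OF I] simp: smooth_on_def\<close>)
  qed
  then show ?thesis using \<open>j < N\<close> by (simp add: smooth_on_def)
qed

text \<open>The matrix of the first-order system satisfied by \<open>(y, y', \<dots>, y\<^sup>(\<^sup>n\<^sup>-\<^sup>1\<^sup>))\<close>.\<close>

definition companion :: "nat \<Rightarrow> (nat \<Rightarrow> real \<Rightarrow> real) \<Rightarrow> nat \<Rightarrow> nat \<Rightarrow> real \<Rightarrow> real" where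
  "companion n c j i x = (if Suc j < n then (if i = Suc j then 1 else 0) else - c i x)"

lemma companion_sum:
  "j < n \<Longrightarrow> (\<Sum>i<n. companion n c j i x * f i) = (if Suc j < n then f (Suc j) else - (\<Sum>i<n. c i x * f i))"
  by (simp add: companion_def if_distrib[of "\<lambda>z. z * _"] sum_negf cong: if_cong)

lemma smooth_on_companion: "open I \<Longrightarrow> (\<And>j. j < n \<Longrightarrow> smooth_on I (c j)) \<Longrightarrow> i < n \<Longrightarrow> j < n \<Longrightarrow> smooth_on I (companion n c i j)"
  by (cases "Suc i < n") (simp_all add: companion_def[abs_def] smooth_on_minus)

lemma linear_ode_unique:
  assumes I: "open_interval I" and c: "\<And>j. j < n \<Longrightarrow> smooth_on I (c j)" and "x0 \<in> I"
    and y: "smooth_on I y" and eq: "\<And>x. x \<in> I \<Longrightarrow> linear_ode n c x (\<lambda>j. (deriv ^^ j) y x) = 0"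
    and init: "\<And>j. j < n \<Longrightarrow> (deriv ^^ j) y x0 = 0" and "0 < n" "x \<in> I"
  shows "y x = 0"
proof -
  have op: "open I" using I by (simp add: open_interval_def)
  have "(deriv ^^ 0) y x = 0"
  proof (rule linear_system_unique[OF I, of n "companion n c" "\<lambda>j. (deriv ^^ j) y" x0 x])
    show "continuous_on I (companion n c i j)" if "i < n" "j < n" for i j
      using smooth_on_companion[OF op c that] by (rule smooth_on_imp_continuous_on)
    fix j x assume j: "j < n" and x: "x \<in> I"
    have "(deriv ^^ Suc j) y x = (\<Sum>i<n. companion n c j i x * (deriv ^^ i) y x)"
    proof (cases "Suc j < n")
      case True
      then show ?thesis using j by (simp add: companion_sum)
    next
      case False
      have "n = Suc j" using j False by simp
      have "(deriv ^^ n) y x = (\<Sum>i<n. companion n c j i x * (deriv ^^ i) y x)"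
        using eq[OF x] companion_sum[OF j, of c x "\<lambda>i. (deriv ^^ i) y x"] False
        unfolding linear_ode_def if_not_P[OF False] by linarith
      then show ?thesis using \<open>n = Suc j\<close> by simp
    qed
    then show "DERIV ((deriv ^^ j) y) x :> (\<Sum>i<n. companion n c j i x * (deriv ^^ i) y x)"
      using smooth_on_DERIV_higher[OF y x, of j] by (simp only:)
  qed (use assms in auto)
  then show ?thesis by simp
qed

lemma linear_ode_exists:
  assumes I: "open_interval I" and c: "\<And>j. j < n \<Longrightarrow> smooth_on I (c j)" and x0: "x0 \<in> I" and n: "0 < n"
  obtains y where "smooth_on I y" "\<And>x. x \<in> I \<Longrightarrow> linear_ode n c x (\<lambda>j. (deriv ^^ j) y x) = 0"
    "\<And>j. j < n \<Longrightarrow> (deriv ^^ j) y x0 = v j"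
proof -
  have op: "open I" using I by (simp add: open_interval_def)
  have sm: "smooth_on I (companion n c i j)" if "i < n" "j < n" for i j
    by (rule smooth_on_companion[OF op c that])
  obtain w where w: "\<And>j. j < n \<Longrightarrow> w j x0 = v j"
    "\<And>j x. j < n \<Longrightarrow> x \<in> I \<Longrightarrow> DERIV (w j) x :> (\<Sum>i<n. companion n c j i x * w i x)"
    using linear_system_exists[OF I _ x0, of n "companion n c" v] smooth_on_imp_continuous_on[OF sm]
    by blast
  have smw: "smooth_on I (w 0)"
    using linear_system_smooth[OF op, of n "companion n c" w 0] sm w(2) n by blast
  have D: "j < n \<Longrightarrow> x \<in> I \<Longrightarrow> (deriv ^^ j) (w 0) x = w j x" for j x
  proof (induction j arbitrary: x)
    case (Suc j)
    have "(deriv ^^ Suc j) (w 0) x = deriv (w j) x"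
      using deriv_cong_open[OF op Suc.prems(2), of "(deriv ^^ j) (w 0)" "w j"] Suc by simp
    also have "\<dots> = w (Suc j) x"
      using w(2)[of j x] Suc.prems by (intro DERIV_imp_deriv) (simp add: companion_sum)
    finally show ?case .
  qed simp
  have "linear_ode n c x (\<lambda>j. (deriv ^^ j) (w 0) x) = 0" if x: "x \<in> I" for x
  proof -
    obtain k where k: "n = Suc k" using n by (cases n) auto
    have "(deriv ^^ Suc k) (w 0) x = deriv (w k) x"
      using deriv_cong_open[OF op x, of "(deriv ^^ k) (w 0)" "w k"] D k by simp
    also have "\<dots> = - (\<Sum>i<n. c i x * w i x)"
      using w(2)[of k x] x k by (intro DERIV_imp_deriv) (simp add: companion_sum del: sum.lessThan_Suc)
    finally show ?thesis using D x k by (simp add: linear_ode_def del: sum.lessThan_Suc funpow.simps)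
  qed
  moreover have "(deriv ^^ j) (w 0) x0 = v j" if "j < n" for j
    using D[OF that x0] w(1)[OF that] by simp
  ultimately show ?thesis using smw by (intro that[of "w 0"])
qed

section \<open>Dimension by linear functionals\<close>

lemma functionals_sum:
  fixes \<Phi> :: "vector_field \<Rightarrow> nat \<Rightarrow> real"
  assumes sub: "vf.subspace V"
    and add: "\<And>X Y. X \<in> V \<Longrightarrow> Y \<in> V \<Longrightarrow> \<Phi> (X + Y) i = \<Phi> X i + \<Phi> Y i"
    and scale: "\<And>r X. X \<in> V \<Longrightarrow> \<Phi> (\<lambda>z. r *\<^sub>R X z) i = r * \<Phi> X i"
    and "\<And>k. k \<in> K \<Longrightarrow> b k \<in> V"
  shows "(\<Sum>k\<in>K. (\<lambda>z. r k *\<^sub>R b k z)) \<in> V \<and> \<Phi> (\<Sum>k\<in>K. (\<lambda>z. r k *\<^sub>R b k z)) i = (\<Sum>k\<in>K. r k * \<Phi> (b k) i)"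
proof -
  have 0: "0 \<in> V" using sub by (rule vf.subspace_0)
  then have "\<Phi> (\<lambda>z. 0 *\<^sub>R (0 :: vector_field) z) i = 0 * \<Phi> 0 i" by (rule scale)
  then have \<Phi>0: "\<Phi> 0 i = 0" by (simp add: zero_fun_def)
  show ?thesis using assms(4)
  proof (induction K rule: infinite_finite_induct)
    case (insert k K)
    have bk: "b k \<in> V" using insert.prems by simp
    have rb: "(\<lambda>z. r k *\<^sub>R b k z) \<in> V"
      using insert.prems vf.subspace_scale[OF sub] by blast
    have IH: "(\<Sum>k\<in>K. (\<lambda>z. r k *\<^sub>R b k z)) \<in> V"
      "\<Phi> (\<Sum>k\<in>K. (\<lambda>z. r k *\<^sub>R b k z)) i = (\<Sum>k\<in>K. r k * \<Phi> (b k) i)"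
      using insert by auto
    show ?case
      unfolding sum.insert[OF insert.hyps] add[OF rb IH(1)] IH(2) scale[OF bk]
      using vf.subspace_add[OF sub rb IH(1)] by blast
  qed (use 0 \<Phi>0 in auto)
qed

text \<open>If the values can be prescribed, preimages of the unit vectors form a basis of \<open>V\<close>. Conversely, the image of a
  basis with \<open>N\<close> elements is independent in the \<open>N\<close>-dimensional space of values, and a vector outside its span
  would make \<open>N + 1\<close> independent vectors there.\<close>

lemma dim_eq_iff_functionals_onto:
  fixes V :: "vector_field set" and \<Phi> :: "vector_field \<Rightarrow> nat \<Rightarrow> real"
  assumes sub: "vf.subspace V"
    and add: "\<And>X Y i. X \<in> V \<Longrightarrow> Y \<in> V \<Longrightarrow> \<Phi> (X + Y) i = \<Phi> X i + \<Phi> Y i"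
    and scale: "\<And>r X i. X \<in> V \<Longrightarrow> \<Phi> (\<lambda>z. r *\<^sub>R X z) i = r * \<Phi> X i"
    and inj: "\<And>X. X \<in> V \<Longrightarrow> (\<And>i. i < N \<Longrightarrow> \<Phi> X i = 0) \<Longrightarrow> X = 0"
    and "0 < N"
  shows "vf.dim V = N \<longleftrightarrow> (\<forall>e. \<exists>X\<in>V. \<forall>i<N. \<Phi> X i = e i)"
proof
  note lin = functionals_sum[where \<Phi>=\<Phi>, OF sub add scale]
  have diff: "\<Phi> (X - Y) i = \<Phi> X i - \<Phi> Y i" if "X \<in> V" "Y \<in> V" for X Y i
  proof -
    have "X - Y \<in> V" using vf.subspace_diff[OF sub] that by blast
    from add[OF this that(2), of i] show ?thesis by simp
  qed
  {
    assume surj: "\<forall>e. \<exists>X\<in>V. \<forall>i<N. \<Phi> X i = e i"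
    then have "\<forall>k. \<exists>X\<in>V. \<forall>i<N. \<Phi> X i = (if i = k then 1 else 0)" by (auto intro: surj[rule_format])
    then obtain b where b: "\<And>k. b k \<in> V" "\<And>k i. i < N \<Longrightarrow> \<Phi> (b k) i = (if i = k then 1 else 0)"
      by metis
    have injb: "inj_on b {..<N}"
      by (rule inj_onI) (metis b(2) lessThan_iff zero_neq_one)
    have \<Phi>b: "\<Phi> (\<Sum>k<N. (\<lambda>z. r k *\<^sub>R b k z)) i = r i" if "i < N" for r i
      using lin[where K="{..<N}" and b=b and i=i and r=r] b that by (simp add: if_distrib cong: if_cong)
    show "vf.dim V = N"
    proof (rule vf.dim_unique)
      show "b ` {..<N} \<subseteq> V" using b by auto
      show "V \<subseteq> vf.span (b ` {..<N})"
      proof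
        fix X assume X: "X \<in> V"
        let ?S = "\<Sum>k<N. (\<lambda>z. \<Phi> X k *\<^sub>R b k z)"
        have SV: "?S \<in> V" using lin[where K="{..<N}" and b=b] b by blast
        have "X - ?S = 0"
        proof (rule inj)
          show "X - ?S \<in> V" using vf.subspace_diff[OF sub X SV] .
          show "\<Phi> (X - ?S) i = 0" if "i < N" for i
            using diff[OF X SV] \<Phi>b[OF that] by simp
        qed
        then have "X = ?S" by simp
        also have "\<dots> \<in> vf.span (b ` {..<N})"
          by (intro vf.span_sum vf.span_scale vf.span_base) auto
        finally show "X \<in> vf.span (b ` {..<N})" .
      qed
      show "vf.independent (b ` {..<N})"
      proof
        assume "vf.dependent (b ` {..<N})"
        then obtain u where u: "\<exists>v\<in>b ` {..<N}. u v \<noteq> 0" "(\<Sum>v\<in>b ` {..<N}. (\<lambda>z. u v *\<^sub>R v z)) = 0"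
          using vf.dependent_finite[of "b ` {..<N}"] by auto
        have "(\<Sum>k<N. (\<lambda>z. u (b k) *\<^sub>R b k z)) = 0"
          using u(2) by (simp add: sum.reindex[OF injb])
        moreover have "\<Phi> 0 i = 0" for i using diff[of 0 0 i] vf.subspace_0[OF sub] by simp
        ultimately have "u (b i) = 0" if "i < N" for i using \<Phi>b[OF that, of "\<lambda>k. u (b k)"] by simp
        then show False using u(1) by auto
      qed
      show "card (b ` {..<N}) = N" by (simp add: card_image injb)
    qed
  }
  {
    assume dim: "vf.dim V = N"
    interpret R: vector_space "\<lambda>r (f :: nat \<Rightarrow> real) i. r * f i"
      by unfold_locales (auto simp: fun_eq_iff algebra_simps)
    obtain B where B: "B \<subseteq> V" "vf.independent B" "V \<subseteq> vf.span B" "card B = N"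
      using vf.basis_exists[of V] dim by metis
    have finB: "finite B" using B(4) \<open>0 < N\<close> card_ge_0_finite by metis
    define \<Psi> where "\<Psi> X i = (if i < N then \<Phi> X i else 0)" for X i
    have linB: "(\<Sum>b\<in>B. (\<lambda>i. r b * \<Psi> b i)) = \<Psi> (\<Sum>b\<in>B. (\<lambda>z. r b *\<^sub>R b z))" for r
    proof
      fix i
      have "(\<Sum>b\<in>B. (\<lambda>i. r b * \<Psi> b i)) i = (\<Sum>b\<in>B. r b * \<Psi> b i)"
        by (induction B rule: infinite_finite_induct) auto
      then show "(\<Sum>b\<in>B. (\<lambda>i. r b * \<Psi> b i)) i = \<Psi> (\<Sum>b\<in>B. (\<lambda>z. r b *\<^sub>R b z)) i"
        using lin[where K=B and b="\<lambda>b. b" and i=i and r=r] B(1) by (auto simp: \<Psi>_def subset_iff)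
    qed
    have inB: "(\<Sum>b\<in>B. (\<lambda>z. r b *\<^sub>R b z)) \<in> V" for r
      using lin[where K=B and b="\<lambda>b. b" and r=r] B(1) by blast
    have \<Psi>inj: "X = 0" if "X \<in> V" "\<Psi> X = 0" for X
    proof (rule inj[OF that(1)])
      show "\<Phi> X i = 0" if "i < N" for i using fun_cong[OF \<open>\<Psi> X = 0\<close>, of i] that by (simp add: \<Psi>_def)
    qed
    have inj\<Psi>: "inj_on \<Psi> B"
    proof (rule inj_onI)
      fix X Y assume XY: "X \<in> B" "Y \<in> B" "\<Psi> X = \<Psi> Y"
      have "X - Y = 0"
      proof (rule \<Psi>inj)
        show "X - Y \<in> V" using vf.subspace_diff[OF sub] XY B(1) by blast
        have XYV: "X \<in> V" "Y \<in> V" using XY B(1) by auto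
        show "\<Psi> (X - Y) = 0"
        proof
          fix i show "\<Psi> (X - Y) i = 0 i"
            using fun_cong[OF XY(3), of i] by (simp add: \<Psi>_def diff[OF XYV] split: if_splits)
        qed
      qed
      then show "X = Y" by simp
    qed
    have ind: "R.independent (\<Psi> ` B)"
    proof
      assume "R.dependent (\<Psi> ` B)"
      then obtain u where u: "\<exists>v\<in>\<Psi> ` B. u v \<noteq> 0" "(\<Sum>v\<in>\<Psi> ` B. (\<lambda>i. u v * v i)) = 0"
        using R.dependent_finite[of "\<Psi> ` B"] finB by auto
      have "\<Psi> (\<Sum>b\<in>B. (\<lambda>z. u (\<Psi> b) *\<^sub>R b z)) = 0"
        using u(2) linB[of "\<lambda>b. u (\<Psi> b)"] by (simp add: sum.reindex[OF inj\<Psi>])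
      then have "(\<Sum>b\<in>B. (\<lambda>z. u (\<Psi> b) *\<^sub>R b z)) = 0" by (rule \<Psi>inj[OF inB])
      moreover have "\<exists>b\<in>B. u (\<Psi> b) \<noteq> 0" using u(1) by auto
      ultimately have "vf.dependent B"
        unfolding vf.dependent_finite[OF finB] by (intro exI[of _ "\<lambda>b. u (\<Psi> b)"] conjI)
      then show False using B(2) by contradiction
    qed
    define E where "E = (\<lambda>k i. if i = k then 1 else 0 :: real) ` {..<N}"
    have spanE: "f \<in> R.span E" if "\<And>i. i \<ge> N \<Longrightarrow> f i = 0" for f
    proof -
      have "f = (\<Sum>k<N. (\<lambda>i. f k * (if i = k then 1 else 0)))"
      proof
        fix i
        have "(\<Sum>k\<in>K. (\<lambda>i. f k * (if i = k then 1 else 0))) i = (\<Sum>k\<in>K. f k * (if i = k then 1 else 0))" for K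
          by (induction K rule: infinite_finite_induct) auto
        then show "f i = (\<Sum>k<N. (\<lambda>i. f k * (if i = k then 1 else 0))) i"
          using that[of i] by (cases "i < N") (auto simp: if_distrib cong: if_cong)
      qed
      also have "\<dots> \<in> R.span E" unfolding E_def
        by (intro R.span_sum R.span_scale R.span_base) auto
      finally show ?thesis .
    qed
    show "\<forall>e. \<exists>X\<in>V. \<forall>i<N. \<Phi> X i = e i"
    proof
      fix e :: "nat \<Rightarrow> real"
      define e' where "e' i = (if i < N then e i else 0)" for i
      have "e' \<in> R.span (\<Psi> ` B)"
      proof (rule ccontr)
        assume notin: "e' \<notin> R.span (\<Psi> ` B)"
        then have "R.independent (insert e' (\<Psi> ` B))" using ind R.independent_insertI by blast
        moreover have "insert e' (\<Psi> ` B) \<subseteq> R.span E"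
          by (auto intro!: spanE simp: e'_def \<Psi>_def)
        ultimately have "card (insert e' (\<Psi> ` B)) \<le> card E"
          using R.independent_span_bound[of E] by (simp add: E_def)
        moreover have "card E \<le> N" unfolding E_def using card_image_le[of "{..<N}"] by simp
        moreover have "e' \<notin> \<Psi> ` B" using notin R.span_base[of e' "\<Psi> ` B"] by blast
        then have "card (insert e' (\<Psi> ` B)) = Suc N"
          using finB inj\<Psi> B(4) by (simp add: card_image)
        ultimately show False by simp
      qed
      then obtain u where "e' = (\<Sum>v\<in>\<Psi> ` B. (\<lambda>i. u v * v i))"
        using R.span_finite[of "\<Psi> ` B"] finB by auto
      then have "e' = \<Psi> (\<Sum>b\<in>B. (\<lambda>z. u (\<Psi> b) *\<^sub>R b z))"
        using linB[of "\<lambda>b. u (\<Psi> b)"] by (simp add: sum.reindex[OF inj\<Psi>])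
      then show "\<exists>X\<in>V. \<forall>i<N. \<Phi> X i = e i"
        using inB[of "\<lambda>b. u (\<Psi> b)"] by (intro bexI) (auto simp: e'_def \<Psi>_def fun_eq_iff split: if_splits)
    qed
  }
qed

section \<open>Differential polynomials and total derivatives\<close>

text \<open>\<open>tder I m F F'\<close>: over \<open>I\<close>, \<open>F\<close> is a polynomial in the jet variables \<open>u 1, \<dots>, u m\<close> whose coefficients are smooth
  functions of \<open>(x, u 0)\<close>, and \<open>F'\<close> is its total derivative \<open>D\<^sub>x F\<close> computed by the rules of calculus. Carrying
  \<open>F'\<close> along makes it possible to differentiate prolongation formulas symbolically; differentiability of all
  functions involved is settled once, in the lemma \<open>tder_partials\<close>.\<close>

inductive tder :: "real set \<Rightarrow> nat \<Rightarrow> diff_fun \<Rightarrow> diff_fun \<Rightarrow> bool" for I :: "real set" where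
  base: "smooth_on (I \<times> UNIV) f \<Longrightarrow>
    tder I m (\<lambda>x u. f (x, u 0)) (\<lambda>x u. partial_x f (x, u 0) + u 1 * partial_y f (x, u 0))"
| var: "j \<le> m \<Longrightarrow> tder I m (\<lambda>x u. u j) (\<lambda>x u. u (Suc j))"
| add: "tder I m F F' \<Longrightarrow> tder I m G G' \<Longrightarrow> tder I m (\<lambda>x u. F x u + G x u) (\<lambda>x u. F' x u + G' x u)"
| mult: "tder I m F F' \<Longrightarrow> tder I m G G' \<Longrightarrow>
    tder I m (\<lambda>x u. F x u * G x u) (\<lambda>x u. F' x u * G x u + F x u * G' x u)"

lemma tder_mono: "tder I m F F' \<Longrightarrow> m \<le> k \<Longrightarrow> tder I k F F'"
proof (induction rule: tder.induct)
  case (base f m)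
  then show ?case using tder.base by blast
qed (auto intro: tder.intros)

lemma tder_const: "tder I m (\<lambda>x u. r) (\<lambda>x u. 0)"
  using tder.base[of I "\<lambda>_. r" m] by (simp add: partial_def)

lemma tder_next: "tder I m F F' \<Longrightarrow> \<exists>F''. tder I (Suc m) F' F''"
proof (induction rule: tder.induct)
  case (base f m)
  show ?case
    by (rule exI, rule tder.add[OF tder.base[OF smooth_on_partial_x[OF base]]
          tder.mult[OF tder.var tder.base[OF smooth_on_partial_y[OF base]]]]) simp
next
  case (var j m)
  then show ?case using tder.var[of "Suc j" "Suc m" I] by auto
next
  case (add m F F' G G')
  then show ?case using tder.add by blast
next
  case (mult m F F' G G')
  then obtain F'' G'' where "tder I (Suc m) F' F''" "tder I (Suc m) G' G''" by blast
  moreover have "tder I (Suc m) F F'" "tder I (Suc m) G G'"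
    using mult tder_mono by (meson le_SucI order_refl)+
  ultimately show ?case using tder.add tder.mult by blast
qed

lemma tder_eq_on_jet: "tder I m F F' \<Longrightarrow> (\<And>j. j \<le> m \<Longrightarrow> u j = v j) \<Longrightarrow> F x u = F x v"
  by (induction rule: tder.induct) auto

text \<open>The link between the symbolic \<open>F'\<close> and the partial derivatives out of which \<open>total_deriv\<close> is built.\<close>

lemma tder_partials:
  assumes "tder I m F F'" "x \<in> I"
  shows "\<exists>Fx Fu. DERIV (\<lambda>t. F t u) x :> Fx \<and>
    (\<forall>k. DERIV (\<lambda>t. F x (u(k := t))) (u k) :> Fu k) \<and>
    F' x u = Fx + (\<Sum>k\<le>m. u (Suc k) * Fu k)"
  using assms
proof (induction rule: tder.induct)
  case (base f m)
  show ?case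
  proof (intro exI conjI allI)
    show "DERIV (\<lambda>t. f (t, u 0)) x :> partial_x f (x, u 0)"
      by (rule smooth_on_strip_DERIV_x[OF base])
    show "DERIV (\<lambda>t. f (x, (u(k := t)) 0)) (u k) :> (if k = 0 then partial_y f (x, u 0) else 0)" for k
      using smooth_on_strip_DERIV_y[OF base, of "u 0"] by auto
    show "partial_x f (x, u 0) + u 1 * partial_y f (x, u 0) =
      partial_x f (x, u 0) + (\<Sum>k\<le>m. u (Suc k) * (if k = 0 then partial_y f (x, u 0) else 0))"
      by (simp add: if_distrib cong: if_cong)
  qed
next
  case (var j m)
  show ?case
  proof (intro exI conjI allI)
    show "DERIV (\<lambda>t. u j) x :> 0" by simp
    show "DERIV (\<lambda>t. (u(k := t)) j) (u k) :> (if k = j then 1 else 0)" for k by auto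
    show "u (Suc j) = 0 + (\<Sum>k\<le>m. u (Suc k) * (if k = j then 1 else 0))"
      using var by (simp add: if_distrib cong: if_cong)
  qed
next
  case (add m F F' G G')
  then obtain Fx Fu Gx Gu where
    F: "DERIV (\<lambda>t. F t u) x :> Fx" "\<And>k. DERIV (\<lambda>t. F x (u(k := t))) (u k) :> Fu k"
      "F' x u = Fx + (\<Sum>k\<le>m. u (Suc k) * Fu k)"
    and G: "DERIV (\<lambda>t. G t u) x :> Gx" "\<And>k. DERIV (\<lambda>t. G x (u(k := t))) (u k) :> Gu k"
      "G' x u = Gx + (\<Sum>k\<le>m. u (Suc k) * Gu k)"
    by blast
  show ?case
  proof (intro exI conjI allI)
    show "DERIV (\<lambda>t. F t u + G t u) x :> Fx + Gx" by (intro DERIV_add F G)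
    show "DERIV (\<lambda>t. F x (u(k := t)) + G x (u(k := t))) (u k) :> Fu k + Gu k" for k
      by (intro DERIV_add F G)
    show "F' x u + G' x u = Fx + Gx + (\<Sum>k\<le>m. u (Suc k) * (Fu k + Gu k))"
      by (simp add: F G sum.distrib algebra_simps)
  qed
next
  case (mult m F F' G G')
  then obtain Fx Fu Gx Gu where
    F: "DERIV (\<lambda>t. F t u) x :> Fx" "\<And>k. DERIV (\<lambda>t. F x (u(k := t))) (u k) :> Fu k"
      "F' x u = Fx + (\<Sum>k\<le>m. u (Suc k) * Fu k)"
    and G: "DERIV (\<lambda>t. G t u) x :> Gx" "\<And>k. DERIV (\<lambda>t. G x (u(k := t))) (u k) :> Gu k"
      "G' x u = Gx + (\<Sum>k\<le>m. u (Suc k) * Gu k)"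
    by blast
  show ?case
  proof (intro exI conjI allI)
    show "DERIV (\<lambda>t. F t u * G t u) x :> Fx * G x u + Gx * F x u"
      by (rule DERIV_mult[OF F(1) G(1)])
    show "DERIV (\<lambda>t. F x (u(k := t)) * G x (u(k := t))) (u k) :> Fu k * G x u + Gu k * F x u" for k
      using DERIV_mult[OF F(2)[of k] G(2)[of k]] by simp
    have "(\<Sum>k\<le>m. u (Suc k) * (Fu k * G x u + Gu k * F x u)) =
        (\<Sum>k\<le>m. u (Suc k) * Fu k) * G x u + F x u * (\<Sum>k\<le>m. u (Suc k) * Gu k)"
      by (simp add: sum_distrib_left sum_distrib_right sum.distrib algebra_simps)
    then show "F' x u * G x u + F x u * G' x u =
        Fx * G x u + Gx * F x u + (\<Sum>k\<le>m. u (Suc k) * (Fu k * G x u + Gu k * F x u))"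
      by (simp add: F G algebra_simps)
  qed
qed

lemma total_deriv_eq_tder:
  assumes "tder I m F F'" "x \<in> I"
  shows "total_deriv m F x u = F' x u"
proof -
  obtain Fx Fu where F: "DERIV (\<lambda>t. F t u) x :> Fx" "\<And>k. DERIV (\<lambda>t. F x (u(k := t))) (u k) :> Fu k"
      "F' x u = Fx + (\<Sum>k\<le>m. u (Suc k) * Fu k)"
    using tder_partials[OF assms] by blast
  then show ?thesis
    by (simp add: total_deriv_def jet_partial_def DERIV_imp_deriv[OF F(1)] DERIV_imp_deriv[OF F(2)])
qed

lemma total_deriv_cong:
  assumes "open I" "x \<in> I" "\<And>x u. x \<in> I \<Longrightarrow> F x u = G x u"
  shows "total_deriv m F x u = total_deriv m G x u"
proof -
  have "deriv (\<lambda>t. F t u) x = deriv (\<lambda>t. G t u) x"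
    by (rule deriv_cong_open[OF assms(1,2)]) (use assms(3) in auto)
  then show ?thesis using assms by (simp add: total_deriv_def jet_partial_def)
qed

lemma total_deriv_tder_cong:
  assumes "open I" "x \<in> I" "\<And>x u. x \<in> I \<Longrightarrow> F x u = G x u" "tder I m G G'"
  shows "total_deriv m F x u = G' x u"
  using total_deriv_cong[OF assms(1-3)] total_deriv_eq_tder[OF assms(4,2)] by simp

lemma tder_cmult: "tder I m F F' \<Longrightarrow> tder I m (\<lambda>x u. r * F x u) (\<lambda>x u. r * F' x u)"
  using tder.mult[OF tder_const] by simp

definition dpoly :: "real set \<Rightarrow> nat \<Rightarrow> diff_fun \<Rightarrow> bool" where
  "dpoly I m F \<longleftrightarrow> (\<exists>F'. tder I m F F')"

lemma dpoly_intros: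
  "smooth_on (I \<times> UNIV) f \<Longrightarrow> dpoly I m (\<lambda>x u. f (x, u 0))"
  "j \<le> m \<Longrightarrow> dpoly I m (\<lambda>x u. u j)"
  "dpoly I m F \<Longrightarrow> dpoly I m G \<Longrightarrow> dpoly I m (\<lambda>x u. F x u + G x u)"
  "dpoly I m F \<Longrightarrow> dpoly I m G \<Longrightarrow> dpoly I m (\<lambda>x u. F x u * G x u)"
  "dpoly I m (\<lambda>x u. r)"
  unfolding dpoly_def
  by (rule exI, erule tder.base, rule exI, erule tder.var, (elim exE, rule exI, erule (1) tder.add),
      (elim exE, rule exI, erule (1) tder.mult), rule exI, rule tder_const)

lemma dpoly_diff: "dpoly I m F \<Longrightarrow> dpoly I m G \<Longrightarrow> dpoly I m (\<lambda>x u. F x u - G x u)"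
  using dpoly_intros(3)[of I m F "\<lambda>x u. (-1) * G x u"] dpoly_intros(4)[OF dpoly_intros(5)[of I m "-1"], of G]
  by simp

lemma dpoly_mono: "dpoly I m F \<Longrightarrow> m \<le> k \<Longrightarrow> dpoly I k F"
  unfolding dpoly_def using tder_mono by blast

lemma dpoly_total_derivative: "tder I m F F' \<Longrightarrow> dpoly I (Suc m) F'"
  unfolding dpoly_def by (rule tder_next)

lemma dpoly_eq_on_jet: "dpoly I m F \<Longrightarrow> (\<And>j. j \<le> m \<Longrightarrow> u j = v j) \<Longrightarrow> F x u = F x v"
  unfolding dpoly_def using tder_eq_on_jet by blast

text \<open>The highest variable \<open>u (m + 1)\<close> enters \<open>D\<^sub>x F\<close> only through the term \<open>u (m + 1) * \<partial>F/\<partial>(u m)\<close>.\<close>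

lemma tder_affine_top:
  "tder I m F F' \<Longrightarrow> \<exists>P Q. dpoly I m P \<and> dpoly I m Q \<and> (\<forall>x u. F' x u = u (Suc m) * P x u + Q x u)"
proof (induction rule: tder.induct)
  case (base f m)
  have f: "smooth_on (I \<times> UNIV) (partial_x f)" "smooth_on (I \<times> UNIV) (partial_y f)"
    using base smooth_on_partial_x smooth_on_partial_y by blast+
  show ?case
  proof (cases m)
    case 0
    then show ?thesis
      using f by (intro exI[of _ "\<lambda>x u. partial_y f (x, u 0)"] exI[of _ "\<lambda>x u. partial_x f (x, u 0)"])
        (auto intro: dpoly_intros)
  next
    case (Suc k)
    have "dpoly I m (\<lambda>x u. partial_x f (x, u 0) + u 1 * partial_y f (x, u 0))"
      using f Suc by (intro dpoly_intros) auto
    then show ?thesis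
      by (intro exI[of _ "\<lambda>x u. 0"] exI[of _ "\<lambda>x u. partial_x f (x, u 0) + u 1 * partial_y f (x, u 0)"])
        (auto intro: dpoly_intros)
  qed
next
  case (var j m)
  show ?case
  proof (cases "j = m")
    case True
    then show ?thesis
      by (intro exI[of _ "\<lambda>x u. 1"] exI[of _ "\<lambda>x u. 0"]) (auto intro: dpoly_intros)
  next
    case False
    then show ?thesis using var
      by (intro exI[of _ "\<lambda>x u. 0"] exI[of _ "\<lambda>x u. u (Suc j)"]) (auto intro: dpoly_intros)
  qed
next
  case (add m F F' G G')
  then obtain P Q P2 Q2 where PQ: "dpoly I m P" "dpoly I m Q" "dpoly I m P2" "dpoly I m Q2"
    and eq: "\<And>x u. F' x u = u (Suc m) * P x u + Q x u" "\<And>x u. G' x u = u (Suc m) * P2 x u + Q2 x u"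
    by blast
  show ?case
  proof (intro exI conjI allI)
    show "dpoly I m (\<lambda>x u. P x u + P2 x u)" "dpoly I m (\<lambda>x u. Q x u + Q2 x u)"
      by (intro dpoly_intros PQ)+
    show "F' x u + G' x u = u (Suc m) * (P x u + P2 x u) + (Q x u + Q2 x u)" for x u
      unfolding eq by (simp add: algebra_simps)
  qed
next
  case (mult m F F' G G')
  then obtain P Q P2 Q2 where PQ: "dpoly I m P" "dpoly I m Q" "dpoly I m P2" "dpoly I m Q2"
    and eq: "\<And>x u. F' x u = u (Suc m) * P x u + Q x u" "\<And>x u. G' x u = u (Suc m) * P2 x u + Q2 x u"
    by blast
  have FG: "dpoly I m F" "dpoly I m G" using mult by (auto simp: dpoly_def)
  show ?case
  proof (intro exI conjI allI)
    show "dpoly I m (\<lambda>x u. P x u * G x u + F x u * P2 x u)"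
      "dpoly I m (\<lambda>x u. Q x u * G x u + F x u * Q2 x u)"
      by (intro dpoly_intros PQ FG)+
    show "F' x u * G x u + F x u * G' x u =
        u (Suc m) * (P x u * G x u + F x u * P2 x u) + (Q x u * G x u + F x u * Q2 x u)" for x u
      unfolding eq by (simp add: algebra_simps)
  qed
qed

definition lift_tder :: "(real \<times> real \<Rightarrow> real) \<Rightarrow> diff_fun" where
  "lift_tder f x u = partial_x f (x, u 0) + u 1 * partial_y f (x, u 0)"

lemma tder_lift: "smooth_on (I \<times> UNIV) f \<Longrightarrow> tder I m (\<lambda>x u. f (x, u 0)) (lift_tder f)"
  unfolding lift_tder_def[abs_def] by (rule tder.base)

lemma dpoly_lift_tder: "smooth_on (I \<times> UNIV) f \<Longrightarrow> 1 \<le> m \<Longrightarrow> dpoly I m (lift_tder f)"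
  using dpoly_mono[OF dpoly_total_derivative[OF tder_lift[of I f 0]], of m] by simp

lemma lift_tder_fst: "lift_tder (\<lambda>z. f (fst z)) x u = deriv f x"
proof -
  have "(DERIV (\<lambda>t. f (x + t)) 0 :> D) \<longleftrightarrow> (DERIV f x :> D)" for D
    using DERIV_shift[of f D 0 x] by (simp add: add.commute)
  then have "partial_x (\<lambda>z. f (fst z)) (x, u 0) = deriv f x"
    by (simp add: partial_def deriv_def)
  moreover have "partial_y (\<lambda>z. f (fst z)) (x, u 0) = 0"
    by (simp add: partial_def)
  ultimately show ?thesis by (simp add: lift_tder_def)
qed

lemma tder_fst: "open I \<Longrightarrow> smooth_on I f \<Longrightarrow> tder I m (\<lambda>x u. f x) (\<lambda>x u. deriv f x)"
  using tder_lift[OF smooth_on_strip_fst, of I f m] by (simp add: lift_tder_fst[abs_def])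

lemma dpoly_fst: "open I \<Longrightarrow> smooth_on I f \<Longrightarrow> dpoly I m (\<lambda>x u. f x)"
  unfolding dpoly_def by (rule exI, rule tder_fst)

section \<open>Leading terms of the prolongation of a general vector field\<close>

locale smooth_vector_field =
  fixes I :: "real set" and X :: vector_field and \<xi> \<eta> :: "real \<times> real \<Rightarrow> real"
  assumes open_I: "open I"
    and \<xi>_def: "\<xi> = (\<lambda>z. fst (X z))" and \<eta>_def: "\<eta> = (\<lambda>z. snd (X z))"
    and smooth_\<xi>: "smooth_on (I \<times> UNIV) \<xi>" and smooth_\<eta>: "smooth_on (I \<times> UNIV) \<eta>"
begin

abbreviation "xi_x \<equiv> partial_x \<xi>"
abbreviation "xi_y \<equiv> partial_y \<xi>"
abbreviation "eta_x \<equiv> partial_x \<eta>"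
abbreviation "eta_y \<equiv> partial_y \<eta>"
abbreviation "eta_yy \<equiv> partial_y eta_y"

text \<open>This turns every closed formula for one prolongation coefficient into a formula for the next one; all
  formulas below are obtained by iterating it.\<close>

lemma prolong_coeff_Suc_tder:
  assumes "x \<in> I" "\<And>x u. x \<in> I \<Longrightarrow> prolong_coeff X k x u = G x u" "tder I k G G'"
  shows "prolong_coeff X (Suc k) x u = G' x u - u (Suc k) * lift_tder \<xi> x u"
proof -
  have "total_deriv 0 (\<lambda>x u. fst (X (x, u 0))) x u = lift_tder \<xi> x u"
    using total_deriv_eq_tder[OF tder_lift[OF smooth_\<xi>, of 0] assms(1), of u] by (simp add: \<xi>_def)
  moreover have "total_deriv k (prolong_coeff X k) x u = G' x u"
    by (rule total_deriv_tder_cong[OF open_I assms])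
  ultimately show ?thesis by simp
qed

lemma prolong_coeff_dpoly:
  "\<exists>G. dpoly I k G \<and> (\<forall>x\<in>I. \<forall>u. prolong_coeff X k x u = G x u)"
proof (induction k)
  case 0
  show ?case
    using tder.base[OF smooth_\<eta>, of 0] by (auto simp: \<eta>_def dpoly_def)
next
  case (Suc k)
  then obtain G G' where G: "tder I k G G'" "\<And>x u. x \<in> I \<Longrightarrow> prolong_coeff X k x u = G x u"
    by (auto simp: dpoly_def)
  have "dpoly I (Suc k) (\<lambda>x u. G' x u - u (Suc k) * lift_tder \<xi> x u)"
    by (intro dpoly_diff dpoly_intros(4) dpoly_intros(2) dpoly_total_derivative[OF G(1)]
        dpoly_lift_tder[OF smooth_\<xi>]) auto
  then show ?case
    using prolong_coeff_Suc_tder[OF _ G(2,1)] by (auto simp del: prolong_coeff.simps)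
qed

lemma prolong_coeff_eq_on_jet:
  assumes "x \<in> I" "\<And>j. j \<le> k \<Longrightarrow> u j = v j"
  shows "prolong_coeff X k x u = prolong_coeff X k x v"
  using prolong_coeff_dpoly[of k] dpoly_eq_on_jet assms by metis

text \<open>The factor of \<open>u k\<close> in the \<open>k\<close>-th prolongation coefficient, for \<open>k \<ge> 2\<close>. Its total derivative is
  \<open>top_coeff_der k\<close>, of order one, minus a term in \<open>u 2\<close>; that term is the source of the products
  \<open>u 2 * u (k - 1)\<close> below.\<close>

definition top_coeff :: "nat \<Rightarrow> diff_fun" where
  "top_coeff k x u = eta_y (x, u 0) + ((- real k) * xi_x (x, u 0)
     + (- real (Suc k)) * (xi_y (x, u 0) * u 1))"

definition top_coeff_der :: "nat \<Rightarrow> diff_fun" where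
  "top_coeff_der k x u = lift_tder (eta_y) x u + ((- real k) * lift_tder (xi_x) x u
     + (- real (Suc k)) * (lift_tder (xi_y) x u * u 1))"

lemmas smooth_partials = smooth_on_partial_x[OF smooth_\<xi>] smooth_on_partial_y[OF smooth_\<xi>]
  smooth_on_partial_x[OF smooth_\<eta>] smooth_on_partial_y[OF smooth_\<eta>]

lemma tder_top_coeff:
  assumes "1 \<le> m"
  shows "tder I m (top_coeff k) (\<lambda>x u. top_coeff_der k x u - real (Suc k) * (xi_y (x, u 0) * u 2))"
proof -
  have "tder I m (top_coeff k) (\<lambda>x u. lift_tder (eta_y) x u + ((- real k) * lift_tder (xi_x) x u
     + (- real (Suc k)) * (lift_tder (xi_y) x u * u 1 + xi_y (x, u 0) * u (Suc 1))))"
    unfolding top_coeff_def[abs_def]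
    by (intro tder.add tder_cmult tder.mult tder_lift smooth_partials tder.var assms)
  moreover have "(\<lambda>x u. lift_tder (eta_y) x u + ((- real k) * lift_tder (xi_x) x u
     + (- real (Suc k)) * (lift_tder (xi_y) x u * u 1 + xi_y (x, u 0) * u (Suc 1))))
     = (\<lambda>x u. top_coeff_der k x u - real (Suc k) * (xi_y (x, u 0) * u 2))"
    by (intro ext) (simp add: top_coeff_der_def algebra_simps numeral_2_eq_2)
  ultimately show ?thesis by simp
qed

lemma dpoly_top_coeff_der: "1 \<le> m \<Longrightarrow> dpoly I m (top_coeff_der k)"
  unfolding top_coeff_der_def[abs_def]
  by (intro dpoly_intros dpoly_lift_tder smooth_partials) auto

lemma prolong_coeff_1:
  assumes "x \<in> I"
  shows "prolong_coeff X 1 x u = lift_tder \<eta> x u - u 1 * lift_tder \<xi> x u"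
  using prolong_coeff_Suc_tder[OF assms, of 0 "\<lambda>x u. \<eta> (x, u 0)", OF _ tder_lift[OF smooth_\<eta>]]
  by (simp add: \<eta>_def)

definition rest2 :: diff_fun where
  "rest2 x u = lift_tder (eta_x) x u + (u 1 * lift_tder (eta_y) x u
     + (- 1) * (u 1 * (lift_tder (xi_x) x u + u 1 * lift_tder (xi_y) x u)))"

lemma dpoly_rest2: "dpoly I 1 rest2"
  unfolding rest2_def[abs_def]
  by (intro dpoly_intros dpoly_lift_tder smooth_partials) auto

lemma prolong_coeff_2:
  assumes "x \<in> I"
  shows "prolong_coeff X 2 x u = u 2 * top_coeff 2 x u + rest2 x u"
proof -
  let ?G = "\<lambda>x u. (eta_x (x, u 0) + u 1 * eta_y (x, u 0))
      + (- 1) * (u 1 * (xi_x (x, u 0) + u 1 * xi_y (x, u 0)))"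
  let ?H = "\<lambda>x u. (lift_tder (eta_x) x u + (u (Suc 1) * eta_y (x, u 0) + u 1 * lift_tder (eta_y) x u))
      + (- 1) * (u (Suc 1) * (xi_x (x, u 0) + u 1 * xi_y (x, u 0))
         + u 1 * (lift_tder (xi_x) x u + (u (Suc 1) * xi_y (x, u 0) + u 1 * lift_tder (xi_y) x u)))"
  have t: "tder I 1 ?G ?H"
    by (intro tder.add tder_cmult tder.mult tder_lift smooth_partials tder.var) auto
  have "prolong_coeff X (Suc 1) x u = ?H x u - u (Suc 1) * lift_tder \<xi> x u"
    by (rule prolong_coeff_Suc_tder[OF assms _ t]) (subst prolong_coeff_1, assumption, simp add: lift_tder_def)
  then show ?thesis
    unfolding Suc_1 by (simp only: rest2_def top_coeff_def lift_tder_def[of \<xi>]) (simp add: algebra_simps)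
qed

text \<open>In order three the product \<open>u 2 * u (k - 1)\<close> is a square, hence its factor does not fit the pattern of the
  higher orders.\<close>

lemma prolong_coeff_3:
  "\<exists>B R. dpoly I 1 B \<and> dpoly I 1 R \<and> (\<forall>x\<in>I. \<forall>u. prolong_coeff X 3 x u =
     u 3 * top_coeff 3 x u - 3 * (xi_y (x, u 0) * (u 2 * u 2)) + u 2 * B x u + R x u)"
proof -
  obtain R' where R': "tder I 1 rest2 R'" using dpoly_rest2 by (auto simp: dpoly_def)
  obtain P Q where PQ: "dpoly I 1 P" "dpoly I 1 Q" "\<And>x u. R' x u = u (Suc 1) * P x u + Q x u"
    using tder_affine_top[OF R'] by blast
  let ?G = "\<lambda>x u. u 2 * top_coeff 2 x u + rest2 x u"
  let ?H = "\<lambda>x u. u (Suc 2) * top_coeff 2 x u + u 2 * (top_coeff_der 2 x u - real (Suc 2) * (xi_y (x, u 0) * u 2)) + R' x u"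
  have t: "tder I 2 ?G ?H"
    by (intro tder.add tder.mult tder.var tder_top_coeff tder_mono[OF R']) auto
  show ?thesis
  proof (intro exI conjI ballI allI)
    show "dpoly I 1 (\<lambda>x u. top_coeff_der 2 x u + P x u)" by (intro dpoly_intros dpoly_top_coeff_der PQ) simp
    show "dpoly I 1 Q" by (rule PQ)
    fix x u assume x: "x \<in> I"
    have "prolong_coeff X (Suc 2) x u = ?H x u - u (Suc 2) * lift_tder \<xi> x u"
      by (rule prolong_coeff_Suc_tder[OF x prolong_coeff_2 t])
    then show "prolong_coeff X 3 x u = u 3 * top_coeff 3 x u - 3 * (xi_y (x, u 0) * (u 2 * u 2))
        + u 2 * (top_coeff_der 2 x u + P x u) + Q x u"
      unfolding PQ(3) top_coeff_def lift_tder_def[of \<xi>] by (simp add: algebra_simps numeral_3_eq_3 numeral_2_eq_2 del: prolong_coeff.simps)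
  qed
qed

text \<open>What matters about \<open>b\<close> is that it is not zero. It is \<open>10\<close> in order four, and in the step from \<open>k\<close> to \<open>k + 1\<close>
  differentiating \<open>u (k - 1)\<close> in \<open>u 2 * u (k - 1)\<close> reproduces \<open>b\<close>, while \<open>top_coeff k\<close> contributes \<open>k + 1\<close>. The
  remaining products that arise, such as \<open>u 3 * u (k - 1)\<close>, have order at most \<open>(k + 1) - 2\<close> because \<open>k \<ge> 4\<close>, so they go into the rest \<open>R\<close>.\<close>

lemma prolong_coeff_ge_4:
  assumes "4 \<le> k"
  shows "\<exists>b B R. b > 0 \<and> dpoly I 1 B \<and> dpoly I (k - 2) R \<and> (\<forall>x\<in>I. \<forall>u. prolong_coeff X k x u =
     u k * top_coeff k x u - b * (xi_y (x, u 0) * (u 2 * u (k - 1))) + u (k - 1) * B x u + R x u)"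
  using assms
proof (induction k rule: dec_induct)
  case base
  obtain B R where BR: "dpoly I 1 B" "dpoly I 1 R" "\<And>x u. x \<in> I \<Longrightarrow> prolong_coeff X 3 x u =
      u 3 * top_coeff 3 x u - 3 * (xi_y (x, u 0) * (u 2 * u 2)) + u 2 * B x u + R x u"
    using prolong_coeff_3 by blast
  obtain B' R' where B': "tder I 1 B B'" and R': "tder I 1 R R'" using BR by (auto simp: dpoly_def)
  let ?G = "\<lambda>x u. u 3 * top_coeff 3 x u + (- 3) * (xi_y (x, u 0) * (u 2 * u 2)) + u 2 * B x u + R x u"
  let ?H = "\<lambda>x u. u (Suc 3) * top_coeff 3 x u + u 3 * (top_coeff_der 3 x u - real (Suc 3) * (xi_y (x, u 0) * u 2))
      + (- 3) * (lift_tder (xi_y) x u * (u 2 * u 2) + xi_y (x, u 0) * (u (Suc 2) * u 2 + u 2 * u (Suc 2)))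
      + (u (Suc 2) * B x u + u 2 * B' x u) + R' x u"
  have t: "tder I 3 ?G ?H"
    by (intro tder.add tder_cmult tder.mult tder.var tder_top_coeff tder_lift smooth_partials tder_mono[OF R'] tder_mono[OF B']) auto
  show ?case
  proof (intro exI conjI ballI allI)
    show "(10::real) > 0" by simp
    show "dpoly I 1 (\<lambda>x u. top_coeff_der 3 x u + B x u)" by (intro dpoly_intros dpoly_top_coeff_der BR) simp
    have "dpoly I 2 (\<lambda>x u. (- 3) * (lift_tder (xi_y) x u * (u 2 * u 2)) + u 2 * B' x u + R' x u)"
      using dpoly_total_derivative[OF B'] dpoly_total_derivative[OF R']
      by (intro dpoly_intros dpoly_lift_tder smooth_partials) (auto simp: numeral_2_eq_2)
    then show "dpoly I (4 - 2) (\<lambda>x u. (- 3) * (lift_tder (xi_y) x u * (u 2 * u 2)) + u 2 * B' x u + R' x u)"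
      by simp
    fix x u assume x: "x \<in> I"
    have "prolong_coeff X (Suc 3) x u = ?H x u - u (Suc 3) * lift_tder \<xi> x u"
      by (rule prolong_coeff_Suc_tder[OF x _ t]) (use BR(3) in simp)
    moreover have "Suc 3 = 4" "Suc 2 = 3" "4 - 1 = (3::nat)" by simp_all
    ultimately show "prolong_coeff X 4 x u = u 4 * top_coeff 4 x u - 10 * (xi_y (x, u 0) * (u 2 * u (4 - 1)))
        + u (4 - 1) * (top_coeff_der 3 x u + B x u)
        + ((- 3) * (lift_tder (xi_y) x u * (u 2 * u 2)) + u 2 * B' x u + R' x u)"
      unfolding top_coeff_def lift_tder_def[of \<xi>] by (simp add: algebra_simps del: prolong_coeff.simps)
  qed
next
  case (step k)
  then obtain b B R where b: "b > 0" and BR: "dpoly I 1 B" "dpoly I (k - 2) R"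
    "\<And>x u. x \<in> I \<Longrightarrow> prolong_coeff X k x u =
      u k * top_coeff k x u - b * (xi_y (x, u 0) * (u 2 * u (k - 1))) + u (k - 1) * B x u + R x u"
    by blast
  obtain j where k: "k = Suc j" "3 \<le> j" using step(1) by (cases k) auto
  obtain B' R' where B': "tder I 1 B B'" and R': "tder I (k - 2) R R'" using BR by (auto simp: dpoly_def)
  let ?G = "\<lambda>x u. u k * top_coeff k x u + (- b) * (xi_y (x, u 0) * (u 2 * u j)) + u j * B x u + R x u"
  let ?H = "\<lambda>x u. u (Suc k) * top_coeff k x u + u k * (top_coeff_der k x u - real (Suc k) * (xi_y (x, u 0) * u 2))
      + (- b) * (lift_tder (xi_y) x u * (u 2 * u j) + xi_y (x, u 0) * (u (Suc 2) * u j + u 2 * u (Suc j)))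
      + (u (Suc j) * B x u + u j * B' x u) + R' x u"
  have t: "tder I k ?G ?H"
    using k by (intro tder.add tder_cmult tder.mult tder.var tder_top_coeff tder_lift smooth_partials tder_mono[OF R'] tder_mono[OF B']) auto
  \<comment> \<open>the terms of order at most \<open>k - 1\<close>; the one with \<open>u 3 * u j\<close> is of this order since \<open>j = k - 1 \<ge> 3\<close>\<close>
  let ?R = "\<lambda>x u. (- b) * (lift_tder (xi_y) x u * (u 2 * u j)) + (- b) * (xi_y (x, u 0) * (u 3 * u j))
      + u j * B' x u + R' x u"
  show ?case
  proof (intro exI conjI ballI allI)
    show "b + real (Suc k) > 0" using b by simp
    show "dpoly I 1 (\<lambda>x u. top_coeff_der k x u + B x u)" by (intro dpoly_intros dpoly_top_coeff_der BR) simp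
    have "dpoly I j B'" "dpoly I j R'"
      using dpoly_total_derivative[OF B'] dpoly_total_derivative[OF R'] k
      by (auto intro: dpoly_mono)
    then have "dpoly I j ?R"
      using k by (intro dpoly_intros dpoly_lift_tder smooth_partials) auto
    then show "dpoly I (Suc k - 2) ?R" using k by simp
    fix x u assume x: "x \<in> I"
    have "prolong_coeff X (Suc k) x u = ?H x u - u (Suc k) * lift_tder \<xi> x u"
      by (rule prolong_coeff_Suc_tder[OF x _ t]) (use BR(3) k in simp)
    then show "prolong_coeff X (Suc k) x u = u (Suc k) * top_coeff (Suc k) x u
        - (b + real (Suc k)) * (xi_y (x, u 0) * (u 2 * u (Suc k - 1)))
        + u (Suc k - 1) * (top_coeff_der k x u + B x u) + ?R x u"
      unfolding top_coeff_def lift_tder_def[of \<xi>] using k(1) by (simp add: algebra_simps numeral_3_eq_3 numeral_2_eq_2 del: prolong_coeff.simps)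
  qed
qed

end

section \<open>Symmetries are affine in the dependent variable\<close>

locale linear_ode_symmetry = smooth_vector_field +
  fixes n :: nat and c :: "nat \<Rightarrow> real \<Rightarrow> real"
  assumes n_ge_3: "3 \<le> n" and smooth_c: "\<And>j. j < n \<Longrightarrow> smooth_on I (c j)"
    and invariant: "\<And>x u. x \<in> I \<Longrightarrow> linear_ode n c x u = 0 \<Longrightarrow> prolongation n X (linear_ode n c) x u = 0"

lemma prolongation_linear_ode:
  assumes "open I" "x \<in> I" "\<And>j. j < n \<Longrightarrow> smooth_on I (c j)"
  shows "prolongation n X (linear_ode n c) x u =
    fst (X (x, u 0)) * (\<Sum>j<n. deriv (c j) x * u j) + (\<Sum>j<n. prolong_coeff X j x u * c j x) + prolong_coeff X n x u"
proof -
  have "DERIV (\<lambda>t. linear_ode n c t u) x :> 0 + (\<Sum>j<n. deriv (c j) x * u j)"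
    unfolding linear_ode_def
    by (intro DERIV_add DERIV_const DERIV_sum DERIV_cmult_right smooth_on_DERIV[OF assms(3) assms(2)]) auto
  then have 1: "deriv (\<lambda>t. linear_ode n c t u) x = (\<Sum>j<n. deriv (c j) x * u j)"
    by (simp add: DERIV_imp_deriv)
  have 2: "jet_partial k (linear_ode n c) x u = (if k = n then 1 else c k x)" if "k \<le> n" for k
  proof -
    have "linear_ode n c x (u(k := t)) =
        (if k = n then t + (\<Sum>j<n. c j x * u j) else u n + c k x * t + (\<Sum>j\<in>{..<n}-{k}. c j x * u j))" for t
    proof (cases "k = n")
      case True
      then show ?thesis by (simp add: linear_ode_def)
    next
      case False
      then have "(\<Sum>j<n. c j x * (u(k := t)) j) = c k x * t + (\<Sum>j\<in>{..<n}-{k}. c j x * u j)"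
        using that by (subst sum.remove[of _ k]) (auto intro!: sum.cong)
      then show ?thesis using False by (simp add: linear_ode_def)
    qed
    then have "DERIV (\<lambda>t. linear_ode n c x (u(k := t))) (u k) :> (if k = n then 1 else c k x)"
      by (auto intro!: derivative_eq_intros)
    then show ?thesis by (simp add: jet_partial_def DERIV_imp_deriv)
  qed
  have "(\<Sum>k\<le>n. prolong_coeff X k x u * jet_partial k (linear_ode n c) x u)
      = (\<Sum>k<n. prolong_coeff X k x u * c k x) + prolong_coeff X n x u"
    unfolding lessThan_Suc_atMost[symmetric] sum.lessThan_Suc using 2 by (auto intro!: sum.cong)
  then show ?thesis unfolding prolongation_def 1 by simp
qed

text \<open>On functions that are affine in \<open>s\<close> and in \<open>t\<close> this is the coefficient at \<open>s t\<close>; it annihilates functions of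
  \<open>s\<close> alone and functions of \<open>t\<close> alone.\<close>

definition mixed_diff :: "(real \<Rightarrow> real \<Rightarrow> real) \<Rightarrow> real" where
  "mixed_diff f = f 1 1 - f 1 0 - f 0 1 + f 0 0"

lemma mixed_diff_add: "mixed_diff (\<lambda>s t. f s t + g s t) = mixed_diff f + mixed_diff g"
  and mixed_diff_cmult: "mixed_diff (\<lambda>s t. r * f s t) = r * mixed_diff f"
  and mixed_diff_cmult_right: "mixed_diff (\<lambda>s t. f s t * r) = mixed_diff f * r"
  by (simp_all add: mixed_diff_def algebra_simps)

lemma mixed_diff_sum: "mixed_diff (\<lambda>s t. \<Sum>j\<in>K. f j s t) = (\<Sum>j\<in>K. mixed_diff (f j))"
  by (simp add: mixed_diff_def sum.distrib sum_subtractf)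

context linear_ode_symmetry
begin

lemma invariance:
  assumes "x \<in> I" "u n = - (\<Sum>j<n. c j x * u j)"
  shows "\<xi> (x, u 0) * (\<Sum>j<n. deriv (c j) x * u j) + (\<Sum>j<n. prolong_coeff X j x u * c j x) + prolong_coeff X n x u = 0"
  using invariant[OF assms(1), of u] prolongation_linear_ode[OF open_I assms(1) smooth_c, where X=X and u=u] assms(2)
  by (simp add: linear_ode_def \<xi>_def)

text \<open>A jet on the equation with only \<open>u 0\<close>, \<open>u p\<close> and \<open>u (n - 1)\<close> free; the last entry \<open>u n\<close> is the one that the
  equation dictates. It is affine in \<open>(s, t)\<close>, so substituting it creates no product \<open>s t\<close>.\<close>

definition test_jet :: "nat \<Rightarrow> real \<Rightarrow> real \<Rightarrow> real \<Rightarrow> real \<Rightarrow> nat \<Rightarrow> real" where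
  "test_jet p x y s t = (let v = (\<lambda>j. if j = 0 then y else if j = p then s else if j = n - 1 then t else 0)
     in v(n := - (\<Sum>j<n. c j x * v j)))"

lemma test_jet_simps:
  assumes "0 < p" "p < n - 1"
  shows "test_jet p x y s t 0 = y" "test_jet p x y s t p = s" "test_jet p x y s t (n - 1) = t"
    "j < n \<Longrightarrow> j \<noteq> 0 \<Longrightarrow> j \<noteq> p \<Longrightarrow> j \<noteq> n - 1 \<Longrightarrow> test_jet p x y s t j = 0"
    "test_jet p x y s t n = - (\<Sum>j<n. c j x * test_jet p x y s t j)"
  using assms by (auto simp: test_jet_def Let_def)

lemma mixed_diff_test_jet:
  assumes "0 < p" "p < n - 1" "j \<le> n"
  shows "mixed_diff (\<lambda>s t. test_jet p x y s t j) = 0"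
proof -
  have 1: "mixed_diff (\<lambda>s t. test_jet p x y s t j) = 0" if "j < n" for j
  proof -
    consider "j = 0" | "j = p" | "j = n - 1" | "j \<noteq> 0 \<and> j \<noteq> p \<and> j \<noteq> n - 1" by blast
    then show ?thesis
      by cases (use test_jet_simps[OF assms(1,2)] that in \<open>auto simp: mixed_diff_def\<close>)
  qed
  have "mixed_diff (\<lambda>s t. test_jet p x y s t n) = mixed_diff (\<lambda>s t. (-1) * (\<Sum>j<n. c j x * test_jet p x y s t j))"
    using test_jet_simps(5)[OF assms(1,2)] by simp
  also have "\<dots> = 0"
    unfolding mixed_diff_cmult mixed_diff_sum using 1 by simp
  finally show ?thesis using 1 assms(3) by (cases "j = n") auto
qed

text \<open>The criterion of invariance on test jets is a combination of prolongation coefficients. Those of order below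
  \<open>n - 1\<close> do not see \<open>t = u (n - 1)\<close>, so only the top two can contribute a product \<open>s t\<close>.\<close>

lemma mixed_diff_prolong_coeff_eq_0:
  assumes p: "0 < p" "p < n - 1" and x: "x \<in> I"
    and nm1: "mixed_diff (\<lambda>s t. prolong_coeff X (n - 1) x (test_jet p x y s t)) = 0"
  shows "mixed_diff (\<lambda>s t. prolong_coeff X n x (test_jet p x y s t)) = 0"
proof -
  let ?J = "test_jet p x y"
  have low: "mixed_diff (\<lambda>s t. prolong_coeff X j x (?J s t)) = 0" if "j < n - 1" for j
  proof -
    have "prolong_coeff X j x (?J s t) = prolong_coeff X j x (?J s 0)" for s t
      by (rule prolong_coeff_eq_on_jet[OF x])
        (use that p in \<open>auto simp: test_jet_def Let_def\<close>)
    from this[of 1 1] this[of 0 1] show ?thesis by (simp add: mixed_diff_def)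
  qed
  have all: "mixed_diff (\<lambda>s t. prolong_coeff X j x (?J s t)) = 0" if "j < n" for j
    using low[of j] nm1 that by (cases "j = n - 1") auto
  have "0 = mixed_diff (\<lambda>s t. \<xi> (x, y) * (\<Sum>j<n. deriv (c j) x * ?J s t j)
      + (\<Sum>j<n. prolong_coeff X j x (?J s t) * c j x) + prolong_coeff X n x (?J s t))"
    using invariance[OF x test_jet_simps(5)[OF p]] test_jet_simps(1)[OF p] by (simp add: mixed_diff_def)
  also have "\<dots> = \<xi> (x, y) * (\<Sum>j<n. deriv (c j) x * mixed_diff (\<lambda>s t. ?J s t j))
      + (\<Sum>j<n. mixed_diff (\<lambda>s t. prolong_coeff X j x (?J s t)) * c j x) + mixed_diff (\<lambda>s t. prolong_coeff X n x (?J s t))"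
    by (simp only: mixed_diff_add mixed_diff_cmult mixed_diff_cmult_right mixed_diff_sum)
  also have "\<dots> = mixed_diff (\<lambda>s t. prolong_coeff X n x (?J s t))"
    using all mixed_diff_test_jet[OF p] by simp
  finally show ?thesis by simp
qed

text \<open>With \<open>p = 2\<close> and \<open>u 1 = 0\<close> the coefficient at \<open>s t = u 2 * u (n - 1)\<close> in the criterion of invariance is
  \<open>- b \<xi>\<^sub>y\<close> with \<open>b > 0\<close>.\<close>

lemma partial_y_xi_eq_0_ge_4:
  assumes n: "4 \<le> n" and x: "x \<in> I"
  shows "xi_y (x, y) = 0"
proof -
  have p: "0 < (2::nat)" "2 < n - 1" using n by auto
  let ?J = "test_jet 2 x y"
  have J01: "?J s t 0 = y" "?J s t 1 = 0" "?J s t 2 = s" "?J s t (n - 1) = t" for s t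
    using test_jet_simps[OF p] n by auto
  have top_coeff: "top_coeff k x (?J s t) = top_coeff k x (?J 0 0)" for k s t by (simp add: top_coeff_def J01[simplified])
  have dp1: "B x (?J s t) = B x (?J 0 0)" if "dpoly I 1 B" for B s t
  proof (rule dpoly_eq_on_jet[OF that])
    show "?J s t j = ?J 0 0 j" if "j \<le> 1" for j using that J01 by (cases j) auto
  qed
  have dpn: "R x (?J s t) = R x (?J s 0)" if "dpoly I (n - 2) R" for R s t
    by (rule dpoly_eq_on_jet[OF that]) (use n in \<open>auto simp: test_jet_def Let_def\<close>)
  obtain R where R: "dpoly I (n - 2) R" "\<And>s t. prolong_coeff X (n - 1) x (?J s t) =
      ?J s t (n - 1) * top_coeff (n - 1) x (?J s t) + R x (?J s t)"
  proof (cases "n = 4")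
    case True
    obtain B R where BR: "dpoly I 1 B" "dpoly I 1 R" "\<And>u. prolong_coeff X 3 x u =
       u 3 * top_coeff 3 x u - 3 * (xi_y (x, u 0) * (u 2 * u 2)) + u 2 * B x u + R x u"
      using prolong_coeff_3 x by blast
    have "dpoly I (n - 2) (\<lambda>x u. (- 3) * (xi_y (x, u 0) * (u 2 * u 2)) + u 2 * B x u + R x u)"
      using True BR by (intro dpoly_intros smooth_partials) (auto intro: dpoly_mono)
    then show ?thesis by (rule that) (use True BR(3) in simp)
  next
    case False
    then have k: "4 \<le> n - 1" using n by simp
    obtain b B R where BR: "dpoly I 1 B" "dpoly I (n - 1 - 2) R" "\<And>u. prolong_coeff X (n - 1) x u =
       u (n - 1) * top_coeff (n - 1) x u - b * (xi_y (x, u 0) * (u 2 * u (n - 1 - 1))) + u (n - 1 - 1) * B x u + R x u"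
      using prolong_coeff_ge_4[OF k] x by blast
    have "dpoly I (n - 2) B" "dpoly I (n - 2) R" using BR n by (auto intro: dpoly_mono)
    then have "dpoly I (n - 2) (\<lambda>x u. (- b) * (xi_y (x, u 0) * (u 2 * u (n - 1 - 1))) + u (n - 1 - 1) * B x u + R x u)"
      using n by (intro dpoly_intros smooth_partials) auto
    then show ?thesis by (rule that) (simp only: BR(3) diff_conv_add_uminus minus_mult_left add.assoc)
  qed
  have nm1: "mixed_diff (\<lambda>s t. prolong_coeff X (n - 1) x (?J s t)) = 0"
    unfolding mixed_diff_def R(2) J01(4) dpn[OF R(1), of 1 1] dpn[OF R(1), of 0 1]
      top_coeff[of _ 1 1] top_coeff[of _ 1 0] top_coeff[of _ 0 1] by simp
  obtain b B R where b: "b > 0" and BR: "dpoly I 1 B" "dpoly I (n - 2) R" "\<And>u. prolong_coeff X n x u =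
       u n * top_coeff n x u - b * (xi_y (x, u 0) * (u 2 * u (n - 1))) + u (n - 1) * B x u + R x u"
    using prolong_coeff_ge_4[OF n] x by blast
  have "0 = mixed_diff (\<lambda>s t. prolong_coeff X n x (?J s t))"
    by (rule mixed_diff_prolong_coeff_eq_0[OF p x nm1, symmetric])
  also have "\<dots> = mixed_diff (\<lambda>s t. ?J s t n) * top_coeff n x (?J 0 0) - b * xi_y (x, y)"
    unfolding mixed_diff_def BR(3) J01 dpn[OF BR(2), of 1 1] dpn[OF BR(2), of 0 1]
      top_coeff[of _ 1 1] top_coeff[of _ 1 0] top_coeff[of _ 0 1] dp1[OF BR(1), of 1 1] dp1[OF BR(1), of 1 0] dp1[OF BR(1), of 0 1]
    by (simp add: algebra_simps)
  finally show ?thesis using b mixed_diff_test_jet[OF p, of n x y] by simp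
qed

text \<open>For \<open>n = 3\<close> the two variables coincide, and a second difference in \<open>t = u 2\<close> takes the place of the mixed one.\<close>

lemma partial_y_xi_eq_0_3:
  assumes n: "n = 3" and x: "x \<in> I"
  shows "xi_y (x, y) = 0"
proof -
  \<comment> \<open>the jets with \<open>u 0 = y\<close>, \<open>u 1 = 0\<close>, \<open>u 2 = t\<close> on the equation\<close>
  define u where "u t = (\<lambda>_::nat. 0)(0 := y, 2 := t, 3 := - (c 0 x * y + c 2 x * t))" for t :: real
  have u: "u t 0 = y" "u t 1 = 0" "u t 2 = t" "u t 3 = - (c 0 x * y + c 2 x * t)" for t by (auto simp: u_def)
  have top_coeff: "top_coeff k x (u t) = top_coeff k x (u 0)" for k t using u by (simp add: top_coeff_def)
  have dp1: "B x (u t) = B x (u 0)" if "dpoly I 1 B" for B t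
    by (rule dpoly_eq_on_jet[OF that]) (auto simp: u_def)
  have n3: "{..<n} = {0,1,2}" using n by auto
  obtain B R where BR: "dpoly I 1 B" "dpoly I 1 R" "\<And>u. prolong_coeff X 3 x u =
     u 3 * top_coeff 3 x u - 3 * (xi_y (x, u 0) * (u 2 * u 2)) + u 2 * B x u + R x u"
    using prolong_coeff_3 x by blast
  have low: "prolong_coeff X k x (u t) = prolong_coeff X k x (u 0)" if "k \<le> 1" for k t
    by (rule prolong_coeff_eq_on_jet[OF x]) (use that in \<open>auto simp: u_def\<close>)
  have inv: "\<xi> (x, y) * (deriv (c 0) x * y + deriv (c 2) x * t) +
      (prolong_coeff X 0 x (u 0) * c 0 x + prolong_coeff X 1 x (u 0) * c 1 x
       + (t * top_coeff 2 x (u 0) + rest2 x (u 0)) * c 2 x)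
      + ((- (c 0 x * y + c 2 x * t)) * top_coeff 3 x (u 0) - 3 * (xi_y (x, y) * (t * t)) + t * B x (u 0) + R x (u 0)) = 0" for t
  proof -
    have "(u t) n = - (\<Sum>j<n. c j x * u t j)"
      unfolding n3 using n by (simp add: u u[simplified])
    from invariance[OF x this] show ?thesis
      unfolding n3 using n u(1,3)[of t] u(2)[of t] low[of 0 t] low[of 1 t]
      by (simp add: prolong_coeff_2[OF x] BR(3) u top_coeff[of _ t] dp1[OF BR(1), of t] dp1[OF BR(2), of t] dp1[OF dpoly_rest2, of t] del: prolong_coeff.simps)
  qed
  \<comment> \<open>the part of \<open>inv\<close> that is quadratic in \<open>t\<close>\<close>
  show ?thesis using inv[of 1] inv[of "-1"] inv[of 0] by (simp add: algebra_simps)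
qed

lemma partial_y_xi_eq_0: "x \<in> I \<Longrightarrow> xi_y (x, y) = 0"
  using partial_y_xi_eq_0_3 partial_y_xi_eq_0_ge_4 n_ge_3 by (cases "n = 3") auto

lemma xi_eq: "x \<in> I \<Longrightarrow> \<xi> (x, y) = \<xi> (x, 0)"
  using DERIV_isconst_all[of "\<lambda>t. \<xi> (x, t)" y 0] smooth_on_strip_DERIV_y[OF smooth_\<xi>, of x]
  by (simp add: partial_y_xi_eq_0)

definition xi0 :: "real \<Rightarrow> real" where "xi0 x = \<xi> (x, 0)"

lemma smooth_xi0: "smooth_on I xi0"
  unfolding xi0_def[abs_def] by (rule smooth_on_slice[OF open_I smooth_\<xi>])

lemma partial_x_xi: "x \<in> I \<Longrightarrow> xi_x (x, y) = deriv xi0 x"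
  using deriv_cong_open[OF open_I, of x "\<lambda>t. \<xi> (t, y)" xi0] xi_eq[of _ y]
    smooth_on_strip_DERIV_x[OF smooth_\<xi>, of x y, THEN DERIV_imp_deriv]
  by (simp add: xi0_def)

lemma lift_tder_xi: "x \<in> I \<Longrightarrow> lift_tder \<xi> x u = deriv xi0 x"
  by (simp add: lift_tder_def partial_x_xi partial_y_xi_eq_0)

text \<open>The part of the second prolongation coefficient that is free of \<open>u 2\<close>, once \<open>\<xi>\<close> depends on \<open>x\<close> alone.\<close>

definition rest2_affine :: diff_fun where
  "rest2_affine x u = partial_x eta_x (x, u 0)
     + (u 1 * (partial_y eta_x (x, u 0) + partial_x eta_y (x, u 0) + (- 1) * deriv (deriv xi0) x)
     + u 1 * (u 1 * eta_yy (x, u 0)))"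

lemmas smooth_partials2 = smooth_on_partial_x[OF smooth_on_partial_x[OF smooth_\<eta>]]
  smooth_on_partial_y[OF smooth_on_partial_x[OF smooth_\<eta>]]
  smooth_on_partial_x[OF smooth_on_partial_y[OF smooth_\<eta>]]
  smooth_on_partial_y[OF smooth_on_partial_y[OF smooth_\<eta>]]

lemma smooth_deriv_xi0: "smooth_on I (deriv xi0)" "smooth_on I (deriv (deriv xi0))"
  by (intro smooth_on_deriv smooth_xi0)+

lemma dpoly_rest2_affine: "dpoly I 1 rest2_affine"
  unfolding rest2_affine_def[abs_def]
  by (intro dpoly_intros dpoly_fst[OF open_I] smooth_deriv_xi0 smooth_partials2) auto

lemma prolong_coeff_2':
  assumes x: "x \<in> I"
  shows "prolong_coeff X 2 x u = u 2 * (eta_y (x, u 0) + (- 2) * deriv xi0 x) + rest2_affine x u"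
proof -
  have t: "tder I 1 (\<lambda>x u. eta_x (x, u 0) + u 1 * (eta_y (x, u 0) + (- 1) * deriv xi0 x))
     (\<lambda>x u. lift_tder eta_x x u + (u (Suc 1) * (eta_y (x, u 0) + (- 1) * deriv xi0 x)
        + u 1 * (lift_tder eta_y x u + (- 1) * deriv (deriv xi0) x)))" (is "tder I 1 ?G ?H")
    by (intro tder.add tder_cmult tder.mult tder_lift tder_fst[OF open_I] smooth_partials smooth_deriv_xi0 tder.var) auto
  have "prolong_coeff X (Suc 1) x u = ?H x u - u (Suc 1) * lift_tder \<xi> x u"
    by (rule prolong_coeff_Suc_tder[OF x _ t])
      (subst prolong_coeff_1, assumption, simp add: lift_tder_xi, simp add: lift_tder_def algebra_simps)
  then show ?thesis
    unfolding Suc_1 lift_tder_xi[OF x] unfolding rest2_affine_def lift_tder_def by (simp add: algebra_simps)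
qed

text \<open>Once \<open>\<xi>\<^sub>y = 0\<close>, the next term below the leading one can be tracked exactly in its dependence on \<open>u 1\<close>: each
  differentiation contributes one more \<open>u 1 * \<eta>\<^sub>y\<^sub>y\<close>, from the factor \<open>\<eta>\<^sub>y\<close> of the leading term.\<close>

lemma prolong_coeff_ge_3:
  assumes "3 \<le> k"
  shows "\<exists>G R. smooth_on (I \<times> UNIV) G \<and> dpoly I (k - 2) R \<and> (\<forall>x\<in>I. \<forall>u. prolong_coeff X k x u =
     u k * (eta_y (x, u 0) + (- real k) * deriv xi0 x)
     + u (k - 1) * (real k * (u 1 * eta_yy (x, u 0)) + G (x, u 0)) + R x u)"
  using assms
proof (induction k rule: dec_induct)
  case base
  let ?E = "\<lambda>x u :: nat \<Rightarrow> real. partial_y eta_x (x, u 0) + partial_x eta_y (x, u 0) + (- 1) * deriv (deriv xi0) x"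
  let ?E' = "\<lambda>x u. lift_tder (partial_y eta_x) x u + lift_tder (partial_x eta_y) x u + (- 1) * deriv (deriv (deriv xi0)) x"
  have t: "tder I 2 (\<lambda>x u. u 2 * (eta_y (x, u 0) + (- 2) * deriv xi0 x) + rest2_affine x u)
     (\<lambda>x u. (u (Suc 2) * (eta_y (x, u 0) + (- 2) * deriv xi0 x)
        + u 2 * (lift_tder eta_y x u + (- 2) * deriv (deriv xi0) x))
        + (lift_tder (partial_x eta_x) x u + ((u (Suc 1) * ?E x u + u 1 * ?E' x u)
          + (u (Suc 1) * (u 1 * eta_yy (x, u 0)) + u 1 * (u (Suc 1) * eta_yy (x, u 0) + u 1 * lift_tder eta_yy x u)))))"
    (is "tder I 2 ?G ?H")
    unfolding rest2_affine_def[abs_def]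
    by (intro tder.add tder_cmult tder.mult tder_lift tder_fst[OF open_I] smooth_partials smooth_partials2 smooth_deriv_xi0 tder.var) auto
  show ?case
  proof (intro exI conjI ballI allI)
    show "smooth_on (I \<times> UNIV) (\<lambda>z. (partial_x eta_y z + (- 2) * deriv (deriv xi0) (fst z))
        + (partial_y eta_x z + partial_x eta_y z + (- 1) * deriv (deriv xi0) (fst z)))"
      by (intro smooth_on_add smooth_on_mult smooth_on_const smooth_partials2 smooth_on_strip_fst smooth_deriv_xi0 open_I open_Times open_UNIV)
    show "dpoly I (3 - 2) (\<lambda>x u. lift_tder (partial_x eta_x) x u + u 1 * ?E' x u + u 1 * (u 1 * lift_tder eta_yy x u))"
      by (intro dpoly_intros dpoly_fst[OF open_I] dpoly_lift_tder smooth_partials2 smooth_on_deriv smooth_xi0) auto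
    fix x u assume x: "x \<in> I"
    have "prolong_coeff X (Suc 2) x u = ?H x u - u (Suc 2) * lift_tder \<xi> x u"
      by (rule prolong_coeff_Suc_tder[OF x prolong_coeff_2' t])
    moreover have "Suc 2 = 3" "Suc 1 = 2" "3 - 1 = (2::nat)" by simp_all
    ultimately show "prolong_coeff X 3 x u = u 3 * (eta_y (x, u 0) + (- real 3) * deriv xi0 x)
        + u (3 - 1) * (real 3 * (u 1 * eta_yy (x, u 0)) + ((partial_x eta_y (x, u 0) + (- 2) * deriv (deriv xi0) (fst (x, u 0)))
        + (partial_y eta_x (x, u 0) + partial_x eta_y (x, u 0) + (- 1) * deriv (deriv xi0) (fst (x, u 0)))))
        + (lift_tder (partial_x eta_x) x u + u 1 * ?E' x u + u 1 * (u 1 * lift_tder eta_yy x u))"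
      unfolding lift_tder_xi[OF x] lift_tder_def[of eta_y]
      by (simp add: algebra_simps numeral_2_eq_2 numeral_3_eq_3 del: prolong_coeff.simps)
  qed
next
  case (step k)
  then obtain G R where G: "smooth_on (I \<times> UNIV) G" and R: "dpoly I (k - 2) R"
    and eq: "\<And>x u. x \<in> I \<Longrightarrow> prolong_coeff X k x u =
     u k * (eta_y (x, u 0) + (- real k) * deriv xi0 x)
     + u (k - 1) * (real k * (u 1 * eta_yy (x, u 0)) + G (x, u 0)) + R x u"
    by blast
  obtain j where k: "k = Suc j" "2 \<le> j" using step(1) by (cases k) auto
  obtain R' where R': "tder I (k - 2) R R'" using R by (auto simp: dpoly_def)
  have t: "tder I k (\<lambda>x u. u k * (eta_y (x, u 0) + (- real k) * deriv xi0 x)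
     + u j * (real k * (u 1 * eta_yy (x, u 0)) + G (x, u 0)) + R x u)
    (\<lambda>x u. (u (Suc k) * (eta_y (x, u 0) + (- real k) * deriv xi0 x)
        + u k * (lift_tder eta_y x u + (- real k) * deriv (deriv xi0) x))
     + (u (Suc j) * (real k * (u 1 * eta_yy (x, u 0)) + G (x, u 0))
        + u j * (real k * (u (Suc 1) * eta_yy (x, u 0) + u 1 * lift_tder eta_yy x u) + lift_tder G x u)) + R' x u)"
    (is "tder I k ?G ?H")
    using k by (intro tder.add tder_cmult tder.mult tder_lift tder_fst[OF open_I] smooth_partials smooth_partials2 G
        smooth_deriv_xi0 tder.var tder_mono[OF R']) auto
  let ?R = "\<lambda>x u. u j * (real k * (u 2 * eta_yy (x, u 0) + u 1 * lift_tder eta_yy x u) + lift_tder G x u) + R' x u"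
  show ?case
  proof (intro exI conjI ballI allI)
    show "smooth_on (I \<times> UNIV) (\<lambda>z. (partial_x eta_y z + (- real k) * deriv (deriv xi0) (fst z)) + G z)"
      by (intro smooth_on_add smooth_on_mult smooth_on_const smooth_partials2 smooth_on_strip_fst smooth_deriv_xi0 open_I open_Times open_UNIV G)
    have "dpoly I j R'" using dpoly_total_derivative[OF R'] k by (auto intro: dpoly_mono)
    then have "dpoly I j ?R"
      using k by (intro dpoly_intros dpoly_lift_tder smooth_partials2 G) auto
    then show "dpoly I (Suc k - 2) ?R" using k by simp
    fix x u assume x: "x \<in> I"
    have "prolong_coeff X (Suc k) x u = ?H x u - u (Suc k) * lift_tder \<xi> x u"
      by (rule prolong_coeff_Suc_tder[OF x _ t]) (use eq k in simp)
    then show "prolong_coeff X (Suc k) x u = u (Suc k) * (eta_y (x, u 0) + (- real (Suc k)) * deriv xi0 x)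
        + u (Suc k - 1) * (real (Suc k) * (u 1 * eta_yy (x, u 0))
          + ((partial_x eta_y (x, u 0) + (- real k) * deriv (deriv xi0) (fst (x, u 0))) + G (x, u 0))) + ?R x u"
      unfolding lift_tder_xi[OF x] lift_tder_def[of eta_y] using k(1)
      by (simp add: algebra_simps numeral_2_eq_2 del: prolong_coeff.simps)
  qed
qed

text \<open>With \<open>p = 1\<close> the coefficient at \<open>s t = u 1 * u (n - 1)\<close> in the criterion of invariance is \<open>n \<eta>\<^sub>y\<^sub>y\<close>.\<close>

lemma eta_yy_eq_0:
  assumes x: "x \<in> I"
  shows "eta_yy (x, y) = 0"
proof -
  have p: "0 < (1::nat)" "1 < n - 1" using n_ge_3 by auto
  let ?J = "test_jet 1 x y"
  have J01: "?J s t 0 = y" "?J s t 1 = s" "?J s t (n - 1) = t" for s t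
    using test_jet_simps[OF p] by auto
  have dpn: "R x (?J s t) = R x (?J s 0)" if "dpoly I (n - 2) R" for R s t
    by (rule dpoly_eq_on_jet[OF that]) (use n_ge_3 in \<open>auto simp: test_jet_def Let_def\<close>)
  obtain R where R: "dpoly I (n - 2) R" "\<And>u. prolong_coeff X (n - 1) x u =
      u (n - 1) * (eta_y (x, u 0) + (- real (n - 1)) * deriv xi0 x) + R x u"
  proof (cases "n = 3")
    case True
    show ?thesis
    proof (rule that)
      show "dpoly I (n - 2) rest2_affine" using dpoly_rest2_affine True by simp
    qed (use True prolong_coeff_2'[OF x] in simp)
  next
    case False
    then have k: "3 \<le> n - 1" using n_ge_3 by simp
    obtain G R where G: "smooth_on (I \<times> UNIV) G" and R: "dpoly I (n - 1 - 2) R"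
      and eq: "\<And>u. prolong_coeff X (n - 1) x u = u (n - 1) * (eta_y (x, u 0) + (- real (n - 1)) * deriv xi0 x)
       + u (n - 1 - 1) * (real (n - 1) * (u 1 * eta_yy (x, u 0)) + G (x, u 0)) + R x u"
      using prolong_coeff_ge_3[OF k] x by blast
    have "dpoly I (n - 2) R" using R by (rule dpoly_mono) simp
    then have "dpoly I (n - 2) (\<lambda>x u. u (n - 1 - 1) * (real (n - 1) * (u 1 * eta_yy (x, u 0)) + G (x, u 0)) + R x u)"
      using n_ge_3 by (intro dpoly_intros smooth_partials2 G) auto
    then show ?thesis by (rule that) (simp only: eq add.assoc)
  qed
  have nm1: "mixed_diff (\<lambda>s t. prolong_coeff X (n - 1) x (?J s t)) = 0"
    unfolding mixed_diff_def R(2) J01 dpn[OF R(1), of 1 1] dpn[OF R(1), of 0 1] by simp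
  obtain G R where G: "smooth_on (I \<times> UNIV) G" and R: "dpoly I (n - 2) R"
    and eq: "\<And>u. prolong_coeff X n x u = u n * (eta_y (x, u 0) + (- real n) * deriv xi0 x)
       + u (n - 1) * (real n * (u 1 * eta_yy (x, u 0)) + G (x, u 0)) + R x u"
    using prolong_coeff_ge_3[OF n_ge_3] x by blast
  have "0 = mixed_diff (\<lambda>s t. prolong_coeff X n x (?J s t))"
    by (rule mixed_diff_prolong_coeff_eq_0[OF p x nm1, symmetric])
  also have "\<dots> = mixed_diff (\<lambda>s t. ?J s t n) * (eta_y (x, y) + (- real n) * deriv xi0 x) + real n * eta_yy (x, y)"
    unfolding mixed_diff_def eq J01 dpn[OF R, of 1 1] dpn[OF R, of 0 1] by (simp add: algebra_simps)
  finally show ?thesis using n_ge_3 mixed_diff_test_jet[OF p, of n x y] by simp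
qed

lemma eta_eq:
  assumes x: "x \<in> I"
  shows "\<eta> (x, y) = (\<eta> (x, 1) - \<eta> (x, 0)) * y + \<eta> (x, 0)"
proof -
  have const: "eta_y (x, y) = eta_y (x, 0)" for y
    using DERIV_isconst_all[of "\<lambda>t. eta_y (x, t)" y 0] smooth_on_strip_DERIV_y[OF smooth_partials(4) x]
    by (simp add: eta_yy_eq_0[OF x])
  have "DERIV (\<lambda>t. \<eta> (x, t) - eta_y (x, 0) * t) y :> 0" for y
    using smooth_on_strip_DERIV_y[OF smooth_\<eta> x, of y] const[of y] by (auto intro!: derivative_eq_intros)
  then have "\<eta> (x, y) - eta_y (x, 0) * y = \<eta> (x, 0)" for y
    using DERIV_isconst_all[of "\<lambda>t. \<eta> (x, t) - eta_y (x, 0) * t" y 0] by simp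
  from this[of y] this[of 1] show ?thesis by (simp add: algebra_simps)
qed

end

section \<open>Prolongation of vector fields that are affine in the dependent variable\<close>

text \<open>For the field \<open>\<xi> \<partial>\<^sub>x + (\<phi> y + \<beta>) \<partial>\<^sub>y\<close> the \<open>k\<close>-th prolongation coefficient is affine in the jet;
  \<open>prolong_entry \<xi> \<phi> k j\<close> is the factor of \<open>u j\<close> in it.\<close>

primrec prolong_entry :: "(real \<Rightarrow> real) \<Rightarrow> (real \<Rightarrow> real) \<Rightarrow> nat \<Rightarrow> nat \<Rightarrow> real \<Rightarrow> real" where
  "prolong_entry \<xi> \<phi> 0 j = (\<lambda>x. if j = 0 then \<phi> x else 0)"
| "prolong_entry \<xi> \<phi> (Suc k) j = (\<lambda>x. deriv (prolong_entry \<xi> \<phi> k j) x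
     + (if j = 0 then 0 else prolong_entry \<xi> \<phi> k (j - 1) x) - (if j = Suc k then deriv \<xi> x else 0))"

lemma prolong_entry_above: "k < j \<Longrightarrow> prolong_entry \<xi> \<phi> k j x = 0"
proof (induction k arbitrary: j x)
  case (Suc k)
  have "prolong_entry \<xi> \<phi> k j = (\<lambda>_. 0)" using Suc by auto
  then show ?case using Suc by auto
qed simp

locale affine_field =
  fixes I :: "real set" and X :: vector_field and \<xi> \<phi> \<beta> :: "real \<Rightarrow> real"
  assumes open_I: "open I"
    and smooth: "smooth_on I \<xi>" "smooth_on I \<phi>" "smooth_on I \<beta>"
    and X_eq: "\<And>x y. x \<in> I \<Longrightarrow> X (x, y) = (\<xi> x, \<phi> x * y + \<beta> x)"
begin

abbreviation "g \<equiv> prolong_entry \<xi> \<phi>"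

lemma smooth_g: "smooth_on I (g k j)"
proof (induction k arbitrary: j)
  case 0
  then show ?case using smooth(2) by (cases "j = 0") simp_all
next
  case (Suc k)
  show ?case unfolding prolong_entry.simps
    by (intro smooth_on_diff smooth_on_add smooth_on_if smooth_on_const open_I smooth_on_deriv Suc.IH smooth)
qed

text \<open>The closed form of the prolongation coefficients and, below it, its total derivative.\<close>

definition affine_prolong :: "nat \<Rightarrow> diff_fun" where
  "affine_prolong k x u = (\<Sum>j<Suc k. g k j x * u j) + (deriv ^^ k) \<beta> x"

definition affine_prolong' :: "nat \<Rightarrow> diff_fun" where
  "affine_prolong' k x u = (\<Sum>j<Suc k. deriv (g k j) x * u j + g k j x * u (Suc j)) + (deriv ^^ Suc k) \<beta> x"

lemma tder_sum:
  fixes N :: nat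
  shows "(\<And>j. j < N \<Longrightarrow> tder I m (F j) (F' j)) \<Longrightarrow> tder I m (\<lambda>x u. \<Sum>j<N. F j x u) (\<lambda>x u. \<Sum>j<N. F' j x u)"
  by (induction N) (auto intro: tder_const tder.add)

lemma tder_affine_prolong: "tder I k (affine_prolong k) (affine_prolong' k)"
proof -
  have "tder I k (\<lambda>x u. (\<Sum>j<Suc k. g k j x * u j) + (deriv ^^ k) \<beta> x)
    (\<lambda>x u. (\<Sum>j<Suc k. deriv (g k j) x * u j + g k j x * u (Suc j)) + deriv ((deriv ^^ k) \<beta>) x)"
    by (intro tder.add tder_sum tder.mult tder_fst[OF open_I] smooth_g smooth_on_higher_deriv smooth tder.var) simp
  then show ?thesis by (simp add: affine_prolong_def[abs_def] affine_prolong'_def[abs_def])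
qed

lemma affine_prolong_Suc: "affine_prolong (Suc k) x u = affine_prolong' k x u - u (Suc k) * deriv \<xi> x"
proof -
  have z: "g k (Suc k) = (\<lambda>_. 0)" using prolong_entry_above by auto
  have "(\<Sum>j<Suc (Suc k). g (Suc k) j x * u j) =
    (\<Sum>j<Suc (Suc k). deriv (g k j) x * u j) + (\<Sum>j<Suc (Suc k). (if j = 0 then 0 else g k (j - 1) x) * u j)
     - (\<Sum>j<Suc (Suc k). (if j = Suc k then deriv \<xi> x else 0) * u j)"
    by (simp only: prolong_entry.simps left_diff_distrib distrib_right sum.distrib sum_subtractf)
  also have "(\<Sum>j<Suc (Suc k). deriv (g k j) x * u j) = (\<Sum>j<Suc k. deriv (g k j) x * u j)"
    using z by (subst sum.lessThan_Suc) simp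
  also have "(\<Sum>j<Suc (Suc k). (if j = 0 then 0 else g k (j - 1) x) * u j) = (\<Sum>j<Suc k. g k j x * u (Suc j))"
    by (subst sum.lessThan_Suc_shift) simp
  also have "(\<Sum>j<Suc (Suc k). (if j = Suc k then deriv \<xi> x else 0) * u j) = deriv \<xi> x * u (Suc k)"
    by (subst sum.lessThan_Suc) (simp add: sum.neutral)
  finally show ?thesis by (simp add: affine_prolong_def affine_prolong'_def sum.distrib del: sum.lessThan_Suc)
qed

sublocale smooth_vector_field I X "\<lambda>z. fst (X z)" "\<lambda>z. snd (X z)"
proof
  have op: "open (I \<times> (UNIV :: real set))" using open_I by (simp add: open_Times)
  show "smooth_on (I \<times> UNIV) (\<lambda>z. fst (X z))"
    by (rule smooth_on_cong_open[OF op smooth_on_strip_fst[OF open_I smooth(1)]]) (auto simp: X_eq)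
  have "smooth_on (I \<times> UNIV) (\<lambda>z. \<phi> (fst z) * snd z + \<beta> (fst z))"
    by (intro smooth_on_add[OF op] smooth_on_mult[OF op] smooth_on_strip_fst[OF open_I] smooth smooth_on_strip_snd)
  then show "smooth_on (I \<times> UNIV) (\<lambda>z. snd (X z))"
    by (rule smooth_on_cong_open[OF op]) (auto simp: X_eq)
qed (use open_I in auto)

lemma lift_tder_fst_X: "x \<in> I \<Longrightarrow> lift_tder (\<lambda>z. fst (X z)) x u = deriv \<xi> x"
proof -
  assume x: "x \<in> I"
  have op: "open (I \<times> (UNIV :: real set))" using open_I by (simp add: open_Times)
  have "partial b (\<lambda>z. fst (X z)) (x, u 0) = partial b (\<lambda>z. \<xi> (fst z)) (x, u 0)" for b
    by (rule partial_cong_open[OF op]) (use x X_eq in auto)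
  then have "lift_tder (\<lambda>z. fst (X z)) x u = lift_tder (\<lambda>z. \<xi> (fst z)) x u"
    by (simp add: lift_tder_def)
  then show ?thesis by (simp add: lift_tder_fst)
qed

lemma prolong_coeff_eq: "x \<in> I \<Longrightarrow> prolong_coeff X k x u = affine_prolong k x u"
proof (induction k arbitrary: x u)
  case 0
  then show ?case by (simp add: X_eq affine_prolong_def)
next
  case (Suc k)
  show ?case
    using prolong_coeff_Suc_tder[OF Suc.prems Suc.IH tder_affine_prolong, of u] lift_tder_fst_X[OF Suc.prems, of u]
    by (simp add: affine_prolong_Suc del: prolong_coeff.simps)
qed

text \<open>Along the jet of a function \<open>y\<close> the prolongation is governed by the characteristic \<open>Q = \<phi> y + \<beta> - \<xi> y'\<close>: the
  \<open>k\<close>-th coefficient is \<open>Q\<^sup>(\<^sup>k\<^sup>) + \<xi> y\<^sup>(\<^sup>k\<^sup>+\<^sup>1\<^sup>)\<close>. Both sides obey the same recursion.\<close>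

lemma affine_prolong_along_jet:
  assumes y: "smooth_on I y" and "x \<in> I"
  shows "affine_prolong k x (\<lambda>j. (deriv ^^ j) y x) =
    (deriv ^^ k) (\<lambda>x. \<phi> x * y x + \<beta> x - \<xi> x * deriv y x) x + \<xi> x * (deriv ^^ Suc k) y x"
  using assms(2)
proof (induction k arbitrary: x)
  case 0
  then show ?case by (simp add: affine_prolong_def)
next
  case (Suc k)
  let ?Q = "\<lambda>x. \<phi> x * y x + \<beta> x - \<xi> x * deriv y x"
  have Q: "smooth_on I ?Q"
    by (intro smooth_on_diff smooth_on_add smooth_on_mult smooth_on_deriv open_I smooth y)
  have 1: "DERIV (\<lambda>x. affine_prolong k x (\<lambda>j. (deriv ^^ j) y x)) x :> affine_prolong' k x (\<lambda>j. (deriv ^^ j) y x)"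
  proof -
    have "DERIV (\<lambda>x. g k j x * (deriv ^^ j) y x) x :>
        deriv (g k j) x * (deriv ^^ j) y x + g k j x * (deriv ^^ Suc j) y x" for j
      using DERIV_mult[OF smooth_on_DERIV[OF smooth_g Suc.prems] smooth_on_DERIV_higher[OF y Suc.prems, of j], of k j]
      by (simp add: mult.commute)
    then show ?thesis unfolding affine_prolong_def affine_prolong'_def
      by (intro DERIV_add DERIV_sum smooth_on_DERIV_higher[OF smooth(3) Suc.prems])
  qed
  have 2: "DERIV (\<lambda>x. (deriv ^^ k) ?Q x + \<xi> x * (deriv ^^ Suc k) y x) x :>
      (deriv ^^ Suc k) ?Q x + (deriv \<xi> x * (deriv ^^ Suc k) y x + (deriv ^^ Suc (Suc k)) y x * \<xi> x)"
    by (intro DERIV_add DERIV_mult smooth_on_DERIV_higher[OF Q Suc.prems] smooth_on_DERIV[OF smooth(1) Suc.prems]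
        smooth_on_DERIV_higher[OF y Suc.prems])
  have "affine_prolong' k x (\<lambda>j. (deriv ^^ j) y x) =
      (deriv ^^ Suc k) ?Q x + (deriv \<xi> x * (deriv ^^ Suc k) y x + (deriv ^^ Suc (Suc k)) y x * \<xi> x)"
    by (rule DERIV_unique[OF DERIV_cong_open[OF open_I Suc.prems _ 1] 2]) (rule Suc.IH)
  then show ?case unfolding affine_prolong_Suc by (simp add: mult.commute)
qed

lemma smooth_X: "smooth_on (I \<times> UNIV) (\<lambda>z. fst (X z))" "smooth_on (I \<times> UNIV) (\<lambda>z. snd (X z))"
  using smooth_\<xi> smooth_\<eta> by auto

text \<open>The criterion is affine in the jet, so it suffices to test it on the zero jet, which gives the equation for
  \<open>\<beta>\<close>, and on the jets on the equation with a single nonzero entry of index below \<open>n\<close>, namely \<open>u j = 1\<close>.\<close>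

lemma determining_equations:
  assumes n: "0 < n" and c: "\<And>j. j < n \<Longrightarrow> smooth_on I (c j)" and x: "x \<in> I"
    and inv: "\<And>u. linear_ode n c x u = 0 \<Longrightarrow> prolongation n X (linear_ode n c) x u = 0"
  shows "linear_ode n c x (\<lambda>j. (deriv ^^ j) \<beta> x) = 0"
    and "j < n \<Longrightarrow> \<xi> x * deriv (c j) x + (\<Sum>k<n. c k x * g k j x) + g n j x - c j x * g n n x = 0"
proof -
  have *: "\<xi> x * (\<Sum>j<n. deriv (c j) x * u j) + (\<Sum>k<n. affine_prolong k x u * c k x) + affine_prolong n x u = 0"
    if "u n = - (\<Sum>j<n. c j x * u j)" for u
    using inv[of u] prolongation_linear_ode[OF open_I x c, where X=X and u=u] that
    by (simp add: linear_ode_def X_eq[OF x] prolong_coeff_eq[OF x])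
  have p0: "affine_prolong k x (\<lambda>_. 0) = (deriv ^^ k) \<beta> x" for k by (simp add: affine_prolong_def)
  show L: "linear_ode n c x (\<lambda>j. (deriv ^^ j) \<beta> x) = 0"
    using *[of "\<lambda>_. 0"] by (simp add: p0 linear_ode_def mult.commute)
  assume j: "j < n"
  define u where "u = (\<lambda>i. if i = j then 1 else if i = n then - c j x else 0)"
  have sum_u: "(\<Sum>i<n. f i * u i) = f j" for f :: "nat \<Rightarrow> real"
  proof -
    have "(\<Sum>i<n. f i * u i) = (\<Sum>i<n. if i = j then f j else 0)"
      by (rule sum.cong) (auto simp: u_def)
    then show ?thesis using j by simp
  qed
  have un: "u n = - (\<Sum>i<n. c i x * u i)"
    using j unfolding sum_u by (simp add: u_def)
  have pk: "affine_prolong k x u = g k j x + (deriv ^^ k) \<beta> x" if "k < n" for k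
  proof -
    have "(\<Sum>i<Suc k. g k i x * u i) = (\<Sum>i<Suc k. if i = j then g k j x else 0)"
      by (rule sum.cong) (use that in \<open>auto simp: u_def\<close>)
    also have "\<dots> = g k j x" using prolong_entry_above[of k j \<xi> \<phi> x] by (simp del: sum.lessThan_Suc)
    finally show ?thesis by (simp add: affine_prolong_def del: sum.lessThan_Suc)
  qed
  have pn: "affine_prolong n x u = g n j x - c j x * g n n x + (deriv ^^ n) \<beta> x"
    using sum_u[of "\<lambda>i. g n i x"] j by (simp add: affine_prolong_def u_def)
  have s: "(\<Sum>i<n. deriv (c i) x * u i) = deriv (c j) x"
    by (rule sum_u)
  have pk': "(\<Sum>k<n. affine_prolong k x u * c k x) = (\<Sum>k<n. c k x * g k j x) + (\<Sum>k<n. c k x * (deriv ^^ k) \<beta> x)"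
    unfolding sum.distrib[symmetric] by (rule sum.cong) (auto simp: pk algebra_simps)
  show "\<xi> x * deriv (c j) x + (\<Sum>k<n. c k x * g k j x) + g n j x - c j x * g n n x = 0"
    using *[OF un] L unfolding s pk' pn linear_ode_def by simp
qed

lemma g_diag: "x \<in> I \<Longrightarrow> g k k x = \<phi> x - real k * deriv \<xi> x"
proof (induction k arbitrary: x)
  case (Suc k)
  have "g k (Suc k) = (\<lambda>_. 0)" using prolong_entry_above by auto
  then show ?case using Suc by (simp add: algebra_simps)
qed simp

lemma g_subdiag: "x \<in> I \<Longrightarrow> g (Suc k) k x = real (Suc k) * deriv \<phi> x - real (Suc k) * real k / 2 * deriv (deriv \<xi>) x"
proof (induction k arbitrary: x)
  case (Suc k)
  have "deriv (g (Suc k) (Suc k)) x = deriv (\<lambda>x. \<phi> x - real (Suc k) * deriv \<xi> x) x"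
    by (rule deriv_cong_open[OF open_I Suc.prems g_diag])
  also have "\<dots> = deriv \<phi> x - real (Suc k) * deriv (deriv \<xi>) x"
    by (intro DERIV_imp_deriv DERIV_diff DERIV_cmult smooth_on_DERIV[OF _ Suc.prems] smooth_on_deriv smooth)
  finally have "g (Suc (Suc k)) (Suc k) x = deriv \<phi> x - real (Suc k) * deriv (deriv \<xi>) x + g (Suc k) k x"
    unfolding prolong_entry.simps(2)[of _ _ "Suc k"] by simp
  then show ?case unfolding Suc.IH[OF Suc.prems] by (simp add: field_simps)
qed simp

lemma g_subsubdiag:
  "x \<in> I \<Longrightarrow> g (Suc (Suc k)) k x = real (Suc (Suc k)) * real (Suc k) / 2 * deriv (deriv \<phi>) x
     - real (Suc (Suc k)) * real (Suc k) * real k / 6 * deriv (deriv (deriv \<xi>)) x"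
proof (induction k arbitrary: x)
  case 0
  have "deriv (g (Suc 0) 0) x = deriv (deriv \<phi>) x"
    by (rule deriv_cong_open[OF open_I 0]) simp
  then show ?case unfolding prolong_entry.simps(2)[of _ _ "Suc 0"] by simp
next
  case (Suc k)
  have "deriv (g (Suc (Suc k)) (Suc k)) x =
      deriv (\<lambda>x. real (Suc (Suc k)) * deriv \<phi> x - real (Suc (Suc k)) * real (Suc k) / 2 * deriv (deriv \<xi>) x) x"
    by (rule deriv_cong_open[OF open_I Suc.prems g_subdiag])
  also have "\<dots> = real (Suc (Suc k)) * deriv (deriv \<phi>) x - real (Suc (Suc k)) * real (Suc k) / 2 * deriv (deriv (deriv \<xi>)) x"
    by (intro DERIV_imp_deriv DERIV_diff DERIV_cmult smooth_on_DERIV[OF _ Suc.prems] smooth_on_deriv smooth)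
  finally have "g (Suc (Suc (Suc k))) (Suc k) x = real (Suc (Suc k)) * deriv (deriv \<phi>) x
      - real (Suc (Suc k)) * real (Suc k) / 2 * deriv (deriv (deriv \<xi>)) x + g (Suc (Suc k)) k x"
    unfolding prolong_entry.simps(2)[of _ _ "Suc (Suc k)"] by simp
  then show ?case unfolding Suc.IH[OF Suc.prems] by (simp add: field_simps)
qed

end

text \<open>Stated for a combination \<open>r X + Y\<close>, which covers sums and multiples at once.\<close>

lemma prolong_entry_linear:
  assumes "affine_field I X \<xi> \<phi> \<beta>" "affine_field I Y \<xi>2 \<phi>2 \<beta>2" "x \<in> I"
  shows "prolong_entry (\<lambda>x. r * \<xi> x + \<xi>2 x) (\<lambda>x. r * \<phi> x + \<phi>2 x) k j x = r * prolong_entry \<xi> \<phi> k j x + prolong_entry \<xi>2 \<phi>2 k j x"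
  using assms(3)
proof (induction k arbitrary: j x)
  case 0
  then show ?case by simp
next
  case (Suc k)
  interpret X: affine_field I X \<xi> \<phi> \<beta> by fact
  interpret Y: affine_field I Y \<xi>2 \<phi>2 \<beta>2 by fact
  have "deriv (prolong_entry (\<lambda>x. r * \<xi> x + \<xi>2 x) (\<lambda>x. r * \<phi> x + \<phi>2 x) k j) x
      = deriv (\<lambda>x. r * prolong_entry \<xi> \<phi> k j x + prolong_entry \<xi>2 \<phi>2 k j x) x"
    by (rule deriv_cong_open[OF X.open_I Suc.prems Suc.IH])
  also have "\<dots> = r * deriv (prolong_entry \<xi> \<phi> k j) x + deriv (prolong_entry \<xi>2 \<phi>2 k j) x"
    by (intro DERIV_imp_deriv DERIV_add DERIV_cmult smooth_on_DERIV[OF _ Suc.prems] X.smooth_g Y.smooth_g)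
  finally have 1: "deriv (prolong_entry (\<lambda>x. r * \<xi> x + \<xi>2 x) (\<lambda>x. r * \<phi> x + \<phi>2 x) k j) x
    = r * deriv (prolong_entry \<xi> \<phi> k j) x + deriv (prolong_entry \<xi>2 \<phi>2 k j) x" .
  have 2: "deriv (\<lambda>x. r * \<xi> x + \<xi>2 x) x = r * deriv \<xi> x + deriv \<xi>2 x"
    by (intro DERIV_imp_deriv DERIV_add DERIV_cmult smooth_on_DERIV[OF _ Suc.prems] X.smooth Y.smooth)
  show ?case unfolding prolong_entry.simps 1 2 using Suc.IH[OF Suc.prems, of "j - 1"] by (simp add: algebra_simps)
qed

lemma affine_field_lincomb:
  assumes "affine_field I X \<xi> \<phi> \<beta>" "affine_field I Y \<xi>2 \<phi>2 \<beta>2"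
  shows "affine_field I (\<lambda>z. r *\<^sub>R X z + Y z) (\<lambda>x. r * \<xi> x + \<xi>2 x) (\<lambda>x. r * \<phi> x + \<phi>2 x) (\<lambda>x. r * \<beta> x + \<beta>2 x)"
proof -
  interpret X: affine_field I X \<xi> \<phi> \<beta> by fact
  interpret Y: affine_field I Y \<xi>2 \<phi>2 \<beta>2 by fact
  show ?thesis
    by unfold_locales
      (auto intro!: smooth_on_add smooth_on_mult X.open_I X.smooth Y.smooth simp: X.X_eq Y.X_eq algebra_simps)
qed

lemma prolongation_lincomb:
  assumes X: "affine_field I X \<xi> \<phi> \<beta>" and Y: "affine_field I Y \<xi>2 \<phi>2 \<beta>2" and x: "x \<in> I"
    and c: "\<And>j. j < n \<Longrightarrow> smooth_on I (c j)"
  shows "prolongation n (\<lambda>z. r *\<^sub>R X z + Y z) (linear_ode n c) x u =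
    r * prolongation n X (linear_ode n c) x u + prolongation n Y (linear_ode n c) x u"
proof -
  interpret X: affine_field I X \<xi> \<phi> \<beta> by fact
  interpret Y: affine_field I Y \<xi>2 \<phi>2 \<beta>2 by fact
  interpret Z: affine_field I "\<lambda>z. r *\<^sub>R X z + Y z" "\<lambda>x. r * \<xi> x + \<xi>2 x" "\<lambda>x. r * \<phi> x + \<phi>2 x" "\<lambda>x. r * \<beta> x + \<beta>2 x"
    by (rule affine_field_lincomb[OF X Y])
  have b: "(deriv ^^ k) (\<lambda>x. r * \<beta> x + \<beta>2 x) x = r * (deriv ^^ k) \<beta> x + (deriv ^^ k) \<beta>2 x" for k
    using higher_deriv_add[OF X.open_I smooth_on_mult[OF X.open_I smooth_on_const X.smooth(3)] Y.smooth(3) x]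
      higher_deriv_cmult[OF X.open_I X.smooth(3) x] by simp
  have "Z.affine_prolong k x u = r * X.affine_prolong k x u + Y.affine_prolong k x u" for k
    unfolding X.affine_prolong_def Y.affine_prolong_def Z.affine_prolong_def prolong_entry_linear[OF X Y x] b
    by (simp add: sum_distrib_left sum.distrib algebra_simps del: sum.lessThan_Suc)
  then have "prolong_coeff (\<lambda>z. r *\<^sub>R X z + Y z) k x u = r * prolong_coeff X k x u + prolong_coeff Y k x u" for k
    by (simp add: X.prolong_coeff_eq[OF x] Y.prolong_coeff_eq[OF x] Z.prolong_coeff_eq[OF x])
  then show ?thesis
    by (simp add: prolongation_linear_ode[OF X.open_I x c] sum.distrib sum_distrib_left algebra_simps)
qed

section \<open>Symmetries are determined by Cauchy data\<close>

text \<open>The components of a field that is affine in \<open>y\<close>, read off at \<open>y = 0\<close> and \<open>y = 1\<close>. They are defined for every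
  vector field, which makes them linear functions of it without side conditions.\<close>

definition xi_of :: "vector_field \<Rightarrow> real \<Rightarrow> real" where "xi_of X x = fst (X (x, 0))"
definition phi_of :: "vector_field \<Rightarrow> real \<Rightarrow> real" where "phi_of X x = snd (X (x, 1)) - snd (X (x, 0))"
definition beta_of :: "vector_field \<Rightarrow> real \<Rightarrow> real" where "beta_of X x = snd (X (x, 0))"

lemma symmetry_linear:
  assumes I: "open I" and n: "3 \<le> n" and c: "\<And>j. j < n \<Longrightarrow> smooth_on I (c j)" and X: "X \<in> symmetry_algebra n I c"
  shows "affine_field I X (xi_of X) (phi_of X) (beta_of X)"
proof -
  interpret linear_ode_symmetry I X "\<lambda>z. fst (X z)" "\<lambda>z. snd (X z)" n c
    using assms by unfold_locales (auto simp: symmetry_algebra_def)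
  show ?thesis
  proof
    have "smooth_on I (\<lambda>x. fst (X (x, y)))" "smooth_on I (\<lambda>x. snd (X (x, y)))" for y
      by (rule smooth_on_slice[OF open_I smooth_\<xi>], rule smooth_on_slice[OF open_I smooth_\<eta>])
    then show "smooth_on I (xi_of X)" "smooth_on I (phi_of X)" "smooth_on I (beta_of X)"
      unfolding xi_of_def[abs_def] phi_of_def[abs_def] beta_of_def[abs_def]
      by (auto intro: smooth_on_diff open_I)
    show "X (x, y) = (xi_of X x, phi_of X x * y + beta_of X x)" if "x \<in> I" for x y
      using xi_eq[OF that, of y] eta_eq[OF that, of y]
      by (simp add: prod_eq_iff xi_of_def phi_of_def beta_of_def)
  qed (rule I)
qed

lemma symmetry_algebra_iff_linear:
  assumes I: "open I" and n: "3 \<le> n" and c: "\<And>j. j < n \<Longrightarrow> smooth_on I (c j)"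
  shows "X \<in> symmetry_algebra n I c \<longleftrightarrow> affine_field I X (xi_of X) (phi_of X) (beta_of X) \<and>
    (\<forall>z. z \<notin> I \<times> UNIV \<longrightarrow> X z = 0) \<and>
    (\<forall>x\<in>I. \<forall>u. linear_ode n c x u = 0 \<longrightarrow> prolongation n X (linear_ode n c) x u = 0)"
  using symmetry_linear[OF I n c, where X=X] affine_field.smooth_X[of I X]
  by (auto simp: symmetry_algebra_def)

lemma xi_of_lincomb: "xi_of (\<lambda>z. r *\<^sub>R X z + Y z) = (\<lambda>x. r * xi_of X x + xi_of Y x)"
  and phi_of_lincomb: "phi_of (\<lambda>z. r *\<^sub>R X z + Y z) = (\<lambda>x. r * phi_of X x + phi_of Y x)"
  and beta_of_lincomb: "beta_of (\<lambda>z. r *\<^sub>R X z + Y z) = (\<lambda>x. r * beta_of X x + beta_of Y x)"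
  by (auto simp: xi_of_def phi_of_def beta_of_def algebra_simps)

lemma symmetry_algebra_lincomb:
  assumes I: "open I" and n: "3 \<le> n" and c: "\<And>j. j < n \<Longrightarrow> smooth_on I (c j)"
    and X: "X \<in> symmetry_algebra n I c" and Y: "Y \<in> symmetry_algebra n I c"
  shows "(\<lambda>z. r *\<^sub>R X z + Y z) \<in> symmetry_algebra n I c"
proof -
  note lX = symmetry_linear[OF I n c X] and lY = symmetry_linear[OF I n c Y]
  show ?thesis
  proof (subst symmetry_algebra_iff_linear[OF I n c], assumption, unfold xi_of_lincomb phi_of_lincomb beta_of_lincomb,
      intro conjI ballI allI impI)
    show "affine_field I (\<lambda>z. r *\<^sub>R X z + Y z) (\<lambda>x. r * xi_of X x + xi_of Y x)
        (\<lambda>x. r * phi_of X x + phi_of Y x) (\<lambda>x. r * beta_of X x + beta_of Y x)"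
      by (rule affine_field_lincomb[OF lX lY])
    show "r *\<^sub>R X z + Y z = 0" if "z \<notin> I \<times> UNIV" for z
      using X Y that by (cases z) (simp add: symmetry_algebra_def)
    show "prolongation n (\<lambda>z. r *\<^sub>R X z + Y z) (linear_ode n c) x u = 0"
      if "x \<in> I" "linear_ode n c x u = 0" for x u
      using X Y that by (simp add: prolongation_lincomb[OF lX lY that(1) c] symmetry_algebra_def)
  qed
qed

lemma zero_symmetry:
  assumes I: "open I" and n: "3 \<le> n" and c: "\<And>j. j < n \<Longrightarrow> smooth_on I (c j)"
  shows "(0 :: vector_field) \<in> symmetry_algebra n I c"
proof -
  interpret affine_field I "0 :: vector_field" "\<lambda>_. 0" "\<lambda>_. 0" "\<lambda>_. 0"
    by unfold_locales (auto simp: I zero_prod_def)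
  have g0: "x \<in> I \<Longrightarrow> g k j x = 0" for k j x
    using prolong_entry_linear[OF affine_field_axioms affine_field_axioms, of x 1 k j] by simp
  have d0: "(deriv ^^ k) (\<lambda>_. 0) x = (0::real)" for k x
    by (induction k arbitrary: x) (simp_all add: fun_eq_iff[symmetric], metis deriv_const ext)
  have "prolong_coeff 0 k x u = 0" if "x \<in> I" for k x u
    using prolong_coeff_eq[OF that] by (simp add: affine_prolong_def g0[OF that] d0 del: sum.lessThan_Suc)
  then show ?thesis
    by (auto simp: symmetry_algebra_def prolongation_linear_ode[OF I _ c])
qed

lemma subspace_symmetry_algebra:
  assumes I: "open I" and n: "3 \<le> n" and c: "\<And>j. j < n \<Longrightarrow> smooth_on I (c j)"
  shows "vf.subspace (symmetry_algebra n I c)"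
proof (rule vf.subspaceI)
  show z: "0 \<in> symmetry_algebra n I c" by (rule zero_symmetry[OF assms])
  show "X + Y \<in> symmetry_algebra n I c" if "X \<in> symmetry_algebra n I c" "Y \<in> symmetry_algebra n I c" for X Y
    using symmetry_algebra_lincomb[OF assms that, of 1] by (simp add: plus_fun_def)
  show "(\<lambda>z. r *\<^sub>R X z) \<in> symmetry_algebra n I c" if "X \<in> symmetry_algebra n I c" for X r
    using symmetry_algebra_lincomb[OF assms that z, of r] by simp
qed

text \<open>The coordinates on the symmetry algebra: \<open>\<xi>, \<xi>', \<xi>'', \<phi>\<close> in positions \<open>0\<close> to \<open>3\<close> and the derivatives of \<open>\<beta>\<close> from
  position \<open>4\<close> on.\<close>

definition cauchy_data :: "real \<Rightarrow> vector_field \<Rightarrow> nat \<Rightarrow> real" where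
  "cauchy_data x X i = (if i < 3 then (deriv ^^ i) (xi_of X) x else if i = 3 then phi_of X x
     else (deriv ^^ (i - 4)) (beta_of X) x)"

lemma cauchy_data_lincomb:
  assumes X: "affine_field I X (xi_of X) (phi_of X) (beta_of X)"
    and Y: "affine_field I Y (xi_of Y) (phi_of Y) (beta_of Y)" and x: "x \<in> I"
  shows "cauchy_data x (\<lambda>z. r *\<^sub>R X z + Y z) i = r * cauchy_data x X i + cauchy_data x Y i"
proof -
  interpret X: affine_field I X "xi_of X" "phi_of X" "beta_of X" by fact
  interpret Y: affine_field I Y "xi_of Y" "phi_of Y" "beta_of Y" by fact
  have "(deriv ^^ k) (\<lambda>x. r * f x + h x) x = r * (deriv ^^ k) f x + (deriv ^^ k) h x"
    if "smooth_on I f" "smooth_on I h" for f h k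
    using higher_deriv_add[OF X.open_I smooth_on_mult[OF X.open_I smooth_on_const that(1)] that(2) x]
      higher_deriv_cmult[OF X.open_I that(1) x] by simp
  then show ?thesis
    unfolding cauchy_data_def xi_of_lincomb phi_of_lincomb beta_of_lincomb
    using X.smooth Y.smooth by simp
qed

text \<open>The determining equation for \<open>j = n - 1\<close>.\<close>

lemma phi_equation:
  assumes I: "open I" and n: "3 \<le> n" and c: "\<And>j. j < n \<Longrightarrow> smooth_on I (c j)"
    and X: "X \<in> symmetry_algebra n I c" and x: "x \<in> I"
  defines "a \<equiv> c (n - 1)" and "\<xi> \<equiv> xi_of X" and "\<phi> \<equiv> phi_of X"
  shows "deriv \<phi> x = real (n - 1) / 2 * deriv (deriv \<xi>) x - (a x * deriv \<xi> x + deriv a x * \<xi> x) / real n"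
proof -
  note defs = \<xi>_def \<phi>_def
  interpret affine_field I X \<xi> \<phi> "beta_of X"
    unfolding \<xi>_def \<phi>_def by (rule symmetry_linear[OF I n c X])
  obtain k where k: "n = Suc k" using n by (cases n) auto
  have eq: "\<xi> x * deriv (c k) x + (\<Sum>i<n. c i x * g i k x) + g n k x - c k x * g n n x = 0"
    by (rule determining_equations(2)[OF _ c x]) (use X x k in \<open>auto simp: symmetry_algebra_def\<close>)
  have "(\<Sum>i<n. c i x * g i k x) = c k x * g k k x"
    unfolding k sum.lessThan_Suc by (simp add: prolong_entry_above)
  with eq have "\<xi> x * deriv a x + a x * deriv \<xi> x + real n * deriv \<phi> x - real n * real k / 2 * deriv (deriv \<xi>) x = 0"
    unfolding g_diag[OF x] k g_subdiag[OF x] by (simp add: k a_def algebra_simps)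
  then show ?thesis using k by (simp add: field_simps)
qed

text \<open>The determining equation for \<open>j = n - 2\<close>, with \<open>\<phi>'\<close> and \<open>\<phi>''\<close> eliminated by means of the previous lemma. The
  two contributions to the coefficient of \<open>\<xi>'''\<close>, \<open>n (n - 1)\<^sup>2 / 4\<close> from \<open>\<phi>''\<close> and \<open>- n (n - 1) (n - 2) / 6\<close>, do not
  cancel; the coefficient of \<open>\<xi>''\<close> does vanish.\<close>

lemma third_order_equation:
  assumes I: "open I" and n: "3 \<le> n" and c: "\<And>j. j < n \<Longrightarrow> smooth_on I (c j)"
    and X: "X \<in> symmetry_algebra n I c" and x: "x \<in> I"
  defines "a \<equiv> c (n - 1)" and "b \<equiv> c (n - 2)" and "\<xi> \<equiv> xi_of X" and "\<phi> \<equiv> phi_of X"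
  shows "real n * (real n - 1) * (real n + 1) / 12 * deriv (deriv (deriv \<xi>)) x =
    ((real n - 1) / real n * a x * deriv a x + (real n - 1) / 2 * deriv (deriv a) x - deriv b x) * \<xi> x
    + ((real n - 1) / real n * (a x)\<^sup>2 + (real n - 1) * deriv a x - 2 * b x) * deriv \<xi> x"
proof -
  note defs = \<xi>_def \<phi>_def
  interpret affine_field I X \<xi> \<phi> "beta_of X"
    unfolding \<xi>_def \<phi>_def by (rule symmetry_linear[OF I n c X])
  obtain k where k: "n = Suc (Suc k)" using n by (cases n; cases "n - 1") auto
  have smooth_a: "smooth_on I a" unfolding a_def using c n by simp
  have eq: "\<xi> x * deriv (c k) x + (\<Sum>i<n. c i x * g i k x) + g n k x - c k x * g n n x = 0"
    by (rule determining_equations(2)[OF _ c x]) (use X x k in \<open>auto simp: symmetry_algebra_def\<close>)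
  have "(\<Sum>i<n. c i x * g i k x) = c k x * g k k x + c (Suc k) x * g (Suc k) k x"
    unfolding k sum.lessThan_Suc by (simp add: prolong_entry_above)
  with eq have E: "\<xi> x * deriv b x + 2 * b x * deriv \<xi> x
      + a x * ((real n - 1) * deriv \<phi> x - (real n - 1) * (real n - 2) / 2 * deriv (deriv \<xi>) x)
      + real n * (real n - 1) / 2 * deriv (deriv \<phi>) x
      - real n * (real n - 1) * (real n - 2) / 6 * deriv (deriv (deriv \<xi>)) x = 0"
    unfolding g_diag[OF x] k g_subdiag[OF x] g_subsubdiag[OF x] by (simp add: k a_def b_def algebra_simps)
  have \<phi>1: "deriv \<phi> x = (real n - 1) / 2 * deriv (deriv \<xi>) x - (a x * deriv \<xi> x + deriv a x * \<xi> x) / real n" if "x \<in> I" for x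
    using phi_equation[OF I n c X that] n by (simp add: a_def defs of_nat_diff)
  have "deriv (deriv \<phi>) x = deriv (\<lambda>x. (real n - 1) / 2 * deriv (deriv \<xi>) x - (a x * deriv \<xi> x + deriv a x * \<xi> x) / real n) x"
    by (rule deriv_cong_open[OF I x \<phi>1])
  also have "\<dots> = (real n - 1) / 2 * deriv (deriv (deriv \<xi>)) x
     - ((deriv a x * deriv \<xi> x + deriv (deriv \<xi>) x * a x) + (deriv (deriv a) x * \<xi> x + deriv \<xi> x * deriv a x)) / real n"
    by (intro DERIV_imp_deriv DERIV_diff DERIV_add DERIV_mult DERIV_cmult DERIV_cdivide
        smooth_on_DERIV[OF _ x] smooth_on_deriv smooth smooth_a)
  finally have \<phi>2: "deriv (deriv \<phi>) x = (real n - 1) / 2 * deriv (deriv (deriv \<xi>)) x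
     - (a x * deriv (deriv \<xi>) x + 2 * deriv a x * deriv \<xi> x + deriv (deriv a) x * \<xi> x) / real n"
    by (simp add: algebra_simps)
  have n0: "real n \<noteq> 0" using n by simp
  define N where "N = real n"
  show ?thesis
    using E n0 unfolding \<phi>2 \<phi>1[OF x] N_def[symmetric]
    by (simp add: field_simps power2_eq_square)
qed

text \<open>The previous two lemmas as a linear system for \<open>(\<xi>, \<xi>', \<xi>'', \<phi>)\<close>. Only \<open>a = c (n - 1)\<close> and \<open>b = c (n - 2)\<close>
  enter.\<close>

definition determining_matrix :: "nat \<Rightarrow> (real \<Rightarrow> real) \<Rightarrow> (real \<Rightarrow> real) \<Rightarrow> nat \<Rightarrow> nat \<Rightarrow> real \<Rightarrow> real" where
  "determining_matrix n a b j i x =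
    (if j < 2 then (if i = Suc j then 1 else 0)
     else if j = 2 then 12 / (real n * (real n - 1) * (real n + 1)) *
       (if i = 0 then (real n - 1) / real n * a x * deriv a x + (real n - 1) / 2 * deriv (deriv a) x - deriv b x
        else if i = 1 then (real n - 1) / real n * (a x * a x) + (real n - 1) * deriv a x - 2 * b x else 0)
     else (if i = 0 then - 1 / real n * deriv a x else if i = 1 then - 1 / real n * a x
       else if i = 2 then (real n - 1) / 2 else 0))"

lemma smooth_on_determining_matrix:
  assumes I: "open I" and a: "smooth_on I a" and b: "smooth_on I b"
  shows "smooth_on I (determining_matrix n a b j i)"
  unfolding determining_matrix_def[abs_def]
  by (intro smooth_on_if smooth_on_mult smooth_on_add smooth_on_diff smooth_on_const smooth_on_deriv I a b)

lemma cauchy_data_system: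
  assumes I: "open I" and n: "3 \<le> n" and c: "\<And>j. j < n \<Longrightarrow> smooth_on I (c j)"
    and X: "X \<in> symmetry_algebra n I c" and x: "x \<in> I" and j: "j < 4"
  shows "DERIV (\<lambda>x. cauchy_data x X j) x :>
    (\<Sum>i<4. determining_matrix n (c (n - 1)) (c (n - 2)) j i x * cauchy_data x X i)"
proof -
  let ?a = "c (n - 1)" and ?b = "c (n - 2)"
  define \<xi> \<phi> where "\<xi> = xi_of X" and "\<phi> = phi_of X"
  have L: "affine_field I X \<xi> \<phi> (beta_of X)"
    unfolding \<xi>_def \<phi>_def by (rule symmetry_linear[OF I n c X])
  note sm = affine_field.smooth[OF L]
  have cd: "cauchy_data x X 0 = \<xi> x" "cauchy_data x X 1 = deriv \<xi> x" "cauchy_data x X 2 = deriv (deriv \<xi>) x"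
    "cauchy_data x X 3 = \<phi> x" for x
    by (simp_all add: cauchy_data_def \<xi>_def \<phi>_def numeral_2_eq_2)
  have sum4: "(\<Sum>i<4. f i) = f 0 + f 1 + f 2 + f (3::nat)" for f :: "nat \<Rightarrow> real"
    by (simp add: eval_nat_numeral)
  have n0: "real n \<noteq> 0" "real n - 1 \<noteq> 0" "real n + 1 \<noteq> 0" using n by auto
  have three: "deriv (deriv (deriv \<xi>)) x = 12 / (real n * (real n - 1) * (real n + 1)) *
     (((real n - 1) / real n * ?a x * deriv ?a x + (real n - 1) / 2 * deriv (deriv ?a) x - deriv ?b x) * \<xi> x
    + ((real n - 1) / real n * (?a x * ?a x) + (real n - 1) * deriv ?a x - 2 * ?b x) * deriv \<xi> x)"
    (is "?D = 12 / ?k * ?r")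
  proof -
    have "?k / 12 * ?D = ?r"
      using third_order_equation[OF I n c X x] by (simp only: \<xi>_def power2_eq_square)
    moreover have "?k \<noteq> 0" using n0 by simp
    ultimately show ?thesis by (simp add: field_simps)
  qed
  have tr: "deriv \<phi> x = (real n - 1) / 2 * deriv (deriv \<xi>) x - (?a x * deriv \<xi> x + deriv ?a x * \<xi> x) / real n"
    using phi_equation[OF I n c X x] n by (simp add: \<xi>_def \<phi>_def of_nat_diff)
  consider "j = 0" | "j = 1" | "j = 2" | "j = 3" using j by linarith
  then show ?thesis
  proof cases
    case 1
    then show ?thesis
      unfolding sum4 cd 1 using smooth_on_DERIV[OF sm(1) x] by (simp add: determining_matrix_def)
  next
    case 2
    then show ?thesis
      unfolding sum4 cd 2 using smooth_on_DERIV[OF smooth_on_deriv[OF sm(1)] x] by (simp add: determining_matrix_def)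
  next
    case 3
    let ?M = "determining_matrix n ?a ?b 2"
    have row: "?M 0 x = 12 / ?k * ((real n - 1) / real n * ?a x * deriv ?a x
        + (real n - 1) / 2 * deriv (deriv ?a) x - deriv ?b x)"
      "?M 1 x = 12 / ?k * ((real n - 1) / real n * (?a x * ?a x)
        + (real n - 1) * deriv ?a x - 2 * ?b x)"
      "?M 2 x = 0" "?M 3 x = 0"
      by (simp_all add: determining_matrix_def)
    have expand: "K * (p * s + q * t) = K * p * s + K * q * t + 0 * v + 0 * w" for K p q s t v w :: real
      by (simp add: algebra_simps)
    have "deriv (deriv (deriv \<xi>)) x = (\<Sum>i<4. ?M i x * cauchy_data x X i)"
      unfolding sum4 cd three row by (rule expand)
    then show ?thesis
      unfolding 3 cd(3) using smooth_on_DERIV[OF smooth_on_deriv[OF smooth_on_deriv[OF sm(1)]] x] by simp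
  next
    case 4
    have "deriv \<phi> x = (\<Sum>i<4. determining_matrix n ?a ?b 3 i x * cauchy_data x X i)"
      unfolding sum4 cd tr using n0(1) by (simp add: determining_matrix_def field_simps)
    then show ?thesis
      unfolding 4 cd(4) using smooth_on_DERIV[OF sm(2) x] by simp
  qed
qed

text \<open>The two equations may have different lower coefficients: the components \<open>\<xi>\<close> and \<open>\<phi>\<close> of their symmetries obey
  the same system.\<close>

lemma symmetries_agree:
  assumes I: "open_interval I" and n: "3 \<le> n" and c: "\<And>j. j < n \<Longrightarrow> smooth_on I (c j)"
    and d: "\<And>j. j < n \<Longrightarrow> smooth_on I (d j)"
    and same: "\<And>x. x \<in> I \<Longrightarrow> c (n - 1) x = d (n - 1) x" "\<And>x. x \<in> I \<Longrightarrow> c (n - 2) x = d (n - 2) x"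
    and X: "X \<in> symmetry_algebra n I c" and Y: "Y \<in> symmetry_algebra n I d"
    and x0: "x0 \<in> I" "\<And>i. i < 4 \<Longrightarrow> cauchy_data x0 X i = cauchy_data x0 Y i" and x: "x \<in> I"
  shows "xi_of X x = xi_of Y x" "phi_of X x = phi_of Y x"
proof -
  have op: "open I" using I by (simp add: open_interval_def)
  let ?A = "determining_matrix n (c (n - 1)) (c (n - 2))"
  have A_eq: "determining_matrix n (d (n - 1)) (d (n - 2)) j i x = ?A j i x" if "x \<in> I" for j i x
  proof -
    have "(deriv ^^ k) (c (n - 1)) x = (deriv ^^ k) (d (n - 1)) x" "(deriv ^^ k) (c (n - 2)) x = (deriv ^^ k) (d (n - 2)) x" for k
      by (rule higher_deriv_cong_open[OF op _ that], rule same, assumption)+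
    from this[of 1] this[of 2] same[OF that] show ?thesis
      by (simp add: determining_matrix_def numeral_2_eq_2)
  qed
  have *: "cauchy_data x X j - cauchy_data x Y j = 0" if "j < 4" for j
  proof (rule linear_system_unique[OF I, of 4 ?A "\<lambda>j x. cauchy_data x X j - cauchy_data x Y j" x0 x j])
    show "continuous_on I (?A i j)" for i j
      by (rule smooth_on_imp_continuous_on[OF smooth_on_determining_matrix[OF op]]) (use c n in auto)
    fix j :: nat and x assume j: "j < 4" and x: "x \<in> I"
    have "(\<Sum>i<4. ?A j i x * (cauchy_data x X i - cauchy_data x Y i))
        = (\<Sum>i<4. ?A j i x * cauchy_data x X i) - (\<Sum>i<4. determining_matrix n (d (n - 1)) (d (n - 2)) j i x * cauchy_data x Y i)"
      unfolding A_eq[OF x] by (simp only: right_diff_distrib sum_subtractf)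
    then show "DERIV (\<lambda>x. cauchy_data x X j - cauchy_data x Y j) x :>
        (\<Sum>i<4. ?A j i x * (cauchy_data x X i - cauchy_data x Y i))"
      using DERIV_diff[OF cauchy_data_system[OF op n c X x j] cauchy_data_system[OF op n d Y x j]] by (simp only:)
  qed (use x0 x that in auto)
  show "xi_of X x = xi_of Y x" using *[of 0] by (simp add: cauchy_data_def)
  show "phi_of X x = phi_of Y x" using *[of 3] by (simp add: cauchy_data_def)
qed

lemma symmetry_determined_by_cauchy_data:
  assumes I: "open_interval I" and n: "3 \<le> n" and c: "\<And>j. j < n \<Longrightarrow> smooth_on I (c j)"
    and X: "X \<in> symmetry_algebra n I c" and x0: "x0 \<in> I" and zero: "\<And>i. i < n + 4 \<Longrightarrow> cauchy_data x0 X i = 0"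
  shows "X = 0"
proof -
  have op: "open I" using I by (simp add: open_interval_def)
  interpret affine_field I X "xi_of X" "phi_of X" "beta_of X"
    by (rule symmetry_linear[OF op n c X])
  have Z: "(0 :: vector_field) \<in> symmetry_algebra n I c" by (rule zero_symmetry[OF op n c])
  have "cauchy_data x0 0 i = 0" for i
    using cauchy_data_lincomb[OF symmetry_linear[OF op n c Z] symmetry_linear[OF op n c Z] x0, of 1 i]
    by (simp add: zero_fun_def)
  then have eq: "xi_of X x = xi_of 0 x" "phi_of X x = phi_of 0 x" if "x \<in> I" for x
    using symmetries_agree[OF I n c c refl refl X Z x0 _ that] zero by auto
  have "beta_of X x = 0" if "x \<in> I" for x
  proof (rule linear_ode_unique[OF I c x0 smooth(3) _ _ _ that])
    show "linear_ode n c x (\<lambda>j. (deriv ^^ j) (beta_of X) x) = 0" if "x \<in> I" for x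
      by (rule determining_equations(1)[OF _ c that]) (use X n that in \<open>auto simp: symmetry_algebra_def\<close>)
    show "(deriv ^^ j) (beta_of X) x0 = 0" if "j < n" for j
      using zero[of "j + 4"] that by (simp add: cauchy_data_def)
  qed (use n in auto)
  moreover have "xi_of 0 x = 0" "phi_of 0 x = 0" for x by (simp_all add: xi_of_def phi_of_def)
  ultimately have "X (x, y) = 0" if "x \<in> I" for x y
    unfolding X_eq[OF that] eq[OF that] using that by (simp add: zero_prod_def)
  moreover have "X z = 0" if "z \<notin> I \<times> UNIV" for z using X that by (cases z) (simp add: symmetry_algebra_def)
  ultimately have "X z = 0" for z by (cases z, cases "fst z \<in> I") (auto simp: mem_Times_iff)
  then show ?thesis by (simp add: fun_eq_iff)
qed

lemma maximal_symmetry_iff_cauchy_data_onto: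
  assumes I: "open_interval I" and n: "3 \<le> n" and c: "\<And>j. j < n \<Longrightarrow> smooth_on I (c j)" and x0: "x0 \<in> I"
  shows "maximal_symmetry n I c \<longleftrightarrow>
    (\<forall>e. \<exists>X\<in>symmetry_algebra n I c. \<forall>i<n + 4. cauchy_data x0 X i = e i)"
  unfolding maximal_symmetry_def
proof (rule dim_eq_iff_functionals_onto)
  have op: "open I" using I by (simp add: open_interval_def)
  note lin = symmetry_linear[OF op n c]
  show "vf.subspace (symmetry_algebra n I c)" by (rule subspace_symmetry_algebra[OF op n c])
  have Z: "(0 :: vector_field) \<in> symmetry_algebra n I c" by (rule zero_symmetry[OF op n c])
  have cd0: "cauchy_data x0 0 i = 0" for i
    using cauchy_data_lincomb[OF lin[OF _ Z] lin[OF _ Z] x0, of 1 i] by (simp add: zero_fun_def)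
  show "cauchy_data x0 (X + Y) i = cauchy_data x0 X i + cauchy_data x0 Y i"
    if "X \<in> symmetry_algebra n I c" "Y \<in> symmetry_algebra n I c" for X Y i
    using cauchy_data_lincomb[OF lin[OF _ that(1)] lin[OF _ that(2)] x0, of 1 i] by (simp add: plus_fun_def)
  show "cauchy_data x0 (\<lambda>z. r *\<^sub>R X z) i = r * cauchy_data x0 X i" if "X \<in> symmetry_algebra n I c" for r X i
    using cauchy_data_lincomb[OF lin[OF _ that] lin[OF _ Z] x0, of r i] by (simp add: cd0)
  show "X = 0" if "X \<in> symmetry_algebra n I c" "\<And>i. i < n + 4 \<Longrightarrow> cauchy_data x0 X i = 0" for X
    by (rule symmetry_determined_by_cauchy_data[OF I n c that(1) x0 that(2)])
qed (use n in simp)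

section \<open>Uniqueness of the equation with maximal symmetry\<close>

text \<open>Downward induction on \<open>j\<close>. Maximality provides, for both equations, symmetries with \<open>\<xi>(x) = 0\<close> and
  \<open>\<xi>'(x) = 1\<close> at the given point. They share \<open>\<xi>\<close> and \<open>\<phi>\<close>, hence also the entries of the prolongation, and in the
  difference of the \<open>j\<close>-th determining equations everything cancels except \<open>c j x - d j x\<close> times the difference of
  the diagonal entries with indices \<open>j\<close> and \<open>n\<close>, which is \<open>(n - j) \<xi>'(x) = n - j\<close>.\<close>

theorem maximal_symmetry_unique:
  assumes I: "open_interval I" and n: "3 \<le> n"
    and c: "\<And>j. j < n \<Longrightarrow> smooth_on I (c j)" and d: "\<And>j. j < n \<Longrightarrow> smooth_on I (d j)"
    and maxc: "maximal_symmetry n I c" and maxd: "maximal_symmetry n I d"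
    and same: "\<And>x. x \<in> I \<Longrightarrow> c (n - 1) x = d (n - 1) x" "\<And>x. x \<in> I \<Longrightarrow> c (n - 2) x = d (n - 2) x"
    and "j < n" "x \<in> I"
  shows "c j x = d j x"
  using \<open>j < n\<close> \<open>x \<in> I\<close>
proof (induction "n - j" arbitrary: j x rule: less_induct)
  case less
  have op: "open I" using I by (simp add: open_interval_def)
  show ?case
  proof (cases "j = n - 1 \<or> j = n - 2")
    case True
    then show ?thesis using same less.prems by auto
  next
    case False
    \<comment> \<open>Cauchy data of a field with \<open>\<xi>(x) = 0\<close> and \<open>\<xi>'(x) = 1\<close>\<close>
    define e where "e i = (if i = (1::nat) then 1 else 0 :: real)" for i
    obtain X where X: "X \<in> symmetry_algebra n I c" "\<And>i. i < n + 4 \<Longrightarrow> cauchy_data x X i = e i"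
      using maximal_symmetry_iff_cauchy_data_onto[OF I n c less.prems(2), THEN iffD1, OF _ maxc, THEN spec, of e]
      by blast
    obtain Y where Y: "Y \<in> symmetry_algebra n I d" "\<And>i. i < n + 4 \<Longrightarrow> cauchy_data x Y i = e i"
      using maximal_symmetry_iff_cauchy_data_onto[OF I n d less.prems(2), THEN iffD1, OF _ maxd, THEN spec, of e]
      by blast
    interpret X: affine_field I X "xi_of X" "phi_of X" "beta_of X"
      by (rule symmetry_linear[OF op n c X(1)])
    interpret Y: affine_field I Y "xi_of Y" "phi_of Y" "beta_of Y"
      by (rule symmetry_linear[OF op n d Y(1)])
    have agree: "xi_of X t = xi_of Y t" "phi_of X t = phi_of Y t" if "t \<in> I" for t
      using symmetries_agree[OF I n c d same X(1) Y(1) less.prems(2) _ that] X(2) Y(2) by auto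
    have g_eq: "t \<in> I \<Longrightarrow> Y.g k i t = X.g k i t" for k i t
    proof (induction k arbitrary: i t)
      case 0
      then show ?case using agree by simp
    next
      case (Suc k)
      have "deriv (Y.g k i) t = deriv (X.g k i) t" "deriv (xi_of Y) t = deriv (xi_of X) t"
        using deriv_cong_open[OF op Suc.prems, of "Y.g k i" "X.g k i"]
          deriv_cong_open[OF op Suc.prems, of "xi_of Y" "xi_of X"] Suc.IH agree by auto
      then show ?case using Suc.IH[OF Suc.prems] by simp
    qed
    have xi: "xi_of X x = 0" "deriv (xi_of X) x = 1"
      using X(2)[of 0] X(2)[of 1] by (auto simp: cauchy_data_def e_def)
    have EX: "xi_of X x * deriv (c j) x + (\<Sum>k<n. c k x * X.g k j x) + X.g n j x - c j x * X.g n n x = 0"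
      by (rule X.determining_equations(2)[OF _ c less.prems(2)])
        (use X(1) less.prems in \<open>auto simp: symmetry_algebra_def\<close>)
    have EY: "xi_of Y x * deriv (d j) x + (\<Sum>k<n. d k x * Y.g k j x) + Y.g n j x - d j x * Y.g n n x = 0"
      by (rule Y.determining_equations(2)[OF _ d less.prems(2)])
        (use Y(1) less.prems in \<open>auto simp: symmetry_algebra_def\<close>)
    have "(\<Sum>k<n. c k x * X.g k j x) - (\<Sum>k<n. d k x * Y.g k j x) = (\<Sum>k<n. (c k x - d k x) * X.g k j x)"
      by (simp add: g_eq[OF less.prems(2)] sum_subtractf algebra_simps)
    also have "\<dots> = (\<Sum>k<n. if k = j then (c j x - d j x) * X.g j j x else 0)"
    proof (rule sum.cong[OF refl])
      fix k assume "k \<in> {..<n}"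
      then consider "k < j" | "k = j" | "j < k \<and> k < n" by fastforce
      then show "(c k x - d k x) * X.g k j x = (if k = j then (c j x - d j x) * X.g j j x else 0)"
      proof cases
        case 3
        then have "c k x = d k x" using less.hyps[of k x] less.prems by auto
        then show ?thesis using 3 by simp
      qed (auto simp: prolong_entry_above)
    qed
    also have "\<dots> = (c j x - d j x) * X.g j j x" using less.prems by simp
    finally have "(c j x - d j x) * (X.g j j x - X.g n n x) = 0"
      using EX EY xi agree[OF less.prems(2)] g_eq[OF less.prems(2)] by (simp add: algebra_simps)
    moreover have "X.g j j x - X.g n n x = real n - real j"
      unfolding X.g_diag[OF less.prems(2)] xi by simp
    ultimately show ?thesis using less.prems(1) by simp
  qed
qed

section \<open>Iterative equations have maximal symmetry\<close>

text \<open>Every jet on the equation is the jet of a solution \<open>y\<close>. Along it the prolongation applied to the equation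
  equals the equation applied to the characteristic of \<open>X\<close>, because the derivative of the equation along \<open>y\<close>
  vanishes.\<close>

lemma symmetry_if_characteristic_solution:
  assumes I: "open_interval I" and n: "0 < n" and X: "affine_field I X \<xi> \<phi> \<beta>" and out: "\<And>z. z \<notin> I \<times> UNIV \<Longrightarrow> X z = 0"
    and c: "\<And>j. j < n \<Longrightarrow> smooth_on I (c j)"
    and sol: "\<And>y x. smooth_on I y \<Longrightarrow> (\<And>x. x \<in> I \<Longrightarrow> linear_ode n c x (\<lambda>j. (deriv ^^ j) y x) = 0) \<Longrightarrow> x \<in> I \<Longrightarrow>
      linear_ode n c x (\<lambda>j. (deriv ^^ j) (\<lambda>x. \<phi> x * y x + \<beta> x - \<xi> x * deriv y x) x) = 0"
  shows "X \<in> symmetry_algebra n I c"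
proof -
  interpret affine_field I X \<xi> \<phi> \<beta> by fact
  have "prolongation n X (linear_ode n c) x u = 0" if x: "x \<in> I" and u: "linear_ode n c x u = 0" for x u
  proof -
    obtain y where y: "smooth_on I y" "\<And>x. x \<in> I \<Longrightarrow> linear_ode n c x (\<lambda>j. (deriv ^^ j) y x) = 0"
      "\<And>j. j < n \<Longrightarrow> (deriv ^^ j) y x = u j"
      using linear_ode_exists[where n=n and c=c and v=u, OF I c x] n by auto
    define Q where "Q = (\<lambda>x. \<phi> x * y x + \<beta> x - \<xi> x * deriv y x)"
    have un: "(deriv ^^ n) y x = u n"
      using y(2)[OF x] u y(3) by (simp add: linear_ode_def)
    have pc: "prolong_coeff X k x u = (deriv ^^ k) Q x + \<xi> x * (deriv ^^ Suc k) y x" if "k \<le> n" for k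
    proof -
      have "affine_prolong k x u = affine_prolong k x (\<lambda>j. (deriv ^^ j) y x)"
        unfolding affine_prolong_def using y(3) un that by (intro arg_cong2[of _ _ _ _ "(+)"] sum.cong) (auto simp: less_Suc_eq le_less)
      then show ?thesis
        unfolding prolong_coeff_eq[OF x] Q_def affine_prolong_along_jet[OF y(1) x] .
    qed
    have "DERIV (\<lambda>x. linear_ode n c x (\<lambda>j. (deriv ^^ j) y x)) x :>
        (deriv ^^ Suc n) y x + (\<Sum>j<n. deriv (c j) x * (deriv ^^ j) y x + (deriv ^^ Suc j) y x * c j x)"
      unfolding linear_ode_def
      by (intro DERIV_add DERIV_sum DERIV_mult smooth_on_DERIV_higher[OF y(1) x] smooth_on_DERIV[OF c x]) auto
    moreover have "DERIV (\<lambda>x. linear_ode n c x (\<lambda>j. (deriv ^^ j) y x)) x :> 0"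
      by (rule DERIV_cong_open[OF open_I x _ DERIV_const[of 0]]) (simp add: y(2))
    ultimately have D: "(deriv ^^ Suc n) y x + (\<Sum>j<n. deriv (c j) x * (deriv ^^ j) y x + (deriv ^^ Suc j) y x * c j x) = 0"
      by (rule DERIV_unique)
    have "prolongation n X (linear_ode n c) x u = \<xi> x * (\<Sum>j<n. deriv (c j) x * (deriv ^^ j) y x)
       + (\<Sum>j<n. ((deriv ^^ j) Q x + \<xi> x * (deriv ^^ Suc j) y x) * c j x) + ((deriv ^^ n) Q x + \<xi> x * (deriv ^^ Suc n) y x)"
      unfolding prolongation_linear_ode[where c=c and n=n, OF open_I x c, simplified] using y(3) pc by (simp add: X_eq[OF x])
    also have "\<dots> = linear_ode n c x (\<lambda>j. (deriv ^^ j) Q x)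
       + \<xi> x * ((deriv ^^ Suc n) y x + (\<Sum>j<n. deriv (c j) x * (deriv ^^ j) y x + (deriv ^^ Suc j) y x * c j x))"
      by (simp add: linear_ode_def algebra_simps sum.distrib sum_distrib_left)
    also have "\<dots> = 0" unfolding D using sol[OF y(1,2) x] by (simp add: Q_def)
    finally show ?thesis .
  qed
  then show ?thesis
    using smooth_X out by (auto simp: symmetry_algebra_def)
qed

text \<open>The coefficients of the operators \<open>L\<^sub>0 = 1\<close>, \<open>L\<^sub>1 = D + p\<close> and
  \<open>L\<^sub>k\<^sub>+\<^sub>2 = (D + p) L\<^sub>k\<^sub>+\<^sub>1 + (k + 1) (n - k - 1) q L\<^sub>k\<close>.\<close>

fun iter_coeff :: "nat \<Rightarrow> (real \<Rightarrow> real) \<Rightarrow> (real \<Rightarrow> real) \<Rightarrow> nat \<Rightarrow> nat \<Rightarrow> real \<Rightarrow> real" where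
  "iter_coeff n p q 0 j = (\<lambda>x. if j = 0 then 1 else 0)"
| "iter_coeff n p q (Suc 0) j = (\<lambda>x. if j = 1 then 1 else if j = 0 then p x else 0)"
| "iter_coeff n p q (Suc (Suc k)) j = (\<lambda>x. deriv (iter_coeff n p q (Suc k) j) x
     + (if j = 0 then 0 else iter_coeff n p q (Suc k) (j - 1) x) + p x * iter_coeff n p q (Suc k) j x
     + real (Suc k) * (real n - real (Suc k)) * q x * iter_coeff n p q k j x)"

definition iter_op :: "nat \<Rightarrow> (real \<Rightarrow> real) \<Rightarrow> (real \<Rightarrow> real) \<Rightarrow> nat \<Rightarrow> (real \<Rightarrow> real) \<Rightarrow> real \<Rightarrow> real" where
  "iter_op n p q k y x = (\<Sum>j<Suc k. iter_coeff n p q k j x * (deriv ^^ j) y x)"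

lemma iter_coeff_above: "k < j \<Longrightarrow> iter_coeff n p q k j x = 0"
proof (induction n p q k j arbitrary: x rule: iter_coeff.induct)
  case (3 n p q k j)
  then have "iter_coeff n p q (Suc k) j = (\<lambda>_. 0)" by auto
  then show ?case using 3 by auto
qed auto

lemma iter_coeff_diag: "iter_coeff n p q k k x = 1"
proof (induction k arbitrary: x)
  case (Suc k)
  then show ?case
  proof (cases k)
    case (Suc l)
    have "iter_coeff n p q (Suc l) (Suc (Suc l)) = (\<lambda>_. 0)" using iter_coeff_above by auto
    then show ?thesis using Suc Suc.IH by (simp add: iter_coeff_above)
  qed simp
qed simp

locale iterative_equation =
  fixes I :: "real set" and n :: nat and p q :: "real \<Rightarrow> real"
  assumes I: "open_interval I" and n: "3 \<le> n" and smooth_p: "smooth_on I p" and smooth_q: "smooth_on I q"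
begin

lemma open_I: "open I" using I by (simp add: open_interval_def)

abbreviation "ic \<equiv> iter_coeff n p q"
abbreviation "L \<equiv> iter_op n p q"
text \<open>The weight in the recursion. It vanishes at \<open>k = 0\<close>, where the predecessor \<open>k - 1\<close> is meaningless, and at
  \<open>k = n\<close>, where the commutation relation closes.\<close>

definition \<kappa> :: "nat \<Rightarrow> real" where "\<kappa> k = real k * (real n - real k)"

lemma smooth_ic: "smooth_on I (ic k j)"
proof (induction k arbitrary: j rule: induct_nat_012)
  case 0
  then show ?case by (cases "j = 0") simp_all
next
  case 1
  then show ?case using smooth_p by (cases "j = 0"; cases "j = 1") simp_all
next
  case (ge2 k)
  show ?case unfolding iter_coeff.simps
    by (intro smooth_on_add smooth_on_mult smooth_on_if open_I smooth_on_deriv ge2 smooth_p smooth_q smooth_on_const)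
qed

lemma smooth_L: "smooth_on I y \<Longrightarrow> smooth_on I (L k y)"
  unfolding iter_op_def[abs_def]
  by (intro smooth_on_sum smooth_on_mult open_I smooth_ic smooth_on_higher_deriv)

lemma L_0: "L 0 y x = y x"
  by (simp add: iter_op_def)

lemma L_Suc:
  assumes y: "smooth_on I y" and x: "x \<in> I"
  shows "L (Suc k) y x = deriv (L k y) x + p x * L k y x + \<kappa> k * q x * L (k - 1) y x"
proof (cases k)
  case 0
  have "L 0 y = y" by (simp add: fun_eq_iff L_0)
  then show ?thesis using 0 by (simp add: iter_op_def \<kappa>_def)
next
  case (Suc l)
  have z: "ic (Suc l) (Suc (Suc l)) = (\<lambda>_. 0)" using iter_coeff_above by auto
  have "DERIV (L (Suc l) y) x :> (\<Sum>j<Suc (Suc l). deriv (ic (Suc l) j) x * (deriv ^^ j) y x + (deriv ^^ Suc j) y x * ic (Suc l) j x)"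
    unfolding iter_op_def[abs_def]
    by (intro DERIV_sum DERIV_mult smooth_on_DERIV[OF smooth_ic x] smooth_on_DERIV_higher[OF y x])
  then have D: "deriv (L (Suc l) y) x = (\<Sum>j<Suc (Suc l). deriv (ic (Suc l) j) x * (deriv ^^ j) y x)
      + (\<Sum>j<Suc (Suc l). ic (Suc l) j x * (deriv ^^ Suc j) y x)"
    by (simp add: DERIV_imp_deriv sum.distrib mult.commute del: sum.lessThan_Suc)
  let ?u = "\<lambda>j. (deriv ^^ j) y x"
  have "L (Suc (Suc l)) y x = (\<Sum>j<Suc (Suc (Suc l)). deriv (ic (Suc l) j) x * ?u j)
      + (\<Sum>j<Suc (Suc (Suc l)). (if j = 0 then 0 else ic (Suc l) (j - 1) x) * ?u j)
      + (\<Sum>j<Suc (Suc (Suc l)). p x * (ic (Suc l) j x * ?u j))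
      + (\<Sum>j<Suc (Suc (Suc l)). \<kappa> (Suc l) * q x * (ic l j x * ?u j))"
    by (simp only: iter_op_def iter_coeff.simps distrib_right sum.distrib \<kappa>_def mult.assoc)
  also have "(\<Sum>j<Suc (Suc (Suc l)). deriv (ic (Suc l) j) x * ?u j) = (\<Sum>j<Suc (Suc l). deriv (ic (Suc l) j) x * ?u j)"
    using z by (subst sum.lessThan_Suc) simp
  also have "(\<Sum>j<Suc (Suc (Suc l)). (if j = 0 then 0 else ic (Suc l) (j - 1) x) * ?u j) = (\<Sum>j<Suc (Suc l). ic (Suc l) j x * ?u (Suc j))"
    by (subst sum.lessThan_Suc_shift) simp
  also have "(\<Sum>j<Suc (Suc (Suc l)). p x * (ic (Suc l) j x * ?u j)) = p x * L (Suc l) y x"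
    unfolding iter_op_def sum_distrib_left by (subst sum.lessThan_Suc) (simp add: iter_coeff_above del: sum.lessThan_Suc iter_coeff.simps)
  also have "(\<Sum>j<Suc (Suc (Suc l)). \<kappa> (Suc l) * q x * (ic l j x * ?u j)) = \<kappa> (Suc l) * q x * L l y x"
    unfolding iter_op_def sum_distrib_left
    by (subst sum.lessThan_Suc, subst sum.lessThan_Suc) (simp add: iter_coeff_above del: sum.lessThan_Suc iter_coeff.simps)
  finally show ?thesis unfolding Suc D by simp
qed

lemma ic_subdiag: "x \<in> I \<Longrightarrow> ic (Suc k) k x = real (Suc k) * p x"
proof (induction k arbitrary: x)
  case (Suc k)
  have "ic (Suc k) (Suc k) = (\<lambda>_. 1)" using iter_coeff_diag by auto
  then have "ic (Suc (Suc k)) (Suc k) x = real (Suc k) * p x + p x"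
    using Suc by (simp add: iter_coeff_above)
  then show ?case by (simp add: algebra_simps)
qed simp

text \<open>The coefficient of \<open>D\<^sup>k\<close> in \<open>L\<^sub>k\<^sub>+\<^sub>2\<close>. The factor of \<open>q\<close> is the sum of \<open>i (n - i)\<close> over \<open>i \<le> k + 1\<close> in closed
  form.\<close>

lemma ic_subsubdiag: "x \<in> I \<Longrightarrow> ic (Suc (Suc k)) k x =
  real (Suc (Suc k)) * real (Suc k) / 2 * (deriv p x + (p x)\<^sup>2)
  + (real n * real (Suc (Suc k)) * real (Suc k) / 2 - real (Suc (Suc k)) * real (Suc k) * (2 * real k + 3) / 6) * q x"
proof (induction k arbitrary: x)
  case 0
  have "deriv (ic (Suc 0) 0) x = deriv p x" by simp
  then show ?case by (simp add: power2_eq_square algebra_simps)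
next
  case (Suc k)
  have "deriv (ic (Suc (Suc k)) (Suc k)) x = deriv (\<lambda>x. real (Suc (Suc k)) * p x) x"
    by (rule deriv_cong_open[OF open_I Suc.prems ic_subdiag])
  also have "\<dots> = real (Suc (Suc k)) * deriv p x"
    by (intro DERIV_imp_deriv DERIV_cmult smooth_on_DERIV[OF smooth_p Suc.prems])
  finally have "ic (Suc (Suc (Suc k))) (Suc k) x = real (Suc (Suc k)) * deriv p x + ic (Suc (Suc k)) k x
      + p x * (real (Suc (Suc k)) * p x) + real (Suc (Suc k)) * (real n - real (Suc (Suc k))) * q x"
    unfolding iter_coeff.simps(3)[of n p q "Suc k"] ic_subdiag[OF Suc.prems] iter_coeff_diag by simp
  then show ?case unfolding Suc.IH[OF Suc.prems] by (simp add: field_simps power2_eq_square)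
qed

lemma linear_ode_eq_L: "linear_ode n (ic n) x (\<lambda>j. (deriv ^^ j) y x) = L n y x"
  by (simp add: linear_ode_def iter_op_def iter_coeff_diag)

lemma DERIV_L:
  assumes "smooth_on I y" "x \<in> I"
  shows "DERIV (L k y) x :> L (Suc k) y x - p x * L k y x - \<kappa> k * q x * L (k - 1) y x"
  using smooth_on_DERIV[OF smooth_L[OF assms(1)] assms(2), of k] L_Suc[OF assms, of k] by (simp add: algebra_simps)

context
  fixes \<xi> y :: "real \<Rightarrow> real"
  assumes smooth_\<xi>: "smooth_on I \<xi>" and smooth_y: "smooth_on I y"
    and \<xi>_eq: "\<And>x. x \<in> I \<Longrightarrow> deriv (deriv (deriv \<xi>)) x = - 4 * q x * deriv \<xi> x - 2 * deriv q x * \<xi> x"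
begin

text \<open>\<open>T y\<close>, the characteristic \<open>\<phi> y - \<xi> y'\<close> of the field with \<open>\<phi> = (n - 1) / 2 \<xi>' - p \<xi>\<close> and \<open>\<beta> = 0\<close>.\<close>

definition twist :: "real \<Rightarrow> real" where
  "twist x = (real n - 1) / 2 * deriv \<xi> x * y x - \<xi> x * (deriv y x + p x * y x)"

lemma smooth_twist: "smooth_on I twist"
  unfolding twist_def[abs_def]
  by (intro smooth_on_diff smooth_on_mult smooth_on_add smooth_on_const smooth_on_deriv open_I smooth_\<xi> smooth_y smooth_p)

text \<open>The right-hand side of the commutation relation
  \<open>L\<^sub>k T = (T - k \<xi>') L\<^sub>k + k (n - k) / 2 \<xi>'' L\<^sub>k\<^sub>-\<^sub>1\<close>, in which the derivative of \<open>L\<^sub>k y\<close> inside \<open>T (L\<^sub>k y)\<close> has been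
  replaced by means of the recursion. No derivatives of the \<open>L\<^sub>k y\<close> remain, and differentiating it is mechanical.\<close>

definition twist_L :: "nat \<Rightarrow> real \<Rightarrow> real" where
  "twist_L k x = ((real n - 1) / 2 - real k) * deriv \<xi> x * L k y x
     - \<xi> x * (L (Suc k) y x - \<kappa> k * q x * L (k - 1) y x) + \<kappa> k / 2 * deriv (deriv \<xi>) x * L (k - 1) y x"

lemma DERIV_twist_L:
  assumes x: "x \<in> I"
  defines "dL k \<equiv> L (Suc k) y x - p x * L k y x - \<kappa> k * q x * L (k - 1) y x"
  shows "DERIV (twist_L k) x :>
    ((real n - 1) / 2 - real k) * (deriv (deriv \<xi>) x * L k y x + dL k * deriv \<xi> x)
     - (deriv \<xi> x * (L (Suc k) y x - \<kappa> k * (q x * L (k - 1) y x))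
        + (dL (Suc k) - \<kappa> k * (deriv q x * L (k - 1) y x + dL (k - 1) * q x)) * \<xi> x)
     + \<kappa> k / 2 * (deriv (deriv (deriv \<xi>)) x * L (k - 1) y x + dL (k - 1) * deriv (deriv \<xi>) x)"
  unfolding twist_L_def[abs_def] dL_def mult.assoc[of _ "deriv \<xi> _"] mult.assoc[of _ "q _"] mult.assoc[of _ "deriv (deriv \<xi>) _"]
  by (intro DERIV_add DERIV_diff DERIV_cmult DERIV_mult DERIV_L[OF smooth_y x, unfolded mult.assoc] smooth_on_DERIV[OF _ x]
      smooth_on_deriv smooth_\<xi> smooth_q)

text \<open>Induction along the recursion. Once it has been applied to both sides, what is left over is a constant times
  \<open>(\<xi>''' + 4 q \<xi>' + 2 q' \<xi>) L\<^sub>k y\<close>; this is where the equation for \<open>\<xi>\<close> is used.\<close>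

lemma L_twist: "x \<in> I \<Longrightarrow> L k twist x = twist_L k x"
proof (induction k arbitrary: x rule: induct_nat_012)
  case 0
  have "L 0 y = y" by (simp add: fun_eq_iff L_0)
  then show ?case using L_Suc[OF smooth_y 0, of 0] by (simp add: L_0 twist_def twist_L_def \<kappa>_def)
next
  case 1
  have "L 0 y = y" by (simp add: fun_eq_iff L_0)
  then have L0: "x \<in> I \<Longrightarrow> L 0 twist x = twist_L 0 x" for x
    using L_Suc[OF smooth_y, of x 0] by (simp add: L_0 twist_def twist_L_def \<kappa>_def)
  have "L (Suc 0) twist x = deriv (twist_L 0) x + p x * twist_L 0 x"
    using L_Suc[OF smooth_twist 1, of 0] deriv_cong_open[OF open_I 1 L0] L0[OF 1] by (simp add: \<kappa>_def)
  then show ?case unfolding DERIV_imp_deriv[OF DERIV_twist_L[OF 1, of 0]]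
    by (simp add: twist_L_def \<kappa>_def algebra_simps)
next
  case (ge2 k)
  have "L (Suc (Suc k)) twist x = deriv (twist_L (Suc k)) x + p x * twist_L (Suc k) x + \<kappa> (Suc k) * q x * twist_L k x"
    using L_Suc[OF smooth_twist ge2.prems, of "Suc k"] deriv_cong_open[OF open_I ge2.prems ge2.IH(2)]
      ge2.IH[OF ge2.prems] by simp
  then show ?case unfolding DERIV_imp_deriv[OF DERIV_twist_L[OF ge2.prems, of "Suc k"]] \<xi>_eq[OF ge2.prems]
    by (simp add: twist_L_def \<kappa>_def field_simps)
qed

text \<open>For \<open>k = n\<close> the last term of the commutation relation drops out, so \<open>T\<close> preserves the solutions of
  \<open>L\<^sub>n y = 0\<close>.\<close>

lemma L_n_twist:
  assumes "\<And>x. x \<in> I \<Longrightarrow> L n y x = 0" and x: "x \<in> I"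
  shows "L n twist x = 0"
proof -
  have "deriv (L n y) x = 0"
    using deriv_cong_open[OF open_I x, of "L n y" "\<lambda>_. 0"] assms by simp
  then have "L (Suc n) y x = 0"
    using L_Suc[OF smooth_y x, of n] assms by (simp add: \<kappa>_def)
  then show ?thesis using assms by (simp add: L_twist[OF x] twist_L_def \<kappa>_def)
qed

end

lemma L_add:
  assumes "smooth_on I f" "smooth_on I h" "x \<in> I"
  shows "L k (\<lambda>x. f x + h x) x = L k f x + L k h x"
  unfolding iter_op_def higher_deriv_add[OF open_I assms]
  by (simp add: distrib_left sum.distrib del: sum.lessThan_Suc)

lemma L_cmult:
  assumes "smooth_on I f" "x \<in> I"
  shows "L k (\<lambda>x. r * f x) x = r * L k f x"
  unfolding iter_op_def higher_deriv_cmult[OF open_I assms]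
  by (simp add: sum_distrib_left mult.left_commute del: sum.lessThan_Suc)

text \<open>The symmetry with prescribed data has for \<open>\<xi>\<close> a solution of \<open>\<xi>''' + 4 q \<xi>' + 2 q' \<xi> = 0\<close>, for \<open>\<phi>\<close> the function
  \<open>(n - 1) / 2 \<xi>' - p \<xi>\<close> plus a constant, and for \<open>\<beta>\<close> a solution of the equation. Its characteristic along a solution
  \<open>y\<close> is \<open>T y\<close> plus a multiple of \<open>y\<close> plus \<open>\<beta>\<close>, again a solution.\<close>

theorem maximal_symmetry_iterative: "maximal_symmetry n I (ic n)"
proof -
  obtain x0 where x0: "x0 \<in> I" using I by (auto simp: open_interval_def)
  note c = smooth_ic[of n]
  have "\<exists>X\<in>symmetry_algebra n I (ic n). \<forall>i<n + 4. cauchy_data x0 X i = e i" for e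
  proof -
    \<comment> \<open>the coefficients of the third-order equation for \<open>\<xi>\<close>\<close>
    define d where "d j = (if j = (0::nat) then (\<lambda>x. 2 * deriv q x) else if j = 1 then (\<lambda>x. 4 * q x) else (\<lambda>x. 0))" for j
    have "smooth_on I (d j)" for j
      by (auto simp: d_def intro!: smooth_on_mult open_I smooth_on_deriv smooth_q)
    then obtain \<xi> where \<xi>: "smooth_on I \<xi>" "\<And>x. x \<in> I \<Longrightarrow> linear_ode 3 d x (\<lambda>j. (deriv ^^ j) \<xi> x) = 0"
      "\<And>j. j < 3 \<Longrightarrow> (deriv ^^ j) \<xi> x0 = e j"
      using linear_ode_exists[where n=3 and c=d and v=e, OF I _ x0] by auto
    have \<xi>_eq: "deriv (deriv (deriv \<xi>)) x = - 4 * q x * deriv \<xi> x - 2 * deriv q x * \<xi> x" if "x \<in> I" for x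
      using \<xi>(2)[OF that] by (simp add: linear_ode_def d_def eval_nat_numeral)
    obtain \<beta> where \<beta>: "smooth_on I \<beta>" "\<And>x. x \<in> I \<Longrightarrow> linear_ode n (ic n) x (\<lambda>j. (deriv ^^ j) \<beta> x) = 0"
      "\<And>j. j < n \<Longrightarrow> (deriv ^^ j) \<beta> x0 = e (j + 4)"
      using linear_ode_exists[where n=n and c="ic n" and v="\<lambda>j. e (j + 4)", OF I c x0] n by auto
    \<comment> \<open>the constant that gives \<open>\<phi>\<close> the prescribed value at \<open>x0\<close>\<close>
    define K where "K = e 3 - ((real n - 1) / 2 * deriv \<xi> x0 - p x0 * \<xi> x0)"
    define \<phi> where "\<phi> x = (real n - 1) / 2 * deriv \<xi> x - p x * \<xi> x + K" for x
    define X where "X z = (if fst z \<in> I then (\<xi> (fst z), \<phi> (fst z) * snd z + \<beta> (fst z)) else 0)" for z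
    have smooth_\<phi>: "smooth_on I \<phi>" unfolding \<phi>_def[abs_def]
      by (intro smooth_on_add smooth_on_diff smooth_on_mult smooth_on_const smooth_on_deriv open_I \<xi>(1) smooth_p)
    have lX: "affine_field I X \<xi> \<phi> \<beta>"
      by unfold_locales (auto simp: X_def open_I \<xi>(1) \<beta>(1) smooth_\<phi>)
    have "X \<in> symmetry_algebra n I (ic n)"
    proof (rule symmetry_if_characteristic_solution[OF I _ lX _ c])
      show "0 < n" using n by simp
      show "X z = 0" if "z \<notin> I \<times> UNIV" for z using that by (cases z) (simp add: X_def)
      fix y x assume y: "smooth_on I y" "\<And>x. x \<in> I \<Longrightarrow> linear_ode n (ic n) x (\<lambda>j. (deriv ^^ j) y x) = 0" and x: "x \<in> I"
      have Ly: "L n y x = 0" "L n \<beta> x = 0" if "x \<in> I" for x using y(2)[OF that] \<beta>(2)[OF that] by (simp_all add: linear_ode_eq_L)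
      have Q: "(\<lambda>x. \<phi> x * y x + \<beta> x - \<xi> x * deriv y x) = (\<lambda>x. twist \<xi> y x + (K * y x + \<beta> x))"
        by (auto simp: twist_def[OF \<xi>(1) y(1) \<xi>_eq] \<phi>_def algebra_simps)
      have "L n (\<lambda>x. twist \<xi> y x + (K * y x + \<beta> x)) x = L n (twist \<xi> y) x + (K * L n y x + L n \<beta> x)"
        using L_add[OF smooth_twist[OF \<xi>(1) y(1) \<xi>_eq] smooth_on_add[OF open_I smooth_on_mult[OF open_I smooth_on_const y(1)] \<beta>(1)] x]
          L_add[OF smooth_on_mult[OF open_I smooth_on_const y(1)] \<beta>(1) x] L_cmult[OF y(1) x] by simp
      also have "\<dots> = 0" using L_n_twist[OF \<xi>(1) y(1) \<xi>_eq Ly(1) x] Ly[OF x] by simp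
      finally show "linear_ode n (ic n) x (\<lambda>j. (deriv ^^ j) (\<lambda>x. \<phi> x * y x + \<beta> x - \<xi> x * deriv y x) x) = 0"
        unfolding Q linear_ode_eq_L .
    qed
    moreover have "cauchy_data x0 X i = e i" if "i < n + 4" for i
    proof -
      have of: "xi_of X x = \<xi> x" "phi_of X x = \<phi> x" "beta_of X x = \<beta> x" if "x \<in> I" for x
        using that by (simp_all add: xi_of_def phi_of_def beta_of_def X_def)
      have "(deriv ^^ k) (xi_of X) x0 = (deriv ^^ k) \<xi> x0" "(deriv ^^ k) (beta_of X) x0 = (deriv ^^ k) \<beta> x0" for k
        by (rule higher_deriv_cong_open[OF open_I _ x0], simp add: of)+
      then show ?thesis
        using \<xi>(3)[of i] \<beta>(3)[of "i - 4"] that x0 by (auto simp: cauchy_data_def of \<phi>_def K_def)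
    qed
    ultimately show ?thesis by blast
  qed
  then show ?thesis
    using maximal_symmetry_iff_cauchy_data_onto[where c="ic n", OF I n c x0] by blast
qed

end

section \<open>Prescribing the two leading coefficients\<close>

text \<open>The functions \<open>p\<close> and \<open>q\<close> for which \<open>L\<^sub>n\<close> has \<open>a\<close> and \<open>b\<close> as the coefficients of \<open>D\<^sup>n\<^sup>-\<^sup>1\<close> and \<open>D\<^sup>n\<^sup>-\<^sup>2\<close>.\<close>

definition normal_p :: "nat \<Rightarrow> (real \<Rightarrow> real) \<Rightarrow> real \<Rightarrow> real" where
  "normal_p n a x = 1 / real n * a x"

definition normal_q :: "nat \<Rightarrow> (real \<Rightarrow> real) \<Rightarrow> (real \<Rightarrow> real) \<Rightarrow> real \<Rightarrow> real" where
  "normal_q n a b x = 6 / (real n * (real n - 1) * (real n + 1)) *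
     (b x + (- real n * (real n - 1) / 2) * (deriv (normal_p n a) x + normal_p n a x * normal_p n a x))"

definition canonical_coeff :: "nat \<Rightarrow> (real \<Rightarrow> real) \<Rightarrow> (real \<Rightarrow> real) \<Rightarrow> nat \<Rightarrow> real \<Rightarrow> real" where
  "canonical_coeff n a b = iter_coeff n (normal_p n a) (normal_q n a b) n"

lemma smooth_on_normal_p: "open I \<Longrightarrow> smooth_on I a \<Longrightarrow> smooth_on I (normal_p n a)"
  unfolding normal_p_def[abs_def] by (intro smooth_on_mult smooth_on_const)

lemma smooth_on_normal_q:
  "open I \<Longrightarrow> smooth_on I a \<Longrightarrow> smooth_on I b \<Longrightarrow> smooth_on I (normal_q n a b)"
  unfolding normal_q_def[abs_def]
  by (intro smooth_on_mult smooth_on_add smooth_on_const smooth_on_deriv smooth_on_normal_p)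

lemma iterative_equation_normal:
  assumes "open_interval I" "3 \<le> n" "smooth_on I a" "smooth_on I b"
  shows "iterative_equation I n (normal_p n a) (normal_q n a b)"
  using assms by unfold_locales (auto intro: smooth_on_normal_p smooth_on_normal_q simp: open_interval_def)

lemma canonical_coeff_properties:
  assumes "open_interval I" "3 \<le> n" "smooth_on I a" "smooth_on I b"
  shows "smooth_on I (canonical_coeff n a b j)" "maximal_symmetry n I (canonical_coeff n a b)"
    "x \<in> I \<Longrightarrow> canonical_coeff n a b (n - 1) x = a x"
    "x \<in> I \<Longrightarrow> canonical_coeff n a b (n - 2) x = b x"
proof -
  interpret iterative_equation I n "normal_p n a" "normal_q n a b"
    by (rule iterative_equation_normal[OF assms])
  show "smooth_on I (canonical_coeff n a b j)" "maximal_symmetry n I (canonical_coeff n a b)"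
    unfolding canonical_coeff_def by (rule smooth_ic, rule maximal_symmetry_iterative)
  obtain k where k: "n = Suc (Suc k)" using assms(2) by (cases n; cases "n - 1") auto
  assume x: "x \<in> I"
  show "canonical_coeff n a b (n - 1) x = a x"
    using ic_subdiag[OF x, of "Suc k"] k by (simp add: canonical_coeff_def normal_p_def del: iter_coeff.simps)
  define D where "D = deriv (normal_p n a) x + (normal_p n a x)\<^sup>2"
  define N where "N = real n"
  have N: "N \<noteq> 0" "N - 1 \<noteq> 0" "N + 1 \<noteq> 0" "real k = N - 2" using assms(2) k by (auto simp: N_def)
  have q: "normal_q n a b x = 6 / (N * (N - 1) * (N + 1)) * (b x - N * (N - 1) / 2 * D)"
    by (simp add: normal_q_def D_def N_def power2_eq_square)
  have "canonical_coeff n a b (n - 2) x = N * (N - 1) / 2 * D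
     + (N * N * (N - 1) / 2 - N * (N - 1) * (2 * (N - 2) + 3) / 6) * normal_q n a b x"
  proof -
    have "n - 2 = k" using k by simp
    moreover have "real (Suc k) = N - 1" using N(4) by simp
    ultimately show ?thesis
      using ic_subsubdiag[OF x, of k] N(4)
      unfolding canonical_coeff_def k[symmetric] D_def[symmetric] N_def[symmetric] by simp
  qed
  also have "N * N * (N - 1) / 2 - N * (N - 1) * (2 * (N - 2) + 3) / 6 = N * (N - 1) * (N + 1) / 6"
    by (simp add: field_simps)
  finally show "canonical_coeff n a b (n - 2) x = b x"
    unfolding q using N by (simp, simp add: field_simps)
qed

section \<open>Dependence on finitely many derivatives\<close>

text \<open>Dependence of the canonical coefficients on the derivatives of \<open>a\<close> and \<open>b\<close> at a point is expressed by a
  comparison of two pairs of functions at two points, of possibly different intervals. This relation is compatible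
  with sums and products, and derivatives cost one order, so no explicit formula for the dependence is needed.\<close>

definition jets_agree :: "nat \<Rightarrow> (real \<Rightarrow> real) \<Rightarrow> real \<Rightarrow> (real \<Rightarrow> real) \<Rightarrow> real \<Rightarrow> bool" where
  "jets_agree M f x g y \<longleftrightarrow> (\<forall>k\<le>M. (deriv ^^ k) f x = (deriv ^^ k) g y)"

lemma jets_agree_mono: "jets_agree M f x g y \<Longrightarrow> N \<le> M \<Longrightarrow> jets_agree N f x g y"
  by (simp add: jets_agree_def)

lemma jets_agree_Suc: "jets_agree (Suc M) f x g y \<longleftrightarrow> f x = g y \<and> jets_agree M (deriv f) x (deriv g) y"
proof -
  have "(\<forall>k\<le>Suc M. P k) \<longleftrightarrow> P 0 \<and> (\<forall>k\<le>M. P (Suc k))" for P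
    by (metis Suc_le_mono le0 not0_implies_Suc)
  then show ?thesis by (simp add: jets_agree_def funpow_swap1)
qed

lemma jets_agree_deriv: "jets_agree (Suc M) f x g y \<Longrightarrow> jets_agree M (deriv f) x (deriv g) y"
  by (simp add: jets_agree_Suc)

locale two_points =
  fixes I J :: "real set" and x y :: real
  assumes open_I: "open I" and open_J: "open J" and x: "x \<in> I" and y: "y \<in> J"
begin

lemma jets_agree_add:
  assumes "jets_agree M f x g y" "jets_agree M h x k y"
    and "smooth_on I f" "smooth_on I h" "smooth_on J g" "smooth_on J k"
  shows "jets_agree M (\<lambda>t. f t + h t) x (\<lambda>t. g t + k t) y"
  using assms by (simp add: jets_agree_def higher_deriv_add[OF open_I _ _ x] higher_deriv_add[OF open_J _ _ y])

lemma jets_agree_cong: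
  assumes "jets_agree M f x g y" "\<And>t. t \<in> I \<Longrightarrow> f t = f' t" "\<And>t. t \<in> J \<Longrightarrow> g t = g' t"
  shows "jets_agree M f' x g' y"
  using assms(1) higher_deriv_cong_open[OF open_I assms(2) x] higher_deriv_cong_open[OF open_J assms(3) y]
  by (simp add: jets_agree_def)

lemma jets_agree_mult:
  assumes "jets_agree M f x g y" "jets_agree M h x k y"
    and "smooth_on I f" "smooth_on I h" "smooth_on J g" "smooth_on J k"
  shows "jets_agree M (\<lambda>t. f t * h t) x (\<lambda>t. g t * k t) y"
  using assms
proof (induction M arbitrary: f g h k)
  case 0
  then show ?case by (simp add: jets_agree_def)
next
  case (Suc M)
  have d: "deriv (\<lambda>t. f t * h t) t = deriv f t * h t + deriv h t * f t"
    if "smooth_on S f" "smooth_on S h" "t \<in> S" for S t and f h :: "real \<Rightarrow> real"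
    by (intro DERIV_imp_deriv DERIV_mult smooth_on_DERIV[OF _ that(3)] that)
  have low: "jets_agree M f x g y" "jets_agree M h x k y"
    using Suc.prems(1,2) by (auto intro: jets_agree_mono)
  have "jets_agree M (\<lambda>t. deriv f t * h t + deriv h t * f t) x (\<lambda>t. deriv g t * k t + deriv k t * g t) y"
    by (intro jets_agree_add Suc.IH smooth_on_mult smooth_on_deriv open_I open_J Suc.prems(3-6) low
        jets_agree_deriv Suc.prems(1,2))
  then have "jets_agree M (deriv (\<lambda>t. f t * h t)) x (deriv (\<lambda>t. g t * k t)) y"
    by (rule jets_agree_cong) (use d Suc.prems in auto)
  then show ?case using Suc.prems(1,2) by (simp add: jets_agree_Suc)
qed

lemma jets_agree_const: "jets_agree M (\<lambda>_. r) x (\<lambda>_. r) y"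
proof (induction M arbitrary: r)
  case 0
  then show ?case by (simp add: jets_agree_def)
next
  case (Suc M)
  have "deriv (\<lambda>_. r :: real) = (\<lambda>_. 0)" by auto
  then show ?case using Suc by (simp add: jets_agree_Suc)
qed

lemma jets_agree_iter_coeff:
  assumes eqI: "iterative_equation I n p q" and eqJ: "iterative_equation J n p' q'"
    and "jets_agree (M + k) p x p' y" "jets_agree (M + k) q x q' y"
  shows "jets_agree M (iter_coeff n p q k j) x (iter_coeff n p' q' k j) y"
  using assms(3,4)
proof (induction k arbitrary: j M rule: induct_nat_012)
  case 0
  then show ?case using jets_agree_const by simp
next
  case 1
  then have "jets_agree M p x p' y" by (auto intro: jets_agree_mono)
  then show ?case using jets_agree_const by (cases "j = 0"; cases "j = 1") auto
next
  case (ge2 k)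
  interpret I: iterative_equation I n p q by fact
  interpret J: iterative_equation J n p' q' by fact
  have IH: "jets_agree (Suc M) (I.ic (Suc k) i) x (J.ic (Suc k) i) y" for i
    by (rule ge2.IH(2)) (use ge2.prems in auto)
  have IH': "jets_agree M (I.ic (Suc k) i) x (J.ic (Suc k) i) y" for i
    using IH[of i] by (rule jets_agree_mono) simp
  have IH0: "jets_agree M (I.ic k j) x (J.ic k j) y"
    by (rule ge2.IH(1)) (use ge2.prems in \<open>auto intro: jets_agree_mono\<close>)
  have pq: "jets_agree M p x p' y" "jets_agree M q x q' y"
    using ge2.prems by (auto intro: jets_agree_mono)
  have if_agree: "jets_agree M (\<lambda>t. if P then 0 else f t) x (\<lambda>t. if P then 0 else g t) y" if "jets_agree M f x g y" for P f g
    using that jets_agree_const by (cases P) auto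
  show ?case unfolding iter_coeff.simps
    by (intro jets_agree_add jets_agree_mult if_agree smooth_on_if jets_agree_deriv IH IH' IH0 pq jets_agree_const
        smooth_on_add smooth_on_mult smooth_on_const smooth_on_deriv open_I open_J I.smooth_ic J.smooth_ic
        I.smooth_p I.smooth_q J.smooth_p J.smooth_q)
qed

lemma jets_agree_canonical_coeff:
  assumes I: "open_interval I" and J: "open_interval J" and n: "3 \<le> n"
    and a: "smooth_on I a" "smooth_on J a'" "jets_agree (Suc n) a x a' y"
    and b: "smooth_on I b" "smooth_on J b'" "jets_agree (Suc n) b x b' y"
  shows "canonical_coeff n a b j x = canonical_coeff n a' b' j y"
proof -
  have p: "jets_agree (Suc n) (normal_p n a) x (normal_p n a') y"
    unfolding normal_p_def[abs_def] by (intro jets_agree_mult jets_agree_const smooth_on_const a)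
  then have p': "jets_agree n (normal_p n a) x (normal_p n a') y" by (rule jets_agree_mono) simp
  have b': "jets_agree n b x b' y" using b(3) by (rule jets_agree_mono) simp
  have q: "jets_agree n (normal_q n a b) x (normal_q n a' b') y"
    unfolding normal_q_def[abs_def]
    by (intro jets_agree_mult jets_agree_add jets_agree_const jets_agree_deriv p p' b' smooth_on_const smooth_on_mult
        smooth_on_add smooth_on_deriv smooth_on_normal_p open_I open_J a b)
  have "jets_agree 0 (canonical_coeff n a b j) x (canonical_coeff n a' b' j) y"
    unfolding canonical_coeff_def
    by (rule jets_agree_iter_coeff[OF iterative_equation_normal[OF I n a(1) b(1)] iterative_equation_normal[OF J n a(2) b(2)]])
      (use p' q in simp_all)
  then show ?thesis by (simp add: jets_agree_def)
qed

end

lemma derivs_eq_imp_jets_agree: "derivs (Suc M) f x = derivs (Suc M) g y \<Longrightarrow> jets_agree M f x g y"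
  by (simp add: derivs_def jets_agree_def less_Suc_eq_le del: upt_Suc)

section \<open>Equations with maximal symmetry\<close>

text \<open>\<open>F j\<close> takes the value of the canonical \<open>j\<close>-th coefficient for an arbitrary pair of functions with the given
  derivatives at some point; the choice does not affect the value. The order of the derivatives is at most
  \<open>n + 1\<close>: the recursion differentiates \<open>n\<close> times at most, and \<open>q\<close> contains \<open>p'\<close>.\<close>

theorem proposition1:
  fixes n :: nat
  assumes "n \<ge> 3"
  shows "\<exists>(N :: nat) (F :: nat \<Rightarrow> real list \<Rightarrow> real list \<Rightarrow> real).
    (\<forall>I c. open_interval I \<and> (\<forall>j<n. smooth_on I (c j)) \<and> maximal_symmetry n I c \<longrightarrow>
       (\<forall>j\<le>n - 3. \<forall>x\<in>I. c j x = F j (derivs N (c (n - 1)) x) (derivs N (c (n - 2)) x))) \<and>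
    (\<forall>I a b. open_interval I \<and> smooth_on I a \<and> smooth_on I b \<longrightarrow>
       (\<exists>c. (\<forall>j<n. smooth_on I (c j)) \<and> maximal_symmetry n I c \<and>
            (\<forall>x\<in>I. c (n - 1) x = a x \<and> c (n - 2) x = b x)))"
proof -
  define N where "N = Suc (Suc n)"
  define R where "R j la lb r \<longleftrightarrow> (\<exists>I a b x. open_interval I \<and> smooth_on I a \<and> smooth_on I b \<and> x \<in> I \<and>
      derivs N a x = la \<and> derivs N b x = lb \<and> r = canonical_coeff n a b j x)" for j la lb r
  define F where "F j la lb = (SOME r. R j la lb r)" for j la lb
  have F_eq: "F j (derivs N a x) (derivs N b x) = canonical_coeff n a b j x"
    if I: "open_interval I" "smooth_on I a" "smooth_on I b" "x \<in> I" for I a b x j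
  proof -
    have "R j (derivs N a x) (derivs N b x) (canonical_coeff n a b j x)"
      unfolding R_def using I by blast
    then have "R j (derivs N a x) (derivs N b x) (F j (derivs N a x) (derivs N b x))"
      unfolding F_def by (rule someI)
    then obtain J a' b' y where J: "open_interval J" "smooth_on J a'" "smooth_on J b'" "y \<in> J"
      "derivs N a' y = derivs N a x" "derivs N b' y = derivs N b x"
      "F j (derivs N a x) (derivs N b x) = canonical_coeff n a' b' j y"
      unfolding R_def by blast
    interpret two_points J I y x
      using I J by unfold_locales (auto simp: open_interval_def)
    show ?thesis
      unfolding J(7)
      by (rule jets_agree_canonical_coeff[OF J(1) I(1) assms J(2) I(2) _ J(3) I(3)])
        (use J(5,6) in \<open>auto simp: N_def intro: derivs_eq_imp_jets_agree\<close>)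
  qed
  have "c j x = F j (derivs N (c (n - 1)) x) (derivs N (c (n - 2)) x)"
    if I: "open_interval I" and c: "\<forall>j<n. smooth_on I (c j)" and max: "maximal_symmetry n I c"
      and "j \<le> n - 3" and x: "x \<in> I" for I c j x
  proof -
    have c': "\<And>j. j < n \<Longrightarrow> smooth_on I (c j)" using c by blast
    have ab: "smooth_on I (c (n - 1))" "smooth_on I (c (n - 2))" using c' assms by auto
    note can = canonical_coeff_properties[OF I assms ab]
    have "c j x = canonical_coeff n (c (n - 1)) (c (n - 2)) j x"
      by (rule maximal_symmetry_unique[OF I assms c' can(1) max can(2) can(3)[symmetric] can(4)[symmetric]])
        (use assms \<open>j \<le> n - 3\<close> x in auto)
    also have "\<dots> = F j (derivs N (c (n - 1)) x) (derivs N (c (n - 2)) x)"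
      by (rule F_eq[OF I ab x, symmetric])
    finally show ?thesis .
  qed
  moreover have "\<exists>c. (\<forall>j<n. smooth_on I (c j)) \<and> maximal_symmetry n I c \<and>
      (\<forall>x\<in>I. c (n - 1) x = a x \<and> c (n - 2) x = b x)"
    if "open_interval I" "smooth_on I a" "smooth_on I b" for I a b
    using canonical_coeff_properties[OF that(1) assms that(2,3)] by blast
  ultimately show ?thesis by blast
qed

end
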